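(* Let $F:\mathbb{R}^n\rightrightarrows\mathbb{R}^n$ be a set-valued mapping, let $(\bar x,\bar y)\in\mathrm{gph}\,F$, and let $\mathrm{gph}\,F$ be locally closed around $(\bar x,\bar y)$. (i) If $F$ is strongly metrically regular around $(\bar x,\bar y)$, then $F$ is graphically Lipschitzian of dimension $n$ at $(\bar x,\bar y)$ with transformation mapping $\Phi(x,y)=(y,x)$, and for this $\Phi$ one has $\{\mathrm{rge}\,Z\mid Z\in\mathrm{conv}\,\overline{\nabla}{}^{\Phi}F(\bar x,\bar y)\}\subseteq\mathcal{Z}_n^{\rm reg}$. Further, $F$ is SCD regular around $(\bar x,\bar y)$ and $\mathrm{reg}\,F(\bar x,\bar y)=\mathrm{scd\,reg}\,F(\bar x,\bar y)$. (ii) Conversely, if $F$ is graphically Lipschitzian of dimension $n$ at $(\bar x,\bar y)$ with some transformation mapping $\Phi$ such that $\{\mathrm{rge}\,Z\mid Z\in\mathrm{conv}\,\overline{\nabla}{}^{\Phi}F(\bar x,\bar y)\}\subseteq\mathcal{Z}_n^{\rm reg}$, then $F$ is strongly metrically regular around $(\bar x,\bar y)$.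
   Context: Norms are Euclidean (operator norm for matrices). $\mathrm{gph}\,F=\{(x,y)\mid y\in F(x)\}$. For a set $A$ and $\bar z\in A$, the tangent cone $T_A(\bar z)$ is the set of all $w$ for which there are $t_k\downarrow0$, $w_k\to w$ with $\bar z+t_kw_k\in A$ for all $k$. Subspaces. $\mathcal{Z}_n$ is the set of $n$-dimensional linear subspaces of $\mathbb{R}^{2n}=\mathbb{R}^n\times\mathbb{R}^n$ with metric $d_{\mathcal{Z}}(L_1,L_2)=\|P_1-P_2\|$, $P_i$ the orthogonal projection onto $L_i$. For $L\in\mathcal{Z}_n$, $L^*:=\{(-v^*,u^* )\mid(u^*,v^* )\in L^\perp\}$. For a $2n\times n$ matrix $Z$, $\mathrm{rge}\,Z$ is its range, and for any $2n$-row matrix (or vector), $\pi_1$ and $\pi_2$ denote the blocks of the first $n$ and the last $n$ rows. $\mathcal{Z}_n^{\rm reg}$ is the set of all $L\in\mathcal{Z}_n$ such that $(y^*,0)\in L\Rightarrow y^*=0$. SCD notions. $\mathcal{O}_F$ is the set of $(x,y)\in\mathrm{gph}\,F$ for which $T_{\mathrm{gph}\,F}(x,y)\in\mathcal{Z}_n$. For $(x,y)\in\mathrm{gph}\,F$, $\mathcal{S}F(x,y)$ (resp. $\mathcal{S}^*F(x,y)$) is the set of all $L\in\mathcal{Z}_n$ for which there is a sequence $(x_k,y_k)\to(x,y)$ in $\mathcal{O}_F$ with $d_{\mathcal{Z}}(L,T_{\mathrm{gph}\,F}(x_k,y_k))\to0$ (resp. $d_{\mathcal{Z}}(L,T_{\mathrm{gph}\,F}(x_k,y_k)^*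 )\to0$). $F$ has the SCD property at $(x,y)$ if $\mathcal{S}^*F(x,y)\neq\emptyset$, and around $(x,y)$ if it has it at all points of $\mathrm{gph}\,F$ in some neighborhood of $(x,y)$. $F$ is SCD regular around $(x,y)$ if it has the SCD property around $(x,y)$ and $\mathcal{S}^*F(x,y)\subseteq\mathcal{Z}_n^{\rm reg}$; its modulus is $\mathrm{scd\,reg}\,F(x,y):=\sup\{\|y^*\|\mid (y^*,x^* )\in L \text{ for some }L\in\mathcal{S}^*F(x,y),\ \|x^*\|\le1\}$. Graphically Lipschitzian. $F$ is graphically Lipschitzian of dimension $n$ at $(\bar x,\bar y)$ with transformation mapping $\Phi$ if there is an open neighborhood $W$ of $(\bar x,\bar y)$ such that $\Phi$ is a one-to-one mapping from $W$ onto an open subset of $\mathbb{R}^{2n}$, $\Phi$ and $\Phi^{-1}$ are continuously differentiable, and $\Phi(\mathrm{gph}\,F\cap W)$ is the graph of a Lipschitz continuous mapping $f:U\to\mathbb{R}^n$ with $U\subseteq\mathbb{R}^n$ open. In that case $\overline{\nabla}{}^{\Phi}F(\bar x,\bar y)$ denotes the set of all $2n\times n$ matrices $Z$ such that $\mathrm{rge}\,Z\in\mathcal{S}F(\bar x,\bar y)$ and $\pi_1(\nabla\Phi(\bar x,\bar y)Z)=I$; $\mathrm{conv}$ is the convex hull. Metric regularity. $F$ is metrically regular around $(\bar x,\bar y)$ if there are $\kappa\ge0$ and neighborhoods $X$ of $\bar x$, $Y$ of $\bar y$ with $\mathrm{dist}(x,F^{-1}(y))\le\kappa\,\mathrm{dist}(y,F(x))$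 for all $(x,y)\in X\times Y$; $\mathrm{reg}\,F(\bar x,\bar y)$ is the infimum of all such $\kappa$ (over all choices of neighborhoods). $F$ is strongly metrically regular around $(\bar x,\bar y)$ if, in addition, there are open neighborhoods $Y'$ of $\bar y$, $X'$ of $\bar x$ and a mapping $h:Y'\to\mathbb{R}^n$ with $h(\bar y)=\bar x$ and $\mathrm{gph}\,F\cap(X'\times Y')=\{(h(y),y)\mid y\in Y'\}$. *)

theory Defs
  imports "HOL-Analysis.Analysis"
begin

text \<open>
  The Euclidean space of dimension \<open>n\<close> is \<open>real ^ 'n\<close> with \<open>n = CARD('n)\<close>, and its square is the
  product type, whose norm is the Euclidean one.  A real matrix of size \<open>2n \<times> n\<close> is represented by
  the linear map it induces, of type \<open>(real ^ 'n) \<Rightarrow>\<^sub>L ((real ^ 'n) \<times> (real ^ 'n))\<close>; the norm of that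
  type is the operator norm.  The blocks \<open>\<pi>\<^sub>1\<close> and \<open>\<pi>\<^sub>2\<close> are \<open>fst\<close> and \<open>snd\<close>.
\<close>

definition gph :: "('a \<Rightarrow> 'b set) \<Rightarrow> ('a \<times> 'b) set" where
  "gph F = {(x, y). y \<in> F x}"

definition inv_map :: "('a \<Rightarrow> 'b set) \<Rightarrow> 'b \<Rightarrow> 'a set" where
  "inv_map F y = {x. y \<in> F x}"

definition locally_closed_around :: "'a::topological_space set \<Rightarrow> 'a \<Rightarrow> bool" where
  "locally_closed_around A z \<longleftrightarrow> (\<exists>V. closed V \<and> z \<in> interior V \<and> closed (A \<inter> V))"

definition tangent_cone :: "'a::real_normed_vector set \<Rightarrow> 'a \<Rightarrow> 'a set" where
  "tangent_cone A z = {w. \<exists>t :: nat \<Rightarrow> real. \<exists>ws :: nat \<Rightarrow> 'a.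
     (\<forall>k. t k > 0) \<and> t \<longlonglongrightarrow> 0 \<and> ws \<longlonglongrightarrow> w \<and> (\<forall>k. z + t k *\<^sub>R ws k \<in> A)}"


subsection \<open>Subspaces\<close>

definition Zn :: "((real ^ 'n) \<times> (real ^ 'n)) set set" where
  "Zn = {L. subspace L \<and> dim L = CARD('n)}"

definition proj :: "'a::real_inner set \<Rightarrow> 'a \<Rightarrow> 'a" where
  "proj L z = (THE w. w \<in> L \<and> z - w \<in> L\<^sup>\<bottom>)"

definition dZ :: "'a::real_inner set \<Rightarrow> 'a set \<Rightarrow> real" where
  "dZ L1 L2 = onorm (\<lambda>z. proj L1 z - proj L2 z)"

definition adj :: "((real ^ 'n) \<times> (real ^ 'n)) set \<Rightarrow> ((real ^ 'n) \<times> (real ^ 'n)) set" where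
  "adj L = {(- v, u) | u v. (u, v) \<in> L\<^sup>\<bottom>}"

definition Zn_reg :: "((real ^ 'n) \<times> (real ^ 'n)) set set" where
  "Zn_reg = {L \<in> Zn. \<forall>y. (y, 0) \<in> L \<longrightarrow> y = 0}"


subsection \<open>SCD notions\<close>

definition O_set :: "(real ^ 'n \<Rightarrow> (real ^ 'n) set) \<Rightarrow> ((real ^ 'n) \<times> (real ^ 'n)) set" where
  "O_set F = {z \<in> gph F. tangent_cone (gph F) z \<in> Zn}"

definition SF :: "(real ^ 'n \<Rightarrow> (real ^ 'n) set) \<Rightarrow> (real ^ 'n) \<times> (real ^ 'n)
    \<Rightarrow> ((real ^ 'n) \<times> (real ^ 'n)) set set" where
  "SF F z = {L \<in> Zn. \<exists>zs :: nat \<Rightarrow> (real ^ 'n) \<times> (real ^ 'n).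
     (\<forall>k. zs k \<in> O_set F) \<and> zs \<longlonglongrightarrow> z \<and>
     (\<lambda>k. dZ L (tangent_cone (gph F) (zs k))) \<longlonglongrightarrow> 0}"

definition SF_adj :: "(real ^ 'n \<Rightarrow> (real ^ 'n) set) \<Rightarrow> (real ^ 'n) \<times> (real ^ 'n)
    \<Rightarrow> ((real ^ 'n) \<times> (real ^ 'n)) set set" where
  "SF_adj F z = {L \<in> Zn. \<exists>zs :: nat \<Rightarrow> (real ^ 'n) \<times> (real ^ 'n).
     (\<forall>k. zs k \<in> O_set F) \<and> zs \<longlonglongrightarrow> z \<and>
     (\<lambda>k. dZ L (adj (tangent_cone (gph F) (zs k)))) \<longlonglongrightarrow> 0}"

definition SCD_at :: "(real ^ 'n \<Rightarrow> (real ^ 'n) set) \<Rightarrow> (real ^ 'n) \<times> (real ^ 'n) \<Rightarrow> bool" where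
  "SCD_at F z \<longleftrightarrow> SF_adj F z \<noteq> {}"

definition SCD_around :: "(real ^ 'n \<Rightarrow> (real ^ 'n) set) \<Rightarrow> (real ^ 'n) \<times> (real ^ 'n) \<Rightarrow> bool" where
  "SCD_around F z \<longleftrightarrow> (\<exists>W. open W \<and> z \<in> W \<and> (\<forall>z' \<in> gph F \<inter> W. SCD_at F z'))"

definition SCD_regular :: "(real ^ 'n \<Rightarrow> (real ^ 'n) set) \<Rightarrow> (real ^ 'n) \<times> (real ^ 'n) \<Rightarrow> bool" where
  "SCD_regular F z \<longleftrightarrow> SCD_around F z \<and> SF_adj F z \<subseteq> Zn_reg"

definition scd_reg :: "(real ^ 'n \<Rightarrow> (real ^ 'n) set) \<Rightarrow> (real ^ 'n) \<times> (real ^ 'n) \<Rightarrow> ereal" where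
  "scd_reg F z = Sup {ereal (norm y) | y. \<exists>L x. L \<in> SF_adj F z \<and> (y, x) \<in> L \<and> norm x \<le> 1}"


subsection \<open>Graphically Lipschitzian mappings\<close>

definition C1_on :: "('a::real_normed_vector \<Rightarrow> 'b::real_normed_vector) \<Rightarrow> 'a set \<Rightarrow> bool" where
  "C1_on f W \<longleftrightarrow> (\<exists>f' :: 'a \<Rightarrow> 'a \<Rightarrow>\<^sub>L 'b.
     (\<forall>z\<in>W. (f has_derivative blinfun_apply (f' z)) (at z)) \<and> continuous_on W f')"

text \<open>Only the values of \<open>\<Phi>\<close> on \<open>W\<close> and of \<open>f\<close> on \<open>U\<close> matter.\<close>

definition graphically_Lipschitzian ::
  "(real ^ 'n \<Rightarrow> (real ^ 'n) set) \<Rightarrow> (real ^ 'n) \<times> (real ^ 'n)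
    \<Rightarrow> ((real ^ 'n) \<times> (real ^ 'n) \<Rightarrow> (real ^ 'n) \<times> (real ^ 'n)) \<Rightarrow> bool" where
  "graphically_Lipschitzian F z \<Phi> \<longleftrightarrow>
     (\<exists>W. open W \<and> z \<in> W \<and> inj_on \<Phi> W \<and> open (\<Phi> ` W) \<and>
        C1_on \<Phi> W \<and> C1_on (inv_into W \<Phi>) (\<Phi> ` W) \<and>
        (\<exists>U (f :: real ^ 'n \<Rightarrow> real ^ 'n) K. open U \<and> K-lipschitz_on U f \<and>
           \<Phi> ` (gph F \<inter> W) = {(u, f u) | u. u \<in> U}))"

definition nabla_bar ::
  "((real ^ 'n) \<times> (real ^ 'n) \<Rightarrow> (real ^ 'n) \<times> (real ^ 'n))
    \<Rightarrow> (real ^ 'n \<Rightarrow> (real ^ 'n) set) \<Rightarrow> (real ^ 'n) \<times> (real ^ 'n)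
    \<Rightarrow> ((real ^ 'n) \<Rightarrow>\<^sub>L ((real ^ 'n) \<times> (real ^ 'n))) set" where
  "nabla_bar \<Phi> F z = {Z. range (blinfun_apply Z) \<in> SF F z \<and>
     (\<forall>p. fst (frechet_derivative \<Phi> (at z) (blinfun_apply Z p)) = p)}"


subsection \<open>Metric regularity\<close>

text \<open>The distance to the empty set is \<open>\<infinity>\<close>, unlike for \<open>infdist\<close> and \<open>setdist\<close>.\<close>

definition set_dist :: "'a::metric_space \<Rightarrow> 'a set \<Rightarrow> ereal" where
  "set_dist x A = (INF a\<in>A. ereal (dist x a))"

text \<open>
  If \<open>F x = {}\<close> and \<open>\<kappa> = 0\<close>, the right-hand side below is \<open>0 * \<infinity> = 0\<close>.  Taking \<open>0 * \<infinity> = \<infinity>\<close> instead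
  could only make \<open>\<kappa> = 0\<close> admissible in cases where every \<open>\<kappa> > 0\<close> is admissible, so neither metric
  regularity nor the modulus depends on this convention.
\<close>

definition metric_reg_const ::
  "('a::metric_space \<Rightarrow> 'b::metric_space set) \<Rightarrow> 'a \<times> 'b \<Rightarrow> real \<Rightarrow> bool" where
  "metric_reg_const F z \<kappa> \<longleftrightarrow> \<kappa> \<ge> 0 \<and>
     (\<exists>X Y. open X \<and> fst z \<in> X \<and> open Y \<and> snd z \<in> Y \<and>
        (\<forall>x\<in>X. \<forall>y\<in>Y. set_dist x (inv_map F y) \<le> ereal \<kappa> * set_dist y (F x)))"

definition metrically_regular ::
  "('a::metric_space \<Rightarrow> 'b::metric_space set) \<Rightarrow> 'a \<times> 'b \<Rightarrow> bool" where
  "metrically_regular F z \<longleftrightarrow> (\<exists>\<kappa>. metric_reg_const F z \<kappa>)"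

definition reg_modulus ::
  "('a::metric_space \<Rightarrow> 'b::metric_space set) \<Rightarrow> 'a \<times> 'b \<Rightarrow> ereal" where
  "reg_modulus F z = Inf {ereal \<kappa> | \<kappa>. metric_reg_const F z \<kappa>}"

definition strongly_metrically_regular ::
  "('a::metric_space \<Rightarrow> 'b::metric_space set) \<Rightarrow> 'a \<times> 'b \<Rightarrow> bool" where
  "strongly_metrically_regular F z \<longleftrightarrow> metrically_regular F z \<and>
     (\<exists>Y' X' h. open Y' \<and> snd z \<in> Y' \<and> open X' \<and> fst z \<in> X' \<and> h (snd z) = fst z \<and>
        gph F \<inter> (X' \<times> Y') = {(h y, y) | y. y \<in> Y'})"

end

theory Submission
  imports Defs "HOL-Real_Asymp.Real_Asymp"
begin

text \<open>
  Both parts reduce to a study of a Lipschitz parametrization of the graph.  At a point where the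
  parametrization is differentiable, the tangent cone is the range of its Jacobian, so the elements
  of \<open>SF F z\<close> are ranges of limits of Jacobians.  By Rademacher's theorem such points have full
  measure, and by Fubini almost every line meets their complement in a null set.  Hence an increment of
  a Lipschitz function is bounded by its derivatives at nearby points of differentiability.

  Under strong metric regularity the graph is parametrized by the localization \<open>h\<close> of the inverse.
  Then the regularity modulus is the Lipschitz modulus of \<open>h\<close>, which the mean value inequality
  identifies with the largest norm of a limiting Jacobian of \<open>h\<close>; adjoints have the same norm.
  Conversely, if all convex combinations of the limiting Jacobians \<open>Z\<close> have range in \<open>Zn_reg\<close>, then \<open>snd \<circ> Z\<close>
  is nonsingular.  Separating the compact convex set of the values \<open>snd (Z v)\<close> from zero, uniformly in
  the unit vector \<open>v\<close>, shows that the second component of the parametrization is locally expanding, so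
  by invariance of domain it is a homeomorphism with a Lipschitz inverse.
\<close>

subsection \<open>Lebesgue density points and increments of Lipschitz functions along lines\<close>

text \<open>Partial derivatives are not known to exist beforehand, so Rademacher's theorem is run on
  one-sided upper Dini derivatives, which always exist and have Borel superlevel sets. Cutting their
  range into steps of length \<open>\<epsilon> m\<close> gives countably many Borel pieces on which
  all axis derivatives are constant up to \<open>\<epsilon> m\<close>; at a density point of a piece
  the function is nearly linear. The same one-dimensional estimate with a null exceptional set
  yields the mean value inequality. A given segment may lie entirely in the null set, which is why
  that inequality passes through nearby parallel segments. A point of \<open>O_set F\<close> is not
  given as a differentiability point of the parametrization. Hence bounds over all of
  \<open>SF_adj\<close> come from chords of the graph, while limits of Jacobians exhibit elements:
  for nonemptiness, and to bound Jacobians by \<open>scd_reg\<close>. In the converse the separating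
  functional depends on \<open>v\<close>, but it stays fixed along a segment of direction
  \<open>v\<close>, so the vector-valued estimate becomes a scalar one.\<close>

text \<open>Vitali covering argument: disjoint bad balls inside an open \<open>T\<close> containing
  \<open>E\<close> have total measure at most \<open>measure lebesgue (T - E) / e\<close>, and
  \<open>T\<close> can be taken with \<open>T - E\<close> of measure below
  \<open>e * \<epsilon>\<close>.\<close>

lemma lebesgue_density:
  fixes E :: "'a::euclidean_space set"
  assumes E: "E \<in> sets lebesgue" and e: "e > 0"
  shows "negligible {x \<in> E. \<forall>d>0. \<exists>r. 0 < r \<and> r < d \<and>
           e * measure lebesgue (cball x r) \<le> measure lebesgue (cball x r - E)}" (is "negligible ?A")
  unfolding negligible_outer_le
proof (intro allI impI)
  fix \<epsilon> :: real assume "\<epsilon> > 0"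
  let ?\<mu> = "measure lebesgue"
  obtain T where T: "open T" "E \<subseteq> T" "T - E \<in> lmeasurable" "emeasure lebesgue (T - E) < ennreal (e * \<epsilon>)"
    using sets_lebesgue_outer_open[OF E, of "e * \<epsilon>"] e \<open>\<epsilon> > 0\<close> by auto
  have TE: "?\<mu> (T - E) < e * \<epsilon>"
    using T(3,4) e \<open>\<epsilon> > 0\<close> by (simp add: emeasure_eq_measure2 ennreal_less_iff)
  \<comment> \<open>Balls are required to lie in \<open>T\<close> so that their parts outside
    \<open>E\<close> are disjoint subsets of \<open>T - E\<close>.\<close>
  define \<K> where "\<K> = {(x,r). 0 < r \<and> cball x r \<subseteq> T \<and> e * ?\<mu> (cball x r) \<le> ?\<mu> (cball x r - E)}"
  have cover: "\<exists>i. i \<in> \<K> \<and> x \<in> cball (fst i) (snd i) \<and> snd i < d" if "x \<in> ?A" "0 < d" for x d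
  proof -
    have "x \<in> T" and xA: "\<And>d. d > 0 \<Longrightarrow> \<exists>r. 0 < r \<and> r < d \<and> e * ?\<mu> (cball x r) \<le> ?\<mu> (cball x r - E)"
      using T(2) that(1) by auto
    then obtain d' where "d' > 0" "cball x d' \<subseteq> T"
      using T(1) open_contains_cball by blast
    moreover obtain r where r: "0 < r" "r < min d d'" "e * ?\<mu> (cball x r) \<le> ?\<mu> (cball x r - E)"
      using xA[of "min d d'"] \<open>0 < d\<close> \<open>d' > 0\<close> by auto
    ultimately have "cball x r \<subseteq> T" by (meson less_imp_le min.strict_boundedE order_trans subset_cball)
    then have "(x, r) \<in> \<K>" using r by (simp add: \<K>_def)
    then show ?thesis using r by (intro exI[of _ "(x,r)"]) auto
  qed
  have r0: "0 < snd i" if "i \<in> \<K>" for i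
    using that by (auto simp: \<K>_def)
  obtain C where C: "countable C" "C \<subseteq> \<K>"
     "pairwise (\<lambda>i j. disjnt (cball (fst i) (snd i)) (cball (fst j) (snd j))) C"
     "negligible(?A - (\<Union>i \<in> C. cball (fst i) (snd i)))"
    by (rule Vitali_covering_theorem_cballs[of \<K> snd ?A fst, OF r0 cover]) (assumption | rule that)+
  let ?U = "\<Union>i \<in> C. cball (fst i) (snd i)"
  \<comment> \<open>A bound for finite subfamilies suffices: it passes to the countable union by
    monotone convergence.\<close>
  have fin: "?\<mu> (\<Union>i \<in> I. cball (fst i) (snd i)) \<le> \<epsilon>" if "I \<subseteq> C" "finite I" for I
  proof -
    have pw: "pairwise (\<lambda>i j. disjnt (cball (fst i) (snd i)) (cball (fst j) (snd j))) I"
      using C(3) that(1) by (rule pairwise_subset)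
    have "e * ?\<mu> (\<Union>i \<in> I. cball (fst i) (snd i)) = (\<Sum>i\<in>I. e * ?\<mu> (cball (fst i) (snd i)))"
      using pw that(2)
      by (subst measure_UNION') (auto simp: sum_distrib_left)
    also have "\<dots> \<le> (\<Sum>i\<in>I. ?\<mu> (cball (fst i) (snd i) - E))"
      using that C(2) by (intro sum_mono) (auto simp: \<K>_def)
    also have "\<dots> = ?\<mu> (\<Union>i\<in>I. cball (fst i) (snd i) - E)"
    proof (rule measure_UNION'[symmetric, OF that(2)])
      show "pairwise (\<lambda>i j. disjnt (cball (fst i) (snd i) - E) (cball (fst j) (snd j) - E)) I"
        using pw by (rule pairwise_mono) (auto simp: disjnt_def)
    qed (use E in \<open>auto intro: fmeasurable_Diff\<close>)
    also have "\<dots> \<le> ?\<mu> (T - E)"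
    proof (rule measure_mono_fmeasurable[OF _ _ T(3)])
      show "(\<Union>i\<in>I. cball (fst i) (snd i) - E) \<subseteq> T - E"
        using that(1) C(2) by (fastforce simp: \<K>_def)
      show "(\<Union>i\<in>I. cball (fst i) (snd i) - E) \<in> sets lebesgue"
        using that(2) E by (intro sets.finite_UN sets.Diff) auto
    qed
    finally have "e * ?\<mu> (\<Union>i \<in> I. cball (fst i) (snd i)) \<le> e * \<epsilon>"
      using TE by linarith
    then show ?thesis
      using e by simp
  qed
  have U: "?U \<in> lmeasurable" "?\<mu> ?U \<le> \<epsilon>"
    by (rule fmeasurable_UN_bound[OF C(1) _ fin] measure_UN_bound[OF C(1) _ fin]; simp)+
  have "?A \<subseteq> (?A - ?U) \<union> ?U" by blast
  moreover have "(?A - ?U) \<union> ?U \<in> lmeasurable"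
    using C(4) U(1) by (intro fmeasurable.Un) (auto simp: negligible_iff_measure)
  moreover have "?\<mu> ((?A - ?U) \<union> ?U) \<le> \<epsilon>"
    using measure_Un_le[of "?A - ?U" lebesgue ?U] C(4) U
    by (auto simp: negligible_iff_measure fmeasurableD)
  ultimately show "\<exists>T. ?A \<subseteq> T \<and> T \<in> lmeasurable \<and> ?\<mu> T \<le> \<epsilon>" by blast
qed

text \<open>
  If \<open>V\<close> is an open set containing the exceptional set \<open>S\<close>, of almost the same measure, then adding a
  large multiple of the measure of \<open>V \<inter> {a..t}\<close> to \<open>\<phi> t - c * t\<close> yields a continuous function that
  exceeds its value at every point arbitrarily close to the right of that point.
\<close>

lemma dini_increment_ge:
  fixes \<phi> :: "real \<Rightarrow> real"
  assumes ab: "a \<le> b" and lip: "K-lipschitz_on {a..b} \<phi>" and S: "S \<in> sets borel"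
    and dini: "\<And>t e. \<lbrakk>a \<le> t; t < b; t \<notin> S; e > 0\<rbrakk> \<Longrightarrow>
                  \<exists>s. t < s \<and> s < t + e \<and> \<phi> s - \<phi> t \<ge> (c - e) * (s - t)"
  shows "\<phi> b - \<phi> a \<ge> c * (b - a) - (K + \<bar>c\<bar>) * measure lborel (S \<inter> {a..b})"
proof -
  let ?m = "measure lborel (S \<inter> {a..b})"
  have K0: "K \<ge> 0" using lip by (rule lipschitz_on_nonneg)
  have main: "\<phi> b - \<phi> a \<ge> (c - e) * (b - a) - (K + \<bar>c\<bar> + e) * (?m + e)" if e: "e > 0" for e
  proof -
    have SB: "S \<inter> {a..b} \<in> sets borel" using S by auto
    have "S \<inter> {a..b} \<in> sets lebesgue"
      using SB by (simp add: sets_completionI_sets)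
    then obtain V where V: "open V" "S \<inter> {a..b} \<subseteq> V" 
      "V - S \<inter> {a..b} \<in> lmeasurable" "emeasure lebesgue (V - S \<inter> {a..b}) < ennreal e"
      by (rule sets_lebesgue_outer_open[OF _ e]) 
    have VB: "V \<in> sets borel" using V(1) by simp
    have fmI: "V \<inter> {x..y} \<in> fmeasurable lborel" for x y
      by (rule fmeasurableI2[of "{x..y}"]) (use VB in \<open>auto intro!: fmeasurableI simp: emeasure_lborel_Icc_eq \<close>)
    define g where "g t = measure lborel (V \<inter> {a..t})" for t
    have gdiff: "g t - g s = measure lborel (V \<inter> {s<..t})" if "a \<le> s" "s \<le> t" for s t
    proof -
      have "V \<inter> {s<..t} = V \<inter> {a..t} - V \<inter> {a..s}" using that by auto
      then show ?thesis unfolding g_def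
        using fmI that VB by (simp, subst measurable_measure_Diff) auto
    qed
    have Ioc: "{s<..t} \<in> fmeasurable lborel" for s t :: real
      by (rule fmeasurableI2[of "{s..t}"]) (auto intro!: fmeasurableI simp: emeasure_lborel_Icc_eq)
    have gmono: "g s \<le> g t" if "a \<le> s" "s \<le> t" for s t
      using gdiff[OF that] measure_nonneg[of lborel "V \<inter> {s<..t}"] by linarith
    have glip: "g t - g s \<le> t - s" if "a \<le> s" "s \<le> t" for s t
    proof -
      have "measure lborel (V \<inter> {s<..t}) \<le> measure lborel {s<..t}"
        using VB Ioc by (intro measure_mono_fmeasurable) auto
      then show ?thesis using gdiff[OF that] that by simp
    qed
    have gfull: "g t - g s = t - s" if "a \<le> s" "s \<le> t" "{s..t} \<subseteq> V" for s t
    proof -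
      have "V \<inter> {s<..t} = {s<..t}" using that by auto
      then show ?thesis using gdiff[OF that(1,2)] that by simp
    qed
    have gb: "g b \<le> ?m + e"
    proof -
      have 1: "V \<inter> {a..b} = (S \<inter> {a..b}) \<union> ((V - S \<inter> {a..b}) \<inter> {a..b})" using V(2) by auto
      have "measure lborel (V \<inter> {a..b}) \<le> ?m + measure lborel ((V - S \<inter> {a..b}) \<inter> {a..b})"
        using VB SB by (subst 1, intro measure_Un_le) auto
      also have "measure lborel ((V - S \<inter> {a..b}) \<inter> {a..b}) = measure lebesgue ((V - S \<inter> {a..b}) \<inter> {a..b})"
        using VB SB by (subst measure_completion) auto
      also have "\<dots> \<le> measure lebesgue (V - S \<inter> {a..b})"
        using V(3) by (intro measure_mono_fmeasurable) (auto intro!: sets.Int fmeasurableD)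
      also have "\<dots> \<le> e"
        using V(3,4) e by (simp add: emeasure_eq_measure2 ennreal_less_iff)
      finally show ?thesis by (simp add: g_def)
    qed
    \<comment> \<open>On \<open>V\<close> the function \<open>g\<close> has slope 1, while
      \<open>\<phi> t - (c - e) * t\<close> decreases at rate at most
      \<open>K + \<bar>c\<bar> + e\<close>; this \<open>M\<close> compensates exactly that
      loss.\<close>
    define M where "M = K + \<bar>c\<bar> + e"
    define \<psi> where "\<psi> t = \<phi> t - (c - e) * t + M * g t" for t
    have "1-lipschitz_on {a..b} g"
    proof (rule lipschitz_onI)
      fix x y assume "x \<in> {a..b}" "y \<in> {a..b}"
      then show "dist (g x) (g y) \<le> 1 * dist x y"
        using gmono[of x y] gmono[of y x] glip[of x y] glip[of y x]
        by (cases "x \<le> y") (auto simp: dist_real_def abs_if)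
    qed auto
    then have "continuous_on {a..b} \<psi>"
      unfolding \<psi>_def
      by (intro continuous_intros lipschitz_on_continuous_on[OF lip]) (rule lipschitz_on_continuous_on)
    then have clo: "closed {t \<in> {a..b}. \<psi> a \<le> \<psi> t}"
      by (intro continuous_on_closed_Collect_le continuous_on_const) auto
    define P where "P = {t \<in> {a..b}. \<psi> a \<le> \<psi> t}"
    have P: "a \<in> P" "bdd_above P" "closed P" "P \<subseteq> {a..b}" using ab clo by (auto simp: P_def)
    define s where "s = Sup P"
    have sP: "s \<in> P" unfolding s_def using P by (intro closed_contains_Sup) auto
    then have s: "a \<le> s" "s \<le> b" "\<psi> a \<le> \<psi> s" by (auto simp: P_def)
    have "s = b"
    proof (rule ccontr)
      assume "s \<noteq> b"
      then have sb: "s < b" using s by simp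
      have "\<exists>t. s < t \<and> t \<le> b \<and> \<psi> s \<le> \<psi> t"
      proof (cases "s \<in> V")
        case True
        then obtain d where d: "d > 0" "cball s d \<subseteq> V"
          using V(1) open_contains_cball by blast
        define t where "t = min b (s + d)"
        have t: "s < t" "t \<le> b" "{s..t} \<subseteq> V"
          using d sb by (auto simp: t_def dist_real_def subset_eq)
        have "\<bar>\<phi> t - \<phi> s\<bar> \<le> K * (t - s)"
          using lipschitz_onD[OF lip, of t s] t s by (auto simp: dist_real_def)
        moreover have "(c - e) * (t - s) \<le> (\<bar>c\<bar> + e) * (t - s)"
          using t e by (intro mult_right_mono) auto
        moreover have "M * (g t - g s) = K * (t - s) + (\<bar>c\<bar> + e) * (t - s)"
          using gfull[OF s(1) less_imp_le[OF t(1)] t(3)] by (simp only: M_def distrib_right add.assoc)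
        moreover have "\<psi> t - \<psi> s = (\<phi> t - \<phi> s) - (c - e) * (t - s) + M * (g t - g s)"
          by (simp add: \<psi>_def algebra_simps)
        ultimately have "\<psi> s \<le> \<psi> t" by linarith
        then show ?thesis using t by blast
      next
        case False
        then have "s \<notin> S" using V(2) s by auto
        \<comment> \<open>The tolerance \<open>min e (b - s)\<close> also keeps the new point
          \<open>t\<close> below \<open>b\<close>.\<close>
        then obtain t where t: "s < t" "t < s + min e (b - s)" "\<phi> t - \<phi> s \<ge> (c - min e (b - s)) * (t - s)"
          using dini[of s "min e (b - s)"] s sb e by auto
        have "(c - e) * (t - s) \<le> (c - min e (b - s)) * (t - s)"
          using t by (intro mult_right_mono) auto
        moreover have "M * g s \<le> M * g t"
          using gmono[of s t] s t K0 e by (intro mult_left_mono) (auto simp: M_def)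
        ultimately have "\<psi> s \<le> \<psi> t"
          using t unfolding \<psi>_def by (simp add: algebra_simps)
        then show ?thesis using t by (intro exI[of _ t]) auto
      qed
      then obtain t where t: "s < t" "t \<le> b" "\<psi> s \<le> \<psi> t" by blast
      then have "t \<in> P" using s by (auto simp: P_def)
      then have "t \<le> s" unfolding s_def using P by (intro cSup_upper) auto
      then show False using t by simp
    qed
    then have "\<psi> a \<le> \<psi> b" using s by simp
    moreover have "g a = 0"
    proof -
      have "g a \<le> measure lborel {a..a}" unfolding g_def
        using VB by (intro measure_mono_fmeasurable) (auto intro!: fmeasurableI simp: emeasure_lborel_Icc_eq )
      then show ?thesis by (simp add: g_def measure_le_0_iff)
    qed
    moreover have "M * g b \<le> M * (?m + e)"
      using gb K0 e by (intro mult_left_mono) (auto simp: M_def)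
    ultimately show ?thesis
      unfolding \<psi>_def M_def by (simp add: algebra_simps)
  qed
  have "((\<lambda>e. (c - e) * (b - a) - (K + \<bar>c\<bar> + e) * (?m + e)) \<longlongrightarrow> (c - 0) * (b - a) - (K + \<bar>c\<bar> + 0) * (?m + 0)) (at_right 0)"
    by (intro tendsto_intros)
  moreover have "\<forall>\<^sub>F e in at_right 0. (c - e) * (b - a) - (K + \<bar>c\<bar> + e) * (?m + e) \<le> \<phi> b - \<phi> a"
    unfolding eventually_at_right_field using main by (intro exI[of _ 1]) auto
  ultimately show ?thesis
    using tendsto_upperbound[where F="at_right (0::real)"] by fastforce
qed

section \<open>Fubini along parallel segments\<close>

lemma nn_integral_lborel_translate:
  fixes g :: "'a::euclidean_space \<Rightarrow> ennreal"
  assumes g: "g \<in> borel_measurable borel"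
  shows "(\<integral>\<^sup>+w. g (w + c) \<partial>lborel) = (\<integral>\<^sup>+w. g w \<partial>lborel)"
proof -
  have "(\<integral>\<^sup>+w. g w \<partial>lborel) = (\<integral>\<^sup>+w. g w \<partial>distr lborel borel ((+) c))"
    by (simp add: lborel_distr_plus)
  also have "\<dots> = (\<integral>\<^sup>+w. g (c + w) \<partial>lborel)"
    using g by (subst nn_integral_distr) auto
  finally show ?thesis by (simp add: add.commute)
qed

text \<open>For fixed \<open>s\<close> the translation by \<open>s *\<^sub>R v\<close> preserves
  Lebesgue measure, so exchanging the integrals leaves the constant \<open>emeasure lborel N\<close>
  on \<open>{0..t}\<close>. A small \<open>N\<close> thus meets most segments of direction
  \<open>v\<close> in a short set, and a null \<open>N\<close> meets almost all of them in a null
  set.\<close>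

lemma nn_integral_line_measure:
  fixes N :: "'a::euclidean_space set"
  assumes N: "N \<in> sets borel" and t: "t \<ge> 0"
  shows "(\<integral>\<^sup>+w. emeasure lborel {s \<in> {0..t}. w + s *\<^sub>R v \<in> N} \<partial>lborel) = ennreal t * emeasure lborel N"
    and "(\<lambda>w. emeasure lborel {s \<in> {0..t}. w + s *\<^sub>R v \<in> N}) \<in> borel_measurable borel"
proof -
  let ?f = "\<lambda>(w, s). indicator {0..t} s * indicator N (w + s *\<^sub>R v) :: ennreal"
  have meas: "?f \<in> borel_measurable (lborel \<Otimes>\<^sub>M lborel)"
    using N by measurable
  have eq: "emeasure lborel {s \<in> {0..t}. w + s *\<^sub>R v \<in> N} = (\<integral>\<^sup>+s. ?f (w, s) \<partial>lborel)" for w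
  proof -
    have "{s \<in> {0..t}. w + s *\<^sub>R v \<in> N} = {0..t} \<inter> (\<lambda>s. w + s *\<^sub>R v) -` N \<inter> space borel" by auto
    moreover have "(\<lambda>s. w + s *\<^sub>R v) -` N \<inter> space borel \<in> sets borel"
      by (rule measurable_sets[OF _ N]) measurable
    ultimately have "{s \<in> {0..t}. w + s *\<^sub>R v \<in> N} \<in> sets borel" by (metis sets.Int inf_assoc atLeastAtMost_borel)
    then have "emeasure lborel {s \<in> {0..t}. w + s *\<^sub>R v \<in> N}
        = (\<integral>\<^sup>+s. indicator {s \<in> {0..t}. w + s *\<^sub>R v \<in> N} s \<partial>lborel)" by simp
    also have "\<dots> = (\<integral>\<^sup>+s. ?f (w, s) \<partial>lborel)"
      by (intro nn_integral_cong) (auto simp: indicator_def)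
    finally show ?thesis .
  qed
  have sh: "(\<integral>\<^sup>+w. indicator N (w + c) \<partial>lborel) = emeasure lborel N" for c
    using nn_integral_lborel_translate[of "indicator N" c] N by simp
  have "(\<integral>\<^sup>+w. \<integral>\<^sup>+s. ?f (w, s) \<partial>lborel \<partial>lborel) = (\<integral>\<^sup>+s. \<integral>\<^sup>+w. ?f (w, s) \<partial>lborel \<partial>lborel)"
    using lborel_pair.Fubini'[of "\<lambda>w s. ?f (w, s)"] meas by simp
  also have "\<dots> = (\<integral>\<^sup>+s. indicator {0..t} s * emeasure lborel N \<partial>lborel)"
    using N by (intro nn_integral_cong) (simp add: nn_integral_cmult sh)
  also have "\<dots> = ennreal t * emeasure lborel N"
    using t by (simp add: nn_integral_multc)
  finally show "(\<integral>\<^sup>+w. emeasure lborel {s \<in> {0..t}. w + s *\<^sub>R v \<in> N} \<partial>lborel) = ennreal t * emeasure lborel N"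
    unfolding eq .
  show "(\<lambda>w. emeasure lborel {s \<in> {0..t}. w + s *\<^sub>R v \<in> N}) \<in> borel_measurable borel"
    unfolding eq using lborel.borel_measurable_nn_integral_fst[OF meas] by simp
qed

text \<open>
  The set where the upper right Dini derivative in direction \<open>v\<close> is at least \<open>c\<close>, in a form that
  exhibits it as a countable intersection of open sets.
\<close>

definition dini_ge :: "('a::real_normed_vector \<Rightarrow> real) \<Rightarrow> 'a \<Rightarrow> real \<Rightarrow> 'a set" where
  "dini_ge f v c = {w. \<forall>e>0. \<exists>t>0. t < e \<and> (c - e) * t < f (w + t *\<^sub>R v) - f w}"

lemma borel_dini_ge:
  fixes f :: "'a::real_normed_vector \<Rightarrow> real"
  assumes f: "continuous_on UNIV f"
  shows "dini_ge f v c \<in> sets borel"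
proof -
  let ?D = "\<lambda>e. {w. \<exists>t>0. t < e \<and> (c - e) * t < f (w + t *\<^sub>R v) - f w}"
  \<comment> \<open>Monotonicity in \<open>e\<close> lets the tolerances \<open>1 / Suc n\<close>
    replace all positive ones.\<close>
  have "?D e \<subseteq> ?D e'" if "e \<le> e'" for e e' :: real
  proof
    fix w assume "w \<in> ?D e"
    then obtain t where t: "t > 0" "t < e" "(c - e) * t < f (w + t *\<^sub>R v) - f w" by auto
    have "(c - e') * t \<le> (c - e) * t" using that t by (intro mult_right_mono) auto
    then show "w \<in> ?D e'" using t that by (intro CollectI exI[of _ t]) linarith
  qed
  note mono = this
  have "w \<in> dini_ge f v c" if w: "\<And>n. w \<in> ?D (1 / Suc n)" for w
    unfolding dini_ge_def
  proof (intro CollectI allI impI)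
    fix e :: real assume "e > 0"
    then obtain n where "1 / Suc n < e" using nat_approx_posE by blast
    then have "?D (1 / Suc n) \<subseteq> ?D e" by (intro mono) simp
    then show "\<exists>t>0. t < e \<and> (c - e) * t < f (w + t *\<^sub>R v) - f w" using w[of n] by blast
  qed
  then have "dini_ge f v c = (\<Inter>n. ?D (1 / Suc n))" by (fastforce simp: dini_ge_def)
  moreover have "open (?D e)" for e
  proof -
    have "?D e = (\<Union>t\<in>{0<..<e}. {w. (c - e) * t < f (w + t *\<^sub>R v) - f w})" by auto
    moreover have "open {w. (c - e) * t < f (w + t *\<^sub>R v) - f w}" for t
      by (intro open_Collect_less continuous_intros continuous_on_compose2[OF f]) auto
    ultimately show ?thesis by auto
  qed
  ultimately show ?thesis by (auto intro!: sets.countable_INT)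
qed

text \<open>The upper Dini derivative of a Lipschitz function lies between
  \<open>- (K * norm v)\<close> and \<open>K * norm v\<close>; \<open>k\<close> is the integer part
  of its quotient by \<open>e\<close>.\<close>

lemma dini_ge_iff_floor:
  fixes f :: "'a::real_normed_vector \<Rightarrow> real"
  assumes lip: "K-lipschitz_on UNIV f" and "e > 0"
  obtains k :: int where "w \<in> dini_ge f v (of_int k * e) - dini_ge f v ((of_int k + 1) * e)"
proof -
  have inc: "\<bar>f (w + t *\<^sub>R v) - f w\<bar> \<le> K * norm v * t" if "t > 0" for t
    using lipschitz_onD[OF lip, of "w + t *\<^sub>R v" w] that by (simp add: dist_norm mult_ac)
  have lo: "w \<in> dini_ge f v c" if "c \<le> - (K * norm v)" for c
    unfolding dini_ge_def
  proof (intro CollectI allI impI)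
    fix e' :: real assume "e' > 0"
    have "(c - e') * (e' / 2) < - (K * norm v) * (e' / 2)"
      using \<open>e' > 0\<close> that by (intro mult_strict_right_mono) auto
    moreover have "- (K * norm v) * (e' / 2) \<le> f (w + (e' / 2) *\<^sub>R v) - f w"
      using inc[of "e' / 2"] \<open>e' > 0\<close> by (simp only: mult_minus_left abs_le_iff) linarith
    ultimately have "(c - e') * (e' / 2) < f (w + (e' / 2) *\<^sub>R v) - f w" by (rule less_le_trans)
    then show "\<exists>t>0. t < e' \<and> (c - e') * t < f (w + t *\<^sub>R v) - f w"
      using \<open>e' > 0\<close> by (intro exI[of _ "e' / 2"]) auto
  qed
  have hi: "w \<notin> dini_ge f v c" if "c > K * norm v" for c
  proof
    assume "w \<in> dini_ge f v c"
    moreover have "c - K * norm v > 0" using that by simp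
    ultimately obtain t where t: "t > 0" "(c - (c - K * norm v)) * t < f (w + t *\<^sub>R v) - f w"
      unfolding dini_ge_def by blast
    then show False using inc[of t] by auto
  qed
  \<comment> \<open>\<open>N\<close> steps of length \<open>e\<close> cover
    \<open>K * norm v\<close>. Shifting the index by \<open>N\<close> turns the search for the last
    level still reached into a least-number search over naturals between 0 and
    \<open>2 * N + 1\<close>.\<close>
  define N where "N = nat \<lceil>K * norm v / e\<rceil>"
  define P where "P n \<longleftrightarrow> w \<notin> dini_ge f v (of_int (int n - int N) * e)" for n :: nat
  have K0: "K * norm v / e \<ge> 0" using lipschitz_on_nonneg[OF lip] assms(2) by simp
  have N: "real N \<ge> K * norm v / e" unfolding N_def by linarith
  have "P (2 * N + 1)" unfolding P_def
  proof (rule hi)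
    have "K * norm v = (K * norm v / e) * e" using assms(2) by simp
    also have "\<dots> \<le> real N * e" using N assms(2) by (intro mult_right_mono) auto
    also have "\<dots> < of_int (int (2 * N + 1) - int N) * e" using assms(2) by (intro mult_strict_right_mono) auto
    finally show "K * norm v < of_int (int (2 * N + 1) - int N) * e" .
  qed
  moreover have "\<not> P 0" unfolding P_def not_not
  proof (rule lo)
    have "K * norm v = (K * norm v / e) * e" using assms(2) by simp
    also have "\<dots> \<le> real N * e" using N assms(2) by (intro mult_right_mono) auto
    finally show "of_int (int 0 - int N) * e \<le> - (K * norm v)" by simp
  qed
  ultimately obtain n where n: "\<not> P n" "P (Suc n)"
    using ex_least_nat_le[of P] by (metis Suc_diff_1 diff_less less_numeral_extra(1) not_less neq0_conv)
  show ?thesis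
  proof
    show "w \<in> dini_ge f v (of_int (int n - int N) * e) - dini_ge f v ((of_int (int n - int N) + 1) * e)"
      using n unfolding P_def by (simp add: algebra_simps)
  qed
qed

text \<open>\<open>dini_increment_ge\<close> is applied to \<open>f\<close> along the line with
  slope \<open>q\<close> and to its negative with slope \<open>- (q + \<epsilon>)\<close>.
  Membership in the first set gives large quotients at some small scales; nonmembership in the
  second bounds the quotients at all small scales, which is what the negative needs.\<close>

lemma dini_slab_increment:
  fixes f :: "'a::euclidean_space \<Rightarrow> real"
  assumes lip: "K-lipschitz_on UNIV f" and v: "norm v = 1" and t: "t \<ge> 0"
    and N: "N \<in> sets borel" and \<epsilon>: "\<epsilon> \<ge> 0"
    and slab: "\<And>s. \<lbrakk>0 \<le> s; s < t; w + s *\<^sub>R v \<notin> N\<rbrakk> \<Longrightarrow>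
       w + s *\<^sub>R v \<in> dini_ge f v q - dini_ge f v (q + \<epsilon>)"
  shows "\<bar>f (w + t *\<^sub>R v) - f w - q * t\<bar>
           \<le> \<epsilon> * t + (K + \<bar>q\<bar> + \<epsilon>) * measure lborel {s \<in> {0..t}. w + s *\<^sub>R v \<in> N}"
proof -
  define \<phi> where "\<phi> s = f (w + s *\<^sub>R v)" for s
  define S where "S = {s. w + s *\<^sub>R v \<in> N}"
  have "S = (\<lambda>s. w + s *\<^sub>R v) -` N \<inter> space borel" by (auto simp: S_def)
  also have "\<dots> \<in> sets borel" by (rule measurable_sets[OF _ N]) measurable
  finally have S: "S \<in> sets borel" .
  have lip1: "K-lipschitz_on {0..t} \<phi>"
  proof (rule lipschitz_onI)
    fix x y :: real
    have "dist (w + x *\<^sub>R v) (w + y *\<^sub>R v) = dist x y"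
      using v by (simp add: dist_norm dist_real_def flip: scaleR_diff_left)
    then show "dist (\<phi> x) (\<phi> y) \<le> K * dist x y"
      unfolding \<phi>_def using lipschitz_onD[OF lip, of "w + x *\<^sub>R v" "w + y *\<^sub>R v"] by simp
  qed (rule lipschitz_on_nonneg[OF lip])
  then have lip2: "K-lipschitz_on {0..t} (\<lambda>s. - \<phi> s)"
    by (simp add: lipschitz_on_def dist_minus)
  have seteq: "S \<inter> {0..t} = {s \<in> {0..t}. w + s *\<^sub>R v \<in> N}" by (auto simp: S_def)
  let ?m = "measure lborel (S \<inter> {0..t})"
  have "\<phi> t - \<phi> 0 \<ge> q * (t - 0) - (K + \<bar>q\<bar>) * ?m"
  proof (rule dini_increment_ge[OF t lip1 S])
    fix s e :: real assume s: "0 \<le> s" "s < t" "s \<notin> S" "e > 0"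
    then have "w + s *\<^sub>R v \<in> dini_ge f v q" using slab[of s] by (auto simp: S_def)
    then obtain r where "r > 0" "r < e" "(q - e) * r < f (w + s *\<^sub>R v + r *\<^sub>R v) - f (w + s *\<^sub>R v)"
      using \<open>e > 0\<close> by (auto simp: dini_ge_def)
    then show "\<exists>s'>s. s' < s + e \<and> (q - e) * (s' - s) \<le> \<phi> s' - \<phi> s"
      by (intro exI[of _ "s + r"]) (auto simp: \<phi>_def algebra_simps)
  qed
  moreover have "(- \<phi> t) - (- \<phi> 0) \<ge> (- (q + \<epsilon>)) * (t - 0) - (K + \<bar>- (q + \<epsilon>)\<bar>) * ?m"
  proof (rule dini_increment_ge[OF t lip2 S])
    fix s e :: real assume s: "0 \<le> s" "s < t" "s \<notin> S" "e > 0"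
    then have "w + s *\<^sub>R v \<notin> dini_ge f v (q + \<epsilon>)" using slab[of s] by (auto simp: S_def)
    then obtain e' where e': "e' > 0"
      "\<And>r. \<lbrakk>r > 0; r < e'\<rbrakk> \<Longrightarrow> f (w + s *\<^sub>R v + r *\<^sub>R v) - f (w + s *\<^sub>R v) \<le> (q + \<epsilon> - e') * r"
      by (force simp: dini_ge_def not_less)
    define r where "r = min e e' / 2"
    have r: "0 < r" "r < e" "r < e'" using s e' by (auto simp: r_def)
    have "f (w + s *\<^sub>R v + r *\<^sub>R v) - f (w + s *\<^sub>R v) \<le> (q + \<epsilon> - e') * r"
      by (rule e'(2)[OF r(1,3)])
    also have "\<dots> \<le> (q + \<epsilon> + e) * r"
      using r s(4) e'(1) by (intro mult_right_mono) auto
    finally have "f (w + s *\<^sub>R v + r *\<^sub>R v) - f (w + s *\<^sub>R v) \<le> (q + \<epsilon> + e) * r" .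
    then show "\<exists>s'>s. s' < s + e \<and> (- (q + \<epsilon>) - e) * (s' - s) \<le> - \<phi> s' - - \<phi> s"
      using r by (intro exI[of _ "s + r"]) (auto simp: \<phi>_def algebra_simps)
  qed
  moreover have "(K + \<bar>q\<bar>) * ?m \<le> (K + \<bar>q\<bar> + \<epsilon>) * ?m" "(K + \<bar>- (q + \<epsilon>)\<bar>) * ?m \<le> (K + \<bar>q\<bar> + \<epsilon>) * ?m"
    using \<epsilon> by (intro mult_right_mono; simp)+
  moreover have "\<epsilon> * t \<ge> 0" using \<epsilon> t by simp
  ultimately show ?thesis
    unfolding seteq[symmetric] \<phi>_def abs_le_iff by (simp add: algebra_simps)
qed

subsection \<open>Rademacher's theorem\<close>

text \<open>
  The bound \<open>\<beta> w\<close> is \<open>L\<close> times the length of the part inside \<open>N\<close> of the axis-parallel path from \<open>w\<close> to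
  \<open>w + h\<close>.  By Fubini its integral over \<open>w\<close> is controlled by the measure of \<open>N\<close>.
\<close>

lemma path_increment:
  fixes f :: "'a::euclidean_space \<Rightarrow> real"
  assumes lip: "K-lipschitz_on UNIV f" and N: "N \<in> sets borel" and \<epsilon>: "\<epsilon> \<ge> 0"
    and slab: "\<And>y i. \<lbrakk>y \<in> cball x R; y \<notin> N; i \<in> Basis\<rbrakk> \<Longrightarrow> y \<in> dini_ge f i (q i) - dini_ge f i (q i + \<epsilon>)"
    and L: "\<And>i. i \<in> Basis \<Longrightarrow> K + \<bar>q i\<bar> + \<epsilon> \<le> L"
    and B: "finite B" "B \<subseteq> Basis"
  shows "\<exists>\<beta>. \<beta> \<in> borel_measurable borel
    \<and> (\<integral>\<^sup>+w. \<beta> w \<partial>lborel) \<le> ennreal (L * (\<Sum>i\<in>B. \<bar>h \<bullet> i\<bar>)) * emeasure lborel N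
    \<and> (\<forall>w. dist x w \<le> R - (\<Sum>i\<in>B. \<bar>h \<bullet> i\<bar>) \<longrightarrow>
         ennreal \<bar>f (w + (\<Sum>i\<in>B. (h \<bullet> i) *\<^sub>R i)) - f w - (\<Sum>i\<in>B. q i * (h \<bullet> i))\<bar>
           \<le> ennreal (\<epsilon> * (\<Sum>i\<in>B. \<bar>h \<bullet> i\<bar>)) + \<beta> w)"
  using B
proof (induction B rule: finite_induct)
  case empty
  show ?case by (intro exI[of _ "\<lambda>_. 0"]) simp
next
  case (insert j B)
  let ?S = "\<Sum>i\<in>B. \<bar>h \<bullet> i\<bar>" and ?p = "\<Sum>i\<in>B. (h \<bullet> i) *\<^sub>R i"
  define t where "t = \<bar>h \<bullet> j\<bar>"
  have t0: "t \<ge> 0" and j: "j \<in> Basis" using insert.prems by (auto simp: t_def)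
  have L0: "L \<ge> 0" using L[OF j] lipschitz_on_nonneg[OF lip] \<epsilon> by linarith
  obtain \<beta> where \<beta>: "\<beta> \<in> borel_measurable borel"
     "(\<integral>\<^sup>+w. \<beta> w \<partial>lborel) \<le> ennreal (L * ?S) * emeasure lborel N"
     "\<And>w. dist x w \<le> R - ?S \<Longrightarrow>
         ennreal \<bar>f (w + ?p) - f w - (\<Sum>i\<in>B. q i * (h \<bullet> i))\<bar> \<le> ennreal (\<epsilon> * ?S) + \<beta> w"
    using insert by auto
  \<comment> \<open>The offset leads to the lower end of the next edge. Edges are always traversed
    in direction \<open>+j\<close>, even if \<open>h \<bullet> j\<close> is negative, because
    \<open>dini_ge\<close> is one-sided.\<close>
  define c where "c = ?p + min 0 (h \<bullet> j) *\<^sub>R j"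
  define m where "m w = emeasure lborel {s \<in> {0..t}. w + s *\<^sub>R j \<in> N}" for w
  have m: "m \<in> borel_measurable borel" "(\<integral>\<^sup>+w. m w \<partial>lborel) = ennreal t * emeasure lborel N"
    unfolding m_def using nn_integral_line_measure[OF N t0] by auto
  define \<beta>' where "\<beta>' w = \<beta> w + ennreal L * m (w + c)" for w
  have mc: "(\<lambda>w. m (w + c)) \<in> borel_measurable borel"
    using m(1) by measurable
  show ?case
  proof (intro exI[of _ \<beta>'] conjI allI impI)
    show "\<beta>' \<in> borel_measurable borel" unfolding \<beta>'_def using \<beta>(1) mc by measurable
    have "(\<integral>\<^sup>+w. \<beta>' w \<partial>lborel) = (\<integral>\<^sup>+w. \<beta> w \<partial>lborel) + ennreal L * (\<integral>\<^sup>+w. m (w + c) \<partial>lborel)"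
      unfolding \<beta>'_def using \<beta>(1) mc by (simp add: nn_integral_add nn_integral_cmult)
    also have "\<dots> \<le> ennreal (L * ?S) * emeasure lborel N + ennreal L * (ennreal t * emeasure lborel N)"
      using \<beta>(2) by (simp add: nn_integral_lborel_translate[OF m(1)] m(2) add_right_mono)
    also have "\<dots> = (ennreal (L * ?S) + ennreal (L * t)) * emeasure lborel N"
      using L0 t0 by (simp add: distrib_right ennreal_mult mult.assoc)
    also have "ennreal (L * ?S) + ennreal (L * t) = ennreal (L * (\<Sum>i\<in>insert j B. \<bar>h \<bullet> i\<bar>))"
      using L0 t0 insert.hyps by (subst ennreal_plus[symmetric]) (auto simp: sum_nonneg t_def distrib_left add.commute)
    finally show "(\<integral>\<^sup>+w. \<beta>' w \<partial>lborel) \<le> ennreal (L * (\<Sum>i\<in>insert j B. \<bar>h \<bullet> i\<bar>)) * emeasure lborel N" .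
  next
    fix w assume w: "dist x w \<le> R - (\<Sum>i\<in>insert j B. \<bar>h \<bullet> i\<bar>)"
    then have w': "dist x w \<le> R - ?S - t" using insert.hyps by (simp add: t_def)
    define u where "u = w + ?p"
    define u0 where "u0 = w + c"
    have nj: "norm j = 1" using j by simp
    have "norm ?p \<le> ?S"
      using insert.prems by (intro order_trans[OF norm_sum] sum_mono) auto
    then have du: "dist x u \<le> R - t"
      using w' dist_triangle[of x u w] by (simp add: u_def dist_norm)
    \<comment> \<open>The budget \<open>R\<close> minus the path length, left for
      \<open>dist x w\<close>, keeps the whole path in the ball where \<open>slab\<close>
      applies.\<close>
    have in_ball: "u0 + s *\<^sub>R j \<in> cball x R" if "0 \<le> s" "s \<le> t" for s
    proof -
      have eq: "u0 + s *\<^sub>R j = u + (min 0 (h \<bullet> j) + s) *\<^sub>R j"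
        by (simp add: u0_def u_def c_def algebra_simps)
      have "norm ((min 0 (h \<bullet> j) + s) *\<^sub>R j) \<le> t"
        using that nj by (auto simp: t_def min_def abs_if)
      then have "dist u (u0 + s *\<^sub>R j) \<le> t" unfolding eq by (simp add: dist_norm)
      then show ?thesis using du dist_triangle[of x "u0 + s *\<^sub>R j" u] by simp
    qed
    have inc: "\<bar>f (u0 + t *\<^sub>R j) - f u0 - q j * t\<bar>
           \<le> \<epsilon> * t + (K + \<bar>q j\<bar> + \<epsilon>) * measure lborel {s \<in> {0..t}. u0 + s *\<^sub>R j \<in> N}"
      by (rule dini_slab_increment[OF lip nj t0 N \<epsilon>]) (use slab[OF in_ball _ j] in auto)
    have "m u0 \<le> emeasure lborel {0..t}" unfolding m_def by (intro emeasure_mono) auto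
    then have "m u0 < \<infinity>" using t0 by (auto simp: le_less_trans)
    then have mm: "m u0 = ennreal (measure lborel {s \<in> {0..t}. u0 + s *\<^sub>R j \<in> N})"
      unfolding m_def by (intro emeasure_eq_ennreal_measure) auto
    have "(K + \<bar>q j\<bar> + \<epsilon>) * measure lborel {s \<in> {0..t}. u0 + s *\<^sub>R j \<in> N}
            \<le> L * measure lborel {s \<in> {0..t}. u0 + s *\<^sub>R j \<in> N}"
      using L[OF j] by (intro mult_right_mono) auto
    then have inc': "\<bar>f (u0 + t *\<^sub>R j) - f u0 - q j * t\<bar>
           \<le> \<epsilon> * t + L * measure lborel {s \<in> {0..t}. u0 + s *\<^sub>R j \<in> N}"
      using inc by linarith
    have sgn: "\<bar>f (u + (h \<bullet> j) *\<^sub>R j) - f u - q j * (h \<bullet> j)\<bar> = \<bar>f (u0 + t *\<^sub>R j) - f u0 - q j * t\<bar>"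
    proof (cases "h \<bullet> j \<ge> 0")
      case True
      then show ?thesis by (simp add: u0_def u_def c_def t_def)
    next
      case False
      then have "u0 = u + (h \<bullet> j) *\<^sub>R j" "u0 + t *\<^sub>R j = u" "t = - (h \<bullet> j)"
        by (auto simp: u0_def u_def c_def t_def)
      then show ?thesis by (simp add: abs_minus_commute) 
    qed
    have "ennreal \<bar>f (u + (h \<bullet> j) *\<^sub>R j) - f u - q j * (h \<bullet> j)\<bar> \<le> ennreal (\<epsilon> * t) + ennreal L * m u0"
      unfolding sgn mm using inc' L0 t0 \<epsilon>
      by (simp add: ennreal_leI flip: ennreal_plus ennreal_mult)
    moreover have "ennreal \<bar>f u - f w - (\<Sum>i\<in>B. q i * (h \<bullet> i))\<bar> \<le> ennreal (\<epsilon> * ?S) + \<beta> w"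
      unfolding u_def using w' t0 by (intro \<beta>(3)) linarith
    moreover have "ennreal \<bar>f (w + (\<Sum>i\<in>insert j B. (h \<bullet> i) *\<^sub>R i)) - f w - (\<Sum>i\<in>insert j B. q i * (h \<bullet> i))\<bar>
       \<le> ennreal \<bar>f (u + (h \<bullet> j) *\<^sub>R j) - f u - q j * (h \<bullet> j)\<bar> + ennreal \<bar>f u - f w - (\<Sum>i\<in>B. q i * (h \<bullet> i))\<bar>"
      using insert.hyps
      by (simp add: u_def add_ac flip: ennreal_plus)
    ultimately have "ennreal \<bar>f (w + (\<Sum>i\<in>insert j B. (h \<bullet> i) *\<^sub>R i)) - f w - (\<Sum>i\<in>insert j B. q i * (h \<bullet> i))\<bar>
       \<le> (ennreal (\<epsilon> * t) + ennreal L * m u0) + (ennreal (\<epsilon> * ?S) + \<beta> w)"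
      by (meson add_mono order_trans)
    also have "\<dots> = (ennreal (\<epsilon> * t) + ennreal (\<epsilon> * ?S)) + \<beta>' w"
      by (simp add: \<beta>'_def u0_def add_ac)
    also have "ennreal (\<epsilon> * t) + ennreal (\<epsilon> * ?S) = ennreal (\<epsilon> * (\<Sum>i\<in>insert j B. \<bar>h \<bullet> i\<bar>))"
      using \<epsilon> t0 insert.hyps by (subst ennreal_plus[symmetric]) (auto simp: sum_nonneg t_def distrib_left)
    finally show "ennreal \<bar>f (w + (\<Sum>i\<in>insert j B. (h \<bullet> i) *\<^sub>R i)) - f w - (\<Sum>i\<in>insert j B. q i * (h \<bullet> i))\<bar>
       \<le> ennreal (\<epsilon> * (\<Sum>i\<in>insert j B. \<bar>h \<bullet> i\<bar>)) + \<beta>' w" .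
  qed
qed

lemma measure_lebesgue_cball:
  fixes x :: "'a::euclidean_space"
  assumes "r \<ge> 0"
  shows "measure lebesgue (cball x r) = r ^ DIM('a) * measure lebesgue (ball (0::'a) 1)"
  using content_ball_conv_unit_ball[OF assms, of x] by (simp add: content_cball_conv_ball)

text \<open>
  If \<open>N\<close> is small in measure, some \<open>w\<close> close to \<open>x\<close> has a path to \<open>w + h\<close> that is mostly outside \<open>N\<close>;
  the Lipschitz property transfers the resulting estimate from \<open>w\<close> to \<open>x\<close>.
\<close>

lemma density_point_linear_approx:
  fixes f :: "'a::euclidean_space \<Rightarrow> real"
  assumes lip: "K-lipschitz_on UNIV f" and \<epsilon>: "0 < \<epsilon>" "\<epsilon> \<le> 1" and E: "E \<in> sets borel"
    and slab: "\<And>w i. \<lbrakk>w \<in> E; i \<in> Basis\<rbrakk> \<Longrightarrow> w \<in> dini_ge f i (q i) - dini_ge f i (q i + \<epsilon>)"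
    and dens: "\<And>e. e > 0 \<Longrightarrow> \<exists>d>0. \<forall>r. 0 < r \<and> r < d \<longrightarrow>
                  measure lebesgue (cball x r - E) < e * measure lebesgue (cball x r)"
  shows "\<exists>d>0. \<forall>h. norm h < d \<longrightarrow>
           \<bar>f (x + h) - f x - (\<Sum>i\<in>Basis. q i * (h \<bullet> i))\<bar> \<le> (real DIM('a) + 1 + 2 * K) * \<epsilon> * norm h"
proof -
  define n where "n = DIM('a)"
  have n: "n > 0" by (simp add: n_def)
  define L where "L = K + (\<Sum>i\<in>Basis. \<bar>q i\<bar>) + \<epsilon>"
  have K0: "K \<ge> 0" using lip by (rule lipschitz_on_nonneg)
  have L0: "L > 0" using K0 \<epsilon> by (auto simp: L_def intro!: add_nonneg_pos sum_nonneg)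
  have L: "K + \<bar>q i\<bar> + \<epsilon> \<le> L" if "i \<in> Basis" for i
    unfolding L_def using member_le_sum[of i Basis "\<lambda>i. \<bar>q i\<bar>"] that by simp
  define \<omega> where "\<omega> = measure lebesgue (ball (0::'a) 1)"
  have \<omega>: "\<omega> > 0" unfolding \<omega>_def using content_ball_pos[of 1 "0::'a"] by simp
  \<comment> \<open>Solves \<open>L * (n * \<rho>) * e * R ^ n = \<epsilon> * \<rho> * (\<epsilon> *
    \<rho>) ^ n\<close> for \<open>R = (n + 1) * \<rho>\<close>; this equality closes the averaging
    argument below.\<close>
  define e where "e = \<epsilon> ^ Suc n / (L * n * real (n + 1) ^ n)"
  have e: "e > 0" using \<epsilon> L0 n by (simp add: e_def)
  obtain d where d: "d > 0" "\<And>r. \<lbrakk>0 < r; r < d\<rbrakk> \<Longrightarrow>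
      measure lebesgue (cball x r - E) < e * measure lebesgue (cball x r)"
    using dens[OF e] by blast
  show ?thesis
  proof (intro exI[of _ "d / (n + 1)"] conjI allI impI)
    show "d / (n + 1) > 0" using d by simp
    fix h :: 'a assume h: "norm h < d / (n + 1)"
    define \<rho> where "\<rho> = norm h"
    \<comment> \<open>Room for a base point displaced by at most \<open>\<rho>\<close> and a path of
      length at most \<open>n * \<rho>\<close>.\<close>
    define R where "R = (n + 1) * \<rho>"
    show "\<bar>f (x + h) - f x - (\<Sum>i\<in>Basis. q i * (h \<bullet> i))\<bar> \<le> (real DIM('a) + 1 + 2 * K) * \<epsilon> * norm h"
    proof (cases "h = 0")
      case False
      then have \<rho>: "\<rho> > 0" by (simp add: \<rho>_def)
      have R: "R > 0" unfolding R_def using \<rho> by (intro mult_pos_pos) auto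
      have R': "R < d" using h by (simp add: R_def \<rho>_def field_simps)
      define N where "N = cball x R - E"
      have N: "N \<in> sets borel" using E by (auto simp: N_def)
      let ?S = "\<Sum>i\<in>Basis. \<bar>h \<bullet> i\<bar>"
      have S: "?S \<le> n * \<rho>"
        using sum_mono[of Basis "\<lambda>i. \<bar>h \<bullet> i\<bar>" "\<lambda>_. norm h"] by (simp add: n_def \<rho>_def Basis_le_norm)
      obtain \<beta> where \<beta>: "\<beta> \<in> borel_measurable borel"
        "(\<integral>\<^sup>+w. \<beta> w \<partial>lborel) \<le> ennreal (L * ?S) * emeasure lborel N"
        "\<And>w. dist x w \<le> R - ?S \<Longrightarrow>
         ennreal \<bar>f (w + (\<Sum>i\<in>Basis. (h \<bullet> i) *\<^sub>R i)) - f w - (\<Sum>i\<in>Basis. q i * (h \<bullet> i))\<bar>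
           \<le> ennreal (\<epsilon> * ?S) + \<beta> w"
        using path_increment[OF lip N less_imp_le[OF \<epsilon>(1)] _ L finite_Basis order_refl, where x=x and R=R and h=h] slab by (force simp: N_def)
      \<comment> \<open>Chebyshev argument: if \<open>\<beta>\<close> exceeded
        \<open>\<epsilon> * \<rho>\<close> on the whole small ball, its integral would be larger
        than the Fubini bound permits.\<close>
      have "\<exists>w\<in>cball x (\<epsilon> * \<rho>). \<beta> w \<le> ennreal (\<epsilon> * \<rho>)"
      proof (rule ccontr)
        assume "\<not> ?thesis"
        then have big: "ennreal (\<epsilon> * \<rho>) \<le> \<beta> w" if "w \<in> cball x (\<epsilon> * \<rho>)" for w
          using that by (meson linear)
        have "ennreal (\<epsilon> * \<rho>) * emeasure lborel (cball x (\<epsilon> * \<rho>))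
            = (\<integral>\<^sup>+w. ennreal (\<epsilon> * \<rho>) * indicator (cball x (\<epsilon> * \<rho>)) w \<partial>lborel)"
          by (simp add: nn_integral_cmult_indicator)
        also have "\<dots> \<le> (\<integral>\<^sup>+w. \<beta> w \<partial>lborel)"
          using big by (intro nn_integral_mono) (auto simp: indicator_def)
        also have "\<dots> \<le> ennreal (L * ?S) * emeasure lborel N" by (rule \<beta>(2))
        also have "emeasure lborel N = ennreal (measure lborel N)"
        proof (rule emeasure_eq_ennreal_measure)
          have "emeasure lborel N \<le> emeasure lborel (cball x R)"
            unfolding N_def by (intro emeasure_mono) auto
          then show "emeasure lborel N \<noteq> top" using emeasure_lborel_cball_finite[of x R] by (auto simp: top_unique)
        qed
        also have "emeasure lborel (cball x (\<epsilon> * \<rho>)) = ennreal (measure lborel (cball x (\<epsilon> * \<rho>)))"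
          using emeasure_lborel_cball_finite[of x "\<epsilon> * \<rho>"] by (intro emeasure_eq_ennreal_measure) auto
        finally have "ennreal (\<epsilon> * \<rho> * measure lborel (cball x (\<epsilon> * \<rho>))) \<le> ennreal (L * ?S * measure lborel N)"
          using \<epsilon> \<rho> L0 by (simp add: ennreal_mult sum_nonneg)
        then have "\<epsilon> * \<rho> * measure lborel (cball x (\<epsilon> * \<rho>)) \<le> L * ?S * measure lborel N"
          using L0 by (subst (asm) ennreal_le_iff) (auto simp: sum_nonneg)
        also have "measure lborel (cball x (\<epsilon> * \<rho>)) = (\<epsilon> * \<rho>) ^ n * \<omega>"
          using measure_lebesgue_cball[of "\<epsilon> * \<rho>" x] \<epsilon> \<rho> by (simp add: n_def \<omega>_def)
        also have "L * ?S * measure lborel N \<le> L * (n * \<rho>) * measure lborel N"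
          using S L0 by (intro mult_right_mono mult_left_mono) auto
        also have "measure lborel N = measure lebesgue N"
          using N by simp
        also have "L * (n * \<rho>) * \<dots> < L * (n * \<rho>) * (e * (R ^ n * \<omega>))"
          using d(2)[OF R R'] measure_lebesgue_cball[of R x] R L0 \<rho> n
          by (intro mult_strict_left_mono) (auto simp: N_def n_def \<omega>_def)
        also have "\<dots> = \<epsilon> ^ Suc n * \<rho> ^ Suc n * \<omega>"
        proof -
          have "R ^ n = real (n + 1) ^ n * \<rho> ^ n" unfolding R_def by (rule power_mult_distrib)
          moreover have "L * n * (e * real (n + 1) ^ n) = \<epsilon> ^ Suc n" using L0 n by (simp add: e_def)
          moreover have "L * (n * \<rho>) * (e * (real (n + 1) ^ n * \<rho> ^ n * \<omega>))
              = (L * n * (e * real (n + 1) ^ n)) * (\<rho> * \<rho> ^ n) * \<omega>"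
            by (simp only: mult_ac)
          ultimately show ?thesis by simp
        qed
        also have "\<dots> = \<epsilon> * \<rho> * ((\<epsilon> * \<rho>) ^ n * \<omega>)"
          by (simp add: power_mult_distrib)
        finally show False by simp
      qed
      then obtain w where w: "dist x w \<le> \<epsilon> * \<rho>" "\<beta> w \<le> ennreal (\<epsilon> * \<rho>)" by auto
      have "\<epsilon> * \<rho> \<le> \<rho>" using \<epsilon> \<rho> by simp
      then have "dist x w \<le> R - ?S" using w(1) S by (simp add: R_def distrib_right)
      then have "ennreal \<bar>f (w + h) - f w - (\<Sum>i\<in>Basis. q i * (h \<bullet> i))\<bar> \<le> ennreal (\<epsilon> * ?S) + \<beta> w"
        using \<beta>(3)[of w] by (simp add: euclidean_representation)
      also have "\<dots> \<le> ennreal (\<epsilon> * (n * \<rho>)) + ennreal (\<epsilon> * \<rho>)"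
        using w(2) S \<epsilon> by (intro add_mono ennreal_leI mult_left_mono) auto
      also have "\<dots> = ennreal (\<epsilon> * (n * \<rho>) + \<epsilon> * \<rho>)"
        using \<epsilon> \<rho> by (intro ennreal_plus[symmetric]) auto
      finally have 1: "\<bar>f (w + h) - f w - (\<Sum>i\<in>Basis. q i * (h \<bullet> i))\<bar> \<le> \<epsilon> * (n * \<rho>) + \<epsilon> * \<rho>"
        using \<epsilon> \<rho> by (subst (asm) ennreal_le_iff) auto
      have "\<bar>f (x + h) - f (w + h)\<bar> \<le> K * dist (x + h) (w + h)" "\<bar>f x - f w\<bar> \<le> K * dist x w"
        using lipschitz_onD[OF lip, of "x + h" "w + h"] lipschitz_onD[OF lip, of x w] by (auto simp: dist_real_def)
      moreover have "K * dist x w \<le> K * (\<epsilon> * \<rho>)" using w(1) K0 by (intro mult_left_mono)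
      ultimately have "\<bar>f (x + h) - f x - (\<Sum>i\<in>Basis. q i * (h \<bullet> i))\<bar> \<le> \<epsilon> * (n * \<rho>) + \<epsilon> * \<rho> + 2 * (K * (\<epsilon> * \<rho>))"
        using 1 by simp
      then show ?thesis by (simp add: n_def \<rho>_def algebra_simps)
    qed simp
  qed
qed

text \<open>The slope \<open>a\<close> may depend on \<open>e\<close>. Slopes for two tolerances,
  tested along their own difference, differ by at most the sum of the tolerances; so they form a
  Cauchy sequence, whose limit is the gradient.\<close>

lemma differentiable_if_linear_approx:
  fixes f :: "'a::euclidean_space \<Rightarrow> real"
  assumes approx: "\<And>e. e > 0 \<Longrightarrow> \<exists>a. \<exists>d>0. \<forall>h. norm h < d \<longrightarrow> \<bar>f (x + h) - f x - a \<bullet> h\<bar> \<le> e * norm h"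
  shows "f differentiable (at x)"
proof -
  define \<epsilon> where "\<epsilon> m = 1 / real (Suc m)" for m
  have \<epsilon>: "\<epsilon> m > 0" for m by (simp add: \<epsilon>_def)
  have \<epsilon>0: "\<epsilon> \<longlonglongrightarrow> 0" unfolding \<epsilon>_def by (rule LIMSEQ_inverse_real_of_nat[unfolded inverse_eq_divide])
  from approx[OF \<epsilon>] obtain a where
    "\<forall>m. \<exists>d>0. \<forall>h. norm h < d \<longrightarrow> \<bar>f (x + h) - f x - a m \<bullet> h\<bar> \<le> \<epsilon> m * norm h" by metis
  then obtain d where d: "\<And>m. d m > 0"
    "\<And>m h. norm h < d m \<Longrightarrow> \<bar>f (x + h) - f x - a m \<bullet> h\<bar> \<le> \<epsilon> m * norm h" by metis
  have close: "norm (a m - a l) \<le> \<epsilon> m + \<epsilon> l" for m l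
  proof (cases "a m = a l")
    case False
    define v where "v = a m - a l"
    \<comment> \<open>Scales the test vector to half the smaller radius, so that both approximations
      apply to it.\<close>
    define \<tau> where "\<tau> = min (d m) (d l) / (2 * norm v)"
    have v: "norm v > 0" using False by (simp add: v_def)
    have \<tau>: "\<tau> > 0" using d(1)[of m] d(1)[of l] v by (simp add: \<tau>_def)
    have "norm (\<tau> *\<^sub>R v) = \<tau> * norm v" using \<tau> by simp
    also have "\<dots> = min (d m) (d l) / 2" using v by (simp add: \<tau>_def)
    finally have "norm (\<tau> *\<^sub>R v) = min (d m) (d l) / 2" .
    then have "norm (\<tau> *\<^sub>R v) < d m" "norm (\<tau> *\<^sub>R v) < d l" using d(1)[of m] d(1)[of l] by auto
    from d(2)[OF this(1)] d(2)[OF this(2)]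
    have "a m \<bullet> (\<tau> *\<^sub>R v) - a l \<bullet> (\<tau> *\<^sub>R v) \<le> (\<epsilon> m + \<epsilon> l) * norm (\<tau> *\<^sub>R v)"
      by (simp only: abs_le_iff distrib_right) linarith
    moreover have "a m \<bullet> (\<tau> *\<^sub>R v) - a l \<bullet> (\<tau> *\<^sub>R v) = \<tau> * (v \<bullet> v)"
      by (simp add: v_def algebra_simps)
    moreover have "(\<epsilon> m + \<epsilon> l) * norm (\<tau> *\<^sub>R v) = \<tau> * ((\<epsilon> m + \<epsilon> l) * norm v)"
      using \<tau> by simp
    ultimately have "\<tau> * (v \<bullet> v) \<le> \<tau> * ((\<epsilon> m + \<epsilon> l) * norm v)" by (simp only:)
    then have "norm v * norm v \<le> (\<epsilon> m + \<epsilon> l) * norm v"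
      using \<tau> by (simp add: dot_square_norm power2_eq_square)
    then show ?thesis using v by (simp add: v_def)
  qed (use \<epsilon>[of m] \<epsilon>[of l] in simp)
  have "Cauchy a"
  proof (rule metric_CauchyI)
    fix e :: real assume "e > 0"
    then obtain M where M: "\<And>m. m \<ge> M \<Longrightarrow> \<epsilon> m < e / 2"
      using order_tendstoD(2)[OF \<epsilon>0, of "e / 2"] by (auto simp: eventually_sequentially)
    then have "dist (a m) (a l) < e" if "m \<ge> M" "l \<ge> M" for m l
      using close[of m l] M[OF that(1)] M[OF that(2)] by (simp add: dist_norm)
    then show "\<exists>M. \<forall>m\<ge>M. \<forall>n\<ge>M. dist (a m) (a n) < e" by blast
  qed
  then obtain b where b: "a \<longlonglongrightarrow> b" using Cauchy_convergent convergent_def by blast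
  have close_b: "norm (a m - b) \<le> \<epsilon> m" for m
  proof -
    have "(\<lambda>l. norm (a m - a l)) \<longlonglongrightarrow> norm (a m - b)" by (intro tendsto_intros b)
    moreover have "(\<lambda>l. \<epsilon> m + \<epsilon> l) \<longlonglongrightarrow> \<epsilon> m + 0" by (intro tendsto_intros \<epsilon>0)
    ultimately show ?thesis using close[of m] by (auto intro: LIMSEQ_le)
  qed
  have "(f has_derivative (\<lambda>h. b \<bullet> h)) (at x)"
    unfolding has_derivative_at_alt
  proof (intro conjI allI impI)
    show "bounded_linear ((\<bullet>) b)" by (rule bounded_linear_inner_right)
    fix e :: real assume "e > 0"
    then obtain m where m: "\<epsilon> m < e / 2"
      using order_tendstoD(2)[OF \<epsilon>0, of "e / 2"] by (auto simp: eventually_sequentially)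
    have "norm (f y - f x - b \<bullet> (y - x)) \<le> e * norm (y - x)" if y: "norm (y - x) < d m" for y
    proof -
      have "\<bar>f y - f x - a m \<bullet> (y - x)\<bar> \<le> \<epsilon> m * norm (y - x)" using d(2)[OF y] by simp
      moreover have "\<bar>(a m - b) \<bullet> (y - x)\<bar> \<le> norm (a m - b) * norm (y - x)" by (rule Cauchy_Schwarz_ineq2)
      moreover have "norm (a m - b) * norm (y - x) \<le> \<epsilon> m * norm (y - x)"
        by (intro mult_right_mono close_b) simp
      moreover have "2 * \<epsilon> m * norm (y - x) \<le> e * norm (y - x)" using m by (intro mult_right_mono) auto
      ultimately show ?thesis by (simp add: inner_diff_left)
    qed
    then show "\<exists>d>0. \<forall>y. norm (y - x) < d \<longrightarrow> norm (f y - f x - b \<bullet> (y - x)) \<le> e * norm (y - x)"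
      using d(1) by blast
  qed
  then show ?thesis unfolding differentiable_def by blast
qed

text \<open>For each \<open>m\<close> the sets \<open>E m k\<close> cover the space. A point outside
  all \<open>\<N> m k l\<close> is, for every \<open>m\<close>, a density point of the piece
  containing it, hence has linear approximations of every accuracy.\<close>

lemma rademacher_real:
  fixes f :: "'a::euclidean_space \<Rightarrow> real"
  assumes lip: "K-lipschitz_on UNIV f"
  shows "negligible {x. \<not> f differentiable (at x)}"
proof -
  let ?\<mu> = "measure lebesgue"
  have K0: "K \<ge> 0" using lip by (rule lipschitz_on_nonneg)
  have cont: "continuous_on UNIV f" using lip by (rule lipschitz_on_continuous_on)
  define \<epsilon> where "\<epsilon> m = 1 / real (Suc m)" for m
  have \<epsilon>: "0 < \<epsilon> m" "\<epsilon> m \<le> 1" for m by (auto simp: \<epsilon>_def)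
  define E where "E m k = (\<Inter>i\<in>Basis. dini_ge f i (of_int (k i) * \<epsilon> m) - dini_ge f i ((of_int (k i) + 1) * \<epsilon> m))"
    for m and k :: "'a \<Rightarrow> int"
  define \<N> where "\<N> m k l = {x \<in> E m k. \<forall>d>0. \<exists>r. 0 < r \<and> r < d \<and>
           \<epsilon> l * ?\<mu> (cball x r) \<le> ?\<mu> (cball x r - E m k)}" for m k l
  have E: "E m k \<in> sets borel" for m k
    unfolding E_def by (intro sets.finite_INT sets.Diff borel_dini_ge cont) auto
  have neg: "negligible (\<N> m k l)" for m k l
    unfolding \<N>_def using E by (intro lebesgue_density \<epsilon>) (simp add: sets_completionI_sets)
  \<comment> \<open>Extensional functions on the finite set \<open>Basis\<close> make the index set
    countable; this is why \<open>k0\<close> is restricted below.\<close>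
  define I where "I = (UNIV :: nat set) \<times> (PiE (Basis :: 'a set) (\<lambda>_. UNIV :: int set)) \<times> (UNIV :: nat set)"
  have "countable I" unfolding I_def by (intro countable_SIGMA countable_PiE) auto
  then have "negligible (\<Union>(m, k, l)\<in>I. \<N> m k l)"
    using neg by (intro negligible_countable_Union countable_image) auto
  moreover have "{x. \<not> f differentiable (at x)} \<subseteq> (\<Union>(m, k, l)\<in>I. \<N> m k l)"
  proof (rule ccontr)
    assume "\<not> ?thesis"
    then obtain x where x: "\<not> f differentiable (at x)" "\<And>m k l. (m, k, l) \<in> I \<Longrightarrow> x \<notin> \<N> m k l" by blast
    have "\<exists>a. \<exists>d>0. \<forall>h. norm h < d \<longrightarrow> \<bar>f (x + h) - f x - a \<bullet> h\<bar> \<le> e * norm h" if "e > 0" for e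
    proof -
      define C where "C = real DIM('a) + 1 + 2 * K"
      have C: "C > 0" using K0 by (simp add: C_def)
      obtain m where m: "\<epsilon> m < e / C" unfolding \<epsilon>_def using nat_approx_posE[of "e / C"] C \<open>e > 0\<close> by auto
      have "\<forall>i. \<exists>k::int. x \<in> dini_ge f i (of_int k * \<epsilon> m) - dini_ge f i ((of_int k + 1) * \<epsilon> m)"
        using dini_ge_iff_floor[OF lip \<epsilon>(1)] by metis
      then obtain k0 :: "'a \<Rightarrow> int" where
        k0: "\<And>i. x \<in> dini_ge f i (of_int (k0 i) * \<epsilon> m) - dini_ge f i ((of_int (k0 i) + 1) * \<epsilon> m)" by metis
      define k where "k = restrict k0 Basis"
      have xE: "x \<in> E m k" using k0 by (auto simp: E_def k_def)
      have kI: "(m, k, l) \<in> I" for l by (auto simp: I_def k_def)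
      define q where "q i = of_int (k i) * \<epsilon> m" for i
      have "\<exists>d>0. \<forall>h. norm h < d \<longrightarrow>
           \<bar>f (x + h) - f x - (\<Sum>i\<in>Basis. q i * (h \<bullet> i))\<bar> \<le> (real DIM('a) + 1 + 2 * K) * \<epsilon> m * norm h"
      proof (rule density_point_linear_approx[OF lip \<epsilon> E[of m k]])
        show "w \<in> dini_ge f i (q i) - dini_ge f i (q i + \<epsilon> m)" if "w \<in> E m k" "i \<in> Basis" for w i
          using that by (auto simp: E_def q_def distrib_right)
        show "\<exists>d>0. \<forall>r. 0 < r \<and> r < d \<longrightarrow> ?\<mu> (cball x r - E m k) < \<eta> * ?\<mu> (cball x r)" if "\<eta> > 0" for \<eta>
        proof -
          obtain l where l: "\<epsilon> l < \<eta>" unfolding \<epsilon>_def using nat_approx_posE[of \<eta>] \<open>\<eta> > 0\<close> by auto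
          obtain d where d: "d > 0" "\<And>r. \<lbrakk>0 < r; r < d\<rbrakk> \<Longrightarrow> ?\<mu> (cball x r - E m k) < \<epsilon> l * ?\<mu> (cball x r)"
            using x(2)[OF kI[of l]] xE unfolding \<N>_def by (auto simp: not_le)
          have "\<epsilon> l * ?\<mu> (cball x r) \<le> \<eta> * ?\<mu> (cball x r)" for r
            using l by (intro mult_right_mono) auto
          then show ?thesis using d by (meson less_le_trans)
        qed
      qed
      then obtain d where d: "d > 0" "\<And>h. norm h < d \<Longrightarrow>
           \<bar>f (x + h) - f x - (\<Sum>i\<in>Basis. q i * (h \<bullet> i))\<bar> \<le> C * \<epsilon> m * norm h"
        unfolding C_def by blast
      have "C * \<epsilon> m * norm h \<le> e * norm h" for h :: 'a
        using m C by (intro mult_right_mono) (auto simp: field_simps)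
      moreover have "(\<Sum>i\<in>Basis. q i *\<^sub>R i) \<bullet> h = (\<Sum>i\<in>Basis. q i * (h \<bullet> i))" for h
        by (simp add: inner_sum_left inner_commute[of h])
      ultimately show ?thesis
        using d by (intro exI[of _ "\<Sum>i\<in>Basis. q i *\<^sub>R i"] exI[of _ d]) (auto intro: order_trans)
    qed
    then show False using differentiable_if_linear_approx x(1) by blast
  qed
  ultimately show ?thesis by (rule negligible_subset)
qed

text \<open>The nearest-point map onto the ball is 1-Lipschitz and fixes the ball, so composing with
  it extends \<open>f\<close> to the whole space with the same constant; the scalar case then
  handles the components.\<close>

theorem rademacher:
  fixes f :: "'a::euclidean_space \<Rightarrow> 'b::euclidean_space"
  assumes lip: "K-lipschitz_on (cball c r) f"
  shows "negligible {x \<in> ball c r. \<not> f differentiable (at x)}"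
proof (cases "r > 0")
  case True
  let ?B = "cball c r"
  define g where "g x = f (closest_point ?B x)" for x
  have ne: "?B \<noteq> {}" using True by auto
  have lipg: "K-lipschitz_on UNIV (\<lambda>x. g x \<bullet> i)" if "i \<in> Basis" for i
  proof (rule lipschitz_onI)
    fix x y
    have "dist (g x \<bullet> i) (g y \<bullet> i) \<le> dist (g x) (g y)"
      using Basis_le_norm[OF that, of "g x - g y"] by (simp add: dist_norm inner_diff_left)
    also have "\<dots> \<le> K * dist (closest_point ?B x) (closest_point ?B y)"
      unfolding g_def by (rule lipschitz_onD[OF lip]) (use closest_point_in_set[OF closed_cball ne] in auto)
    also have "\<dots> \<le> K * dist x y"
      using closest_point_lipschitz[OF convex_cball closed_cball ne] lipschitz_on_nonneg[OF lip]
      by (intro mult_left_mono)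
    finally show "dist (g x \<bullet> i) (g y \<bullet> i) \<le> K * dist x y" .
  qed (rule lipschitz_on_nonneg[OF lip])
  have "negligible (\<Union>i\<in>Basis. {x. \<not> (\<lambda>x. g x \<bullet> i) differentiable (at x)})"
    by (intro negligible_Union) (auto intro: rademacher_real[OF lipg])
  moreover have "f differentiable (at x)" if x: "x \<in> ball c r" "\<And>i. i \<in> Basis \<Longrightarrow> (\<lambda>x. g x \<bullet> i) differentiable (at x)" for x
  proof -
    have "g differentiable (at x)"
      using x(2) by (subst differentiable_componentwise_within) auto
    then obtain g' where "(g has_derivative g') (at x)" by (auto simp: differentiable_def)
    moreover have "g y = f y" if "y \<in> ball c r" for y
      using that by (simp add: g_def closest_point_self)
    ultimately have "(f has_derivative g') (at x)"
      using x(1) by (intro has_derivative_transform_within_open[of g g' x UNIV "ball c r" f]) auto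
    then show ?thesis by (auto simp: differentiable_def)
  qed
  ultimately show ?thesis by (elim negligible_subset) blast
next
  case False
  then have "{x \<in> ball c r. \<not> f differentiable (at x)} = {}" by (simp add: ball_empty)
  then show ?thesis by (simp only: negligible_empty)
qed

section \<open>Mean value inequality outside a null set\<close>

text \<open>For almost every \<open>w\<close> the segment from \<open>w\<close> to
  \<open>w + (y - x)\<close> meets \<open>N\<close> in a null set, and there the derivative bound
  integrates by \<open>dini_increment_ge\<close>. Continuity carries the result from such
  \<open>w\<close> near \<open>x\<close> to \<open>x\<close>.\<close>

lemma lipschitz_mean_value_ge:
  fixes f :: "'a::euclidean_space \<Rightarrow> real"
  assumes lip: "K-lipschitz_on (ball c r) f" and N: "negligible N"
    and x: "x \<in> ball c r" and y: "y \<in> ball c r"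
    and D: "\<And>u. \<lbrakk>u \<in> ball c r; u \<notin> N\<rbrakk> \<Longrightarrow> \<exists>f'. (f has_derivative f') (at u) \<and> a \<le> f' (y - x)"
  shows "a \<le> f y - f x"
proof (rule ccontr)
  assume neg: "\<not> a \<le> f y - f x"
  define v where "v = y - x"
  have K0: "K \<ge> 0" using lip by (rule lipschitz_on_nonneg)
  have "N \<in> null_sets (completion lborel)" using N by (simp add: negligible_iff_null_sets)
  then obtain N' where N': "N' \<in> null_sets lborel" "N \<subseteq> N'"
    by (auto simp: null_sets_completion_iff2)
  define m where "m w = emeasure lborel {s \<in> {0..1}. w + s *\<^sub>R v \<in> N'}" for w
  have m: "m \<in> borel_measurable borel" "(\<integral>\<^sup>+w. m w \<partial>lborel) = 0"
    unfolding m_def using nn_integral_line_measure[of N' 1 v] N'(1) by (auto simp: null_sets_def)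
  have AE: "AE w in lborel. m w = 0"
    using m by (simp add: nn_integral_0_iff_AE)
  have inc: "a \<le> f (w + v) - f w" if w: "w \<in> ball c r" "w + v \<in> ball c r" "m w = 0" for w
  proof -
    define \<phi> where "\<phi> s = f (w + s *\<^sub>R v)" for s
    have seg: "w + s *\<^sub>R v \<in> ball c r" if "0 \<le> s" "s \<le> 1" for s
      using convexD_alt[OF convex_ball w(1,2) that] by (simp add: algebra_simps)
    define S where "S = {s. w + s *\<^sub>R v \<in> N'}"
    have "S = (\<lambda>s. w + s *\<^sub>R v) -` N' \<inter> space borel" by (auto simp: S_def)
    also have "\<dots> \<in> sets borel" by (rule measurable_sets[of _ borel borel]) (use N'(1) in auto)
    finally have S: "S \<in> sets borel" .
    have lip1: "(K * norm v)-lipschitz_on {0..1} \<phi>"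
    proof (rule lipschitz_onI)
      fix p q :: real assume "p \<in> {0..1}" "q \<in> {0..1}"
      then have "dist (\<phi> p) (\<phi> q) \<le> K * dist (w + p *\<^sub>R v) (w + q *\<^sub>R v)"
        unfolding \<phi>_def by (intro lipschitz_onD[OF lip] seg) auto
      also have "dist (w + p *\<^sub>R v) (w + q *\<^sub>R v) = norm v * dist p q"
        by (simp add: dist_norm dist_real_def flip: scaleR_diff_left)
      finally show "dist (\<phi> p) (\<phi> q) \<le> K * norm v * dist p q" by (simp add: mult.assoc)
    qed (use K0 in simp)
    have "\<phi> 1 - \<phi> 0 \<ge> a * (1 - 0) - (K * norm v + \<bar>a\<bar>) * measure lborel (S \<inter> {0..1})"
    proof (rule dini_increment_ge[OF _ lip1 S])
      fix s e :: real assume s: "0 \<le> s" "s < 1" "s \<notin> S" "e > 0"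
      then have "w + s *\<^sub>R v \<in> ball c r" "w + s *\<^sub>R v \<notin> N" using seg N'(2) by (auto simp: S_def)
      then obtain f' where f': "(f has_derivative f') (at (w + s *\<^sub>R v))" "a \<le> f' v"
        using D unfolding v_def by blast
      have "((\<lambda>s. w + s *\<^sub>R v) has_derivative (\<lambda>t. t *\<^sub>R v)) (at s)"
        by (auto intro!: derivative_eq_intros)
      from has_derivative_compose[OF this f'(1)]
      have "(\<phi> has_derivative (\<lambda>t. f' (t *\<^sub>R v))) (at s)" by (simp add: \<phi>_def[abs_def])
      moreover have "(\<lambda>t. f' (t *\<^sub>R v)) = (\<lambda>t. f' v * t)"
        using linear_scale[OF has_derivative_linear[OF f'(1)]] by (auto simp: mult.commute)
      ultimately have "(\<phi> has_derivative (\<lambda>t. f' v * t)) (at s)" by simp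
      then obtain d where d: "d > 0" "\<And>z. norm (z - s) < d \<Longrightarrow> norm (\<phi> z - \<phi> s - f' v * (z - s)) \<le> e * norm (z - s)"
        unfolding has_derivative_at_alt using s(4) by blast
      define z where "z = s + min d e / 2"
      have z: "s < z" "z < s + e" "norm (z - s) < d" using d(1) s(4) by (auto simp: z_def)
      have "\<phi> z - \<phi> s \<ge> f' v * (z - s) - e * (z - s)" using d(2)[OF z(3)] z(1) by (simp add: abs_le_iff)
      moreover have "a * (z - s) \<le> f' v * (z - s)" using f'(2) z(1) by (intro mult_right_mono) auto
      ultimately show "\<exists>z>s. z < s + e \<and> (a - e) * (z - s) \<le> \<phi> z - \<phi> s"
        using z(1,2) unfolding left_diff_distrib[of a e] by (intro exI[of _ z] conjI) linarith+
    qed simp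
    moreover have "S \<inter> {0..1} = {s \<in> {0..1}. w + s *\<^sub>R v \<in> N'}" by (auto simp: S_def)
    ultimately show ?thesis using w(3) by (simp add: \<phi>_def m_def measure_def)
  qed
  have contf: "continuous_on (ball c r) f" using lip by (rule lipschitz_on_continuous_on)
  have "isCont f x" "isCont f y"
    using contf x y by (auto simp: continuous_on_eq_continuous_at)
  then have "isCont (\<lambda>w. f (w + v) - f w) x"
    unfolding v_def by (intro continuous_intros isCont_o2[where f="\<lambda>w. w + (y - x)" and g=f]) auto
  then have "((\<lambda>w. f (w + v) - f w) \<longlongrightarrow> f y - f x) (at x)"
    by (simp add: isCont_def v_def)
  \<comment> \<open>Failure at \<open>x\<close> would persist for all \<open>w\<close> near
    \<open>x\<close>, where \<open>inc\<close> then forces \<open>m w \<noteq> 0\<close>; a ball of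
    positive measure contradicts the almost everywhere vanishing of \<open>m\<close>.\<close>
  then have "\<forall>\<^sub>F w in at x. f (w + v) - f w < a"
    using neg by (intro order_tendstoD) auto
  moreover have "\<forall>\<^sub>F w in at x. w \<in> ball c r" using x by (intro eventually_at_in_open') auto
  moreover have "\<forall>\<^sub>F w in at x. w + v \<in> ball c r"
  proof -
    have "((\<lambda>w. w + v) \<longlongrightarrow> y) (at x)" unfolding v_def by (auto intro!: tendsto_eq_intros)
    then show ?thesis using y by (rule topological_tendstoD[OF _ open_ball])
  qed
  ultimately have "\<forall>\<^sub>F w in at x. m w \<noteq> 0"
    by eventually_elim (use inc in force)
  then obtain d where d: "d > 0" "\<And>w. \<lbrakk>w \<noteq> x; dist w x < d\<rbrakk> \<Longrightarrow> m w \<noteq> 0"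
    by (auto simp: eventually_at)
  have "AE w in lborel. w \<notin> ball x d"
    using AE AE_lborel_singleton[of x] by eventually_elim (use d(2) in \<open>auto simp: dist_commute\<close>)
  then have "emeasure lborel (ball x d) = 0"
    by (subst (asm) AE_iff_measurable[of "ball x d"]) auto
  then show False using content_ball_pos[OF d(1), of x] by (simp add: measure_def)
qed

subsection \<open>Convergence of subspaces\<close>

lemma proj_unique:
  fixes L :: "'a::real_inner set"
  assumes L: "subspace L" and w: "w \<in> L" "z - w \<in> L\<^sup>\<bottom>"
  shows "proj L z = w"
  unfolding proj_def
proof (rule the_equality)
  show "w \<in> L \<and> z - w \<in> L\<^sup>\<bottom>" using w by simp
  fix w' assume w': "w' \<in> L \<and> z - w' \<in> L\<^sup>\<bottom>"
  have "w' - w \<in> L" using w' w L by (simp add: subspace_diff)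
  then have "(w' - w) \<bullet> (z - w) = 0" "(w' - w) \<bullet> (z - w') = 0"
    using w' w by (auto simp: orthogonal_comp_def orthogonal_def)
  then have "(w' - w) \<bullet> (w' - w) = 0" by (simp add: inner_diff_right)
  then show "w' = w" by simp
qed

lemma proj_mem:
  fixes L :: "'a::euclidean_space set"
  assumes L: "subspace L"
  shows "proj L z \<in> L" "z - proj L z \<in> L\<^sup>\<bottom>"
proof -
  obtain a b where ab: "a \<in> L" "b \<in> L\<^sup>\<bottom>" "z = a + b"
    using subspace_sum_orthogonal_comp[OF L] by (metis UNIV_I set_plus_elim)
  then have "proj L z = a" by (intro proj_unique L) auto
  then show "proj L z \<in> L" "z - proj L z \<in> L\<^sup>\<bottom>" using ab by auto
qed

lemma linear_proj:
  fixes L :: "'a::euclidean_space set"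
  assumes L: "subspace L"
  shows "linear (proj L)"
proof (rule linearI)
  have LP: "subspace (L\<^sup>\<bottom>)" by (rule subspace_orthogonal_comp)
  show "proj L (x + y) = proj L x + proj L y" for x y
    using subspace_add[OF LP proj_mem(2)[OF L, of x] proj_mem(2)[OF L, of y]]
    by (intro proj_unique L subspace_add proj_mem) (simp add: algebra_simps)
  show "proj L (c *\<^sub>R x) = c *\<^sub>R proj L x" for c x
    using subspace_scale[OF LP proj_mem(2)[OF L, of x], of c]
    by (intro proj_unique L subspace_scale proj_mem) (simp add: algebra_simps)
qed

lemma norm_proj_le:
  fixes L :: "'a::euclidean_space set"
  assumes L: "subspace L"
  shows "norm (proj L z) \<le> norm z" "norm (z - proj L z) \<le> norm z"
proof -
  have "orthogonal (proj L z) (z - proj L z)"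
    using proj_mem[OF L, of z] by (auto simp: orthogonal_comp_def)
  from norm_add_Pythagorean[OF this]
  have "(norm z)\<^sup>2 = (norm (proj L z))\<^sup>2 + (norm (z - proj L z))\<^sup>2" by simp
  then have "(norm (proj L z))\<^sup>2 \<le> (norm z)\<^sup>2" "(norm (z - proj L z))\<^sup>2 \<le> (norm z)\<^sup>2" by auto
  then show "norm (proj L z) \<le> norm z" "norm (z - proj L z) \<le> norm z"
    by (auto intro: power2_le_imp_le)
qed

lemma norm_proj_diff_le_dZ:
  fixes L1 L2 :: "'a::euclidean_space set"
  assumes "subspace L1" "subspace L2"
  shows "norm (proj L1 z - proj L2 z) \<le> dZ L1 L2 * norm z"
  unfolding dZ_def
  by (intro onorm linear_conv_bounded_linear[THEN iffD1] linear_compose_sub linear_proj assms)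

lemma dZ_nonneg:
  fixes L1 L2 :: "'a::euclidean_space set"
  assumes "subspace L1" "subspace L2"
  shows "0 \<le> dZ L1 L2"
  unfolding dZ_def
  by (intro onorm_pos_le linear_conv_bounded_linear[THEN iffD1] linear_compose_sub linear_proj assms)

text \<open>Injectivity bounds \<open>Z\<close> below by some \<open>c > 0\<close>, and maps within
  \<open>c / 2\<close> of \<open>Z\<close> keep the bound \<open>c / 2\<close>. No rank is lost, so
  each range is relatively close to the other; the two deviations contribute 1 and 2 to the constant
  \<open>3 / c\<close>.\<close>

lemma dZ_range_tendsto_0:
  fixes Z :: "'a::euclidean_space \<Rightarrow>\<^sub>L 'b::euclidean_space"
  assumes lim: "Zs \<longlonglongrightarrow> Z" and inj: "inj (blinfun_apply Z)"
  shows "(\<lambda>k. dZ (range (blinfun_apply Z)) (range (blinfun_apply (Zs k)))) \<longlonglongrightarrow> 0"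
proof -
  let ?L = "range (blinfun_apply Z)" and ?Lk = "\<lambda>k. range (blinfun_apply (Zs k))"
  have sub: "subspace (range (blinfun_apply Y))" for Y :: "'a \<Rightarrow>\<^sub>L 'b"
    by (intro linear_subspace_image subspace_UNIV) (simp add: blinfun.bounded_linear_right bounded_linear.linear)
  have "linear (blinfun_apply Z)" by (simp add: blinfun.bounded_linear_right bounded_linear.linear)
  then obtain c where c: "c > 0" "\<And>p. c * norm p \<le> norm (Z p)"
    using linear_inj_bounded_below_pos[OF _ inj] by blast
  have bound: "dZ ?L (?Lk k) \<le> 3 / c * norm (Zs k - Z)" if k: "norm (Zs k - Z) \<le> c / 2" for k
    unfolding dZ_def
  proof (rule onorm_bound)
    fix z
    let ?P = "proj ?L" and ?Q = "proj (?Lk k)"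
    define \<delta> where "\<delta> = norm (Zs k - Z)"
    have \<delta>: "norm (Zs k p - Z p) \<le> \<delta> * norm p" for p
      using norm_blinfun[of "Zs k - Z" p] by (simp add: blinfun.diff_left \<delta>_def)
    have low: "c / 2 * norm p \<le> norm (Zs k p)" for p
    proof -
      have "\<delta> * norm p \<le> c / 2 * norm p" using k by (intro mult_right_mono) (auto simp: \<delta>_def)
      then show ?thesis using \<delta>[of p] c(2)[of p] norm_triangle_ineq2[of "Z p" "Z p - Zs k p"]
        by (simp add: norm_minus_commute)
    qed
    have linQ: "linear ?Q" by (rule linear_proj[OF sub])
    \<comment> \<open>With \<open>P\<close>, \<open>Q\<close> the two projections this is
      \<open>P - Q = (I - Q) P - Q (I - P)\<close>: one term measures how far the limit range is
      from the approximating one, the other the reverse.\<close>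
    have decomp: "?P z - ?Q z = (?P z - ?Q (?P z)) - ?Q (z - ?P z)"
      using linear_diff[OF linQ] by simp
    obtain p where p: "?P z = Z p" using proj_mem(1)[OF sub] by blast
    have "?Q (Zs k p) = Zs k p"
      by (intro proj_unique sub) (auto simp: orthogonal_comp_def orthogonal_def)
    then have "?P z - ?Q (?P z) = (Z p - Zs k p) - ?Q (Z p - Zs k p)"
      using p linear_diff[OF linQ] by simp
    then have "norm (?P z - ?Q (?P z)) \<le> norm (Z p - Zs k p)"
      using norm_proj_le(2)[OF sub] by simp
    also have "\<dots> \<le> \<delta> * norm p" using \<delta>[of p] by (simp add: norm_minus_commute)
    also have "\<dots> \<le> \<delta> * (norm z / c)"
    proof (intro mult_left_mono)
      have "c * norm p \<le> norm z" using c(2)[of p] norm_proj_le(1)[OF sub, of Z z] p by simp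
      then show "norm p \<le> norm z / c" using c(1) by (simp add: field_simps)
    qed (simp add: \<delta>_def)
    finally have 1: "norm (?P z - ?Q (?P z)) \<le> \<delta> * (norm z / c)" .
    \<comment> \<open>\<open>b\<close> is orthogonal to the limit range while
      \<open>?Q b = Zs k q\<close> is close to \<open>Z q\<close> in that range, so the inner
      product of \<open>b\<close> with \<open>?Q b\<close>, which is the squared norm of
      \<open>?Q b\<close>, is small.\<close>
    define b where "b = z - ?P z"
    obtain q where q: "?Q b = Zs k q" using proj_mem(1)[OF sub] by blast
    have b: "b \<bullet> Z q = 0"
      using proj_mem(2)[OF sub, of z Z] by (auto simp: orthogonal_comp_def orthogonal_def b_def inner_commute)
    have "(b - ?Q b) \<bullet> Zs k q = 0"
      using proj_mem(2)[OF sub, of b "Zs k"] by (auto simp: orthogonal_comp_def orthogonal_def inner_commute)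
    then have "norm (?Q b) * norm (?Q b) = b \<bullet> (Zs k q - Z q)"
      using b by (simp add: q inner_diff_left inner_diff_right power2_norm_eq_inner[symmetric] power2_eq_square)
    also have "\<dots> \<le> norm b * norm (Zs k q - Z q)" by (rule norm_cauchy_schwarz)
    also have "\<dots> \<le> norm b * (\<delta> * norm q)" by (intro mult_left_mono \<delta>) simp
    also have "\<dots> \<le> norm b * (\<delta> * (2 / c * norm (?Q b)))"
    proof -
      have "norm q \<le> 2 / c * norm (?Q b)" using low[of q] c(1) by (simp add: q field_simps)
      then show ?thesis by (intro mult_left_mono) (auto simp: \<delta>_def)
    qed
    finally have "norm (?Q b) * norm (?Q b) \<le> (2 / c * \<delta> * norm b) * norm (?Q b)" by (simp add: mult_ac)
    then have "norm (?Q b) \<le> 2 / c * \<delta> * norm b"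
      using c(1) by (cases "?Q b = 0") (auto simp: \<delta>_def intro: mult_right_le_imp_le)
    also have "\<dots> \<le> 2 / c * \<delta> * norm z"
      using norm_proj_le(2)[OF sub, of z Z] c(1) by (intro mult_left_mono) (auto simp: b_def \<delta>_def)
    finally have "norm (?Q b) \<le> 2 / c * \<delta> * norm z" .
    then have "norm (?P z - ?Q z) \<le> \<delta> * (norm z / c) + 2 / c * \<delta> * norm z"
      using 1 norm_triangle_ineq4[of "?P z - ?Q (?P z)" "?Q b"] unfolding decomp b_def by linarith
    also have "\<dots> = 3 / c * \<delta> * norm z" by (simp add: field_simps)
    finally show "norm (?P z - ?Q z) \<le> 3 / c * norm (Zs k - Z) * norm z" by (simp add: \<delta>_def)
  qed (use c in simp)
  have lim0: "(\<lambda>k. norm (Zs k - Z)) \<longlonglongrightarrow> 0"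
    using lim by (simp add: LIM_zero tendsto_norm_zero)
  then have "\<forall>\<^sub>F k in sequentially. norm (Zs k - Z) < c / 2"
    by (rule order_tendstoD) (use c in simp)
  then have ev: "\<forall>\<^sub>F k in sequentially. dZ ?L (?Lk k) \<le> 3 / c * norm (Zs k - Z)"
    by eventually_elim (rule bound, simp)
  have "(\<lambda>k. 3 / c * norm (Zs k - Z)) \<longlonglongrightarrow> 0"
    using tendsto_mult_left[OF lim0, of "3 / c"] by simp
  then show ?thesis
    by (rule tendsto_sandwich[OF always_eventually[OF allI[OF dZ_nonneg[OF sub sub]]] ev tendsto_const])
qed

section \<open>Adjoint subspaces as rotated orthogonal complements\<close>

text \<open>A linear isometry that factors \<open>adj\<close> as orthogonal complement followed by a
  quarter turn. The projection onto \<open>adj L\<close> is therefore conjugate to the identity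
  minus \<open>proj L\<close>.\<close>

definition rot :: "'a::real_vector \<times> 'a \<Rightarrow> 'a \<times> 'a" where "rot z = (- snd z, fst z)"

lemma linear_rot: "linear rot"
  by (rule linearI) (auto simp: rot_def)

lemma inj_rot: "inj rot"
  by (auto simp: rot_def inj_def prod_eq_iff)

lemma inner_rot [simp]: "rot x \<bullet> rot y = x \<bullet> (y :: 'a::real_inner \<times> 'a)"
  by (auto simp: rot_def inner_prod_def)

lemma norm_rot [simp]: "norm (rot x) = norm (x :: 'a::real_inner \<times> 'a)"
  by (simp add: norm_eq_sqrt_inner)

lemma adj_eq_rot: "adj L = rot ` (L\<^sup>\<bottom>)"
  by (force simp: adj_def rot_def image_iff)

lemma subspace_adj: "subspace (adj L)"
  unfolding adj_eq_rot by (intro linear_subspace_image linear_rot subspace_orthogonal_comp)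

lemma adj_Zn:
  fixes L :: "((real ^ 'n) \<times> (real ^ 'n)) set"
  assumes "L \<in> Zn"
  shows "adj L \<in> Zn"
proof -
  have "subspace L" "dim L = CARD('n)" using assms by (auto simp: Zn_def)
  moreover have "dim {y \<in> UNIV. \<forall>x \<in> L. orthogonal x y} + dim L = dim (UNIV :: ((real ^ 'n) \<times> (real ^ 'n)) set)"
    by (rule dim_subspace_orthogonal_to_vectors) (use calculation in auto)
  ultimately have "dim (L\<^sup>\<bottom>) = CARD('n)" by (simp add: orthogonal_comp_def)
  moreover have "dim (adj L) = dim (L\<^sup>\<bottom>)"
    unfolding adj_eq_rot by (rule dim_image_eq) (auto intro: linear_rot inj_on_subset[OF inj_rot])
  ultimately show ?thesis by (simp add: Zn_def subspace_adj)
qed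

lemma proj_adj:
  assumes L: "subspace L"
  shows "proj (adj L) (rot z) = rot (z - proj L z)"
proof (rule proj_unique[OF subspace_adj])
  show "rot (z - proj L z) \<in> adj L" using proj_mem(2)[OF L] by (simp add: adj_eq_rot)
  have "rot z - rot (z - proj L z) = rot (proj L z)" by (simp flip: linear_diff[OF linear_rot])
  moreover have "rot (proj L z) \<in> (adj L)\<^sup>\<bottom>"
    using proj_mem(1)[OF L, of z] by (auto simp: adj_eq_rot orthogonal_comp_def orthogonal_def inner_commute)
  ultimately show "rot z - rot (z - proj L z) \<in> (adj L)\<^sup>\<bottom>" by simp
qed

text \<open>Complementary projections differ by the negative of the difference of the projections,
  and conjugation by an isometry preserves the operator norm.\<close>

lemma dZ_adj_le:
  fixes L1 L2 :: "((real ^ 'n) \<times> (real ^ 'n)) set"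
  assumes L: "subspace L1" "subspace L2"
  shows "dZ (adj L1) (adj L2) \<le> dZ L1 L2"
  unfolding dZ_def[of "adj L1"]
proof (rule onorm_bound)
  fix w :: "(real ^ 'n) \<times> (real ^ 'n)"
  define z where "z = (snd w, - fst w)"
  have w: "w = rot z" by (simp add: rot_def z_def)
  have "proj (adj L1) w - proj (adj L2) w = rot (proj L2 z - proj L1 z)"
    unfolding w by (simp add: proj_adj L flip: linear_diff[OF linear_rot])
  then show "norm (proj (adj L1) w - proj (adj L2) w) \<le> dZ L1 L2 * norm w"
    using norm_proj_diff_le_dZ[OF L, of z] by (simp add: w norm_minus_commute)
qed (rule dZ_nonneg[OF L])

lemma range_Zn:
  fixes Z :: "(real ^ 'n) \<Rightarrow>\<^sub>L ((real ^ 'n) \<times> (real ^ 'n))"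
  assumes "inj (blinfun_apply Z)"
  shows "range (blinfun_apply Z) \<in> Zn"
proof -
  have lin: "linear (blinfun_apply Z)" by (simp add: blinfun.bounded_linear_right bounded_linear.linear)
  have "dim (range (blinfun_apply Z)) = dim (UNIV :: (real ^ 'n) set)"
    by (rule dim_image_eq[OF lin]) (use assms in auto)
  then show ?thesis using lin by (simp add: Zn_def linear_subspace_image)
qed

lemma range_in_SF:
  fixes Z :: "(real ^ 'n) \<Rightarrow>\<^sub>L ((real ^ 'n) \<times> (real ^ 'n))"
  assumes "\<And>k. zs k \<in> O_set F" "zs \<longlonglongrightarrow> z" "Zs \<longlonglongrightarrow> Z" "inj (blinfun_apply Z)"
    and "\<And>k. tangent_cone (gph F) (zs k) = range (blinfun_apply (Zs k))"
  shows "range (blinfun_apply Z) \<in> SF F z"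
  unfolding SF_def
  using range_Zn[OF assms(4)] dZ_range_tendsto_0[OF assms(3,4)] assms(1,2)
  by (intro CollectI conjI exI[of _ zs]) (simp_all add: assms(5))

lemma adj_in_SF_adj:
  assumes "L \<in> SF F z"
  shows "adj L \<in> SF_adj F z"
proof -
  obtain zs where zs: "\<And>k. zs k \<in> O_set F" "zs \<longlonglongrightarrow> z" "L \<in> Zn"
     "(\<lambda>k. dZ L (tangent_cone (gph F) (zs k))) \<longlonglongrightarrow> 0"
    using assms by (auto simp: SF_def)
  have sub: "subspace L" "\<And>k. subspace (tangent_cone (gph F) (zs k))"
    using zs(1,3) by (auto simp: O_set_def Zn_def)
  have "(\<lambda>k. dZ (adj L) (adj (tangent_cone (gph F) (zs k)))) \<longlonglongrightarrow> 0"
    by (rule tendsto_sandwich[OF _ _ tendsto_const zs(4)])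
      (auto intro!: always_eventually dZ_nonneg dZ_adj_le sub subspace_adj)
  then show ?thesis
    unfolding SF_adj_def using zs(1,2) adj_Zn[OF zs(3)] by (intro CollectI conjI exI[of _ zs] allI)
qed

text \<open>The bound makes \<open>snd\<close> injective on \<open>T\<close>, so by dimension
  \<open>T\<close> consists of the pairs \<open>(A p, p)\<close> for a linear \<open>A\<close> of
  norm at most \<open>\<kappa>\<close>. Then \<open>adj T\<close> consists of the pairs
  \<open>(B u, u)\<close> with \<open>B\<close> the transpose of \<open>A\<close>, which has the
  same norm.\<close>

lemma adj_norm_bound:
  fixes T :: "((real ^ 'n) \<times> (real ^ 'n)) set"
  assumes T: "T \<in> Zn" and bound: "\<And>w. w \<in> T \<Longrightarrow> norm (fst w) \<le> \<kappa> * norm (snd w)"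
    and yx: "(y, x) \<in> adj T"
  shows "norm y \<le> \<kappa> * norm x"
proof -
  have sub: "subspace T" and dim: "dim T = CARD('n)" using T by (auto simp: Zn_def)
  have lin: "linear (snd :: (real ^ 'n) \<times> (real ^ 'n) \<Rightarrow> _)" by (simp add: linear_snd)
  have inj: "inj_on snd T"
    using bound by (subst linear_inj_on_iff_eq_0[OF lin sub]) (force simp: prod_eq_iff)
  have "dim (snd ` T) = CARD('n)"
    using dim_image_eq[OF lin, of T] inj dim span_eq_iff[THEN iffD2, OF sub] by metis
  moreover have "subspace (snd ` T)" using lin sub by (rule linear_subspace_image)
  ultimately have "snd ` T = UNIV"
    by (intro subspace_dim_equal) auto
  moreover obtain u v where uv: "y = - v" "x = u" "(u, v) \<in> T\<^sup>\<bottom>" using yx by (auto simp: adj_def)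
  \<comment> \<open>Testing orthogonality on the element of \<open>T\<close> above \<open>v\<close>
    itself produces the square of \<open>norm v\<close>.\<close>
  ultimately obtain w where w: "w \<in> T" "snd w = v" by (metis UNIV_I imageE)
  have "u \<bullet> fst w + v \<bullet> v = 0"
    using uv(3) w by (auto simp: orthogonal_comp_def orthogonal_def inner_prod_def inner_commute)
  then have "norm v * norm v = - (u \<bullet> fst w)"
    by (simp add: power2_norm_eq_inner[symmetric] power2_eq_square)
  also have "\<dots> \<le> norm u * norm (fst w)" using Cauchy_Schwarz_ineq2[of u "fst w"] by linarith
  also have "\<dots> \<le> norm u * (\<kappa> * norm v)" using bound[OF w(1)] w(2) by (intro mult_left_mono) auto
  finally have *: "norm v * norm v \<le> (\<kappa> * norm u) * norm v" by (simp add: mult_ac)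
  show ?thesis
  proof (cases "v = 0")
    case False
    then show ?thesis using * uv by simp
  next
    case True
    show ?thesis
    proof (cases "x = 0")
      case False
      \<comment> \<open>The sign of \<open>\<kappa>\<close> is unknown here; an element of
        \<open>T\<close> above \<open>x\<close> shows that \<open>\<kappa> * norm x\<close> is
        nonnegative.\<close>
      obtain w where "w \<in> T" "snd w = x" using \<open>snd ` T = UNIV\<close> by (metis UNIV_I imageE)
      then have "0 \<le> \<kappa> * norm x" using bound[of w] by (auto intro: order_trans[OF norm_ge_zero])
      then show ?thesis using True uv by simp
    qed (use True uv in simp)
  qed
qed

text \<open>The bound is closed under convergence in \<open>dZ\<close>: the projections of
  \<open>(y, x)\<close> onto the approximating adjoints satisfy it and converge to
  \<open>(y, x)\<close>.\<close>

lemma SF_adj_norm_bound: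
  assumes L: "L \<in> SF_adj F z" and W: "open W" "z \<in> W"
    and bound: "\<And>z' w. \<lbrakk>z' \<in> gph F \<inter> W; w \<in> tangent_cone (gph F) z'\<rbrakk> \<Longrightarrow> norm (fst w) \<le> \<kappa> * norm (snd w)"
    and yx: "(y, x) \<in> L"
  shows "norm y \<le> \<kappa> * norm x"
proof -
  obtain zs where zs: "\<And>k. zs k \<in> O_set F" "zs \<longlonglongrightarrow> z" "L \<in> Zn"
     "(\<lambda>k. dZ L (adj (tangent_cone (gph F) (zs k)))) \<longlonglongrightarrow> 0"
    using L by (auto simp: SF_adj_def)
  let ?A = "\<lambda>k. adj (tangent_cone (gph F) (zs k))"
  define w where "w k = proj (?A k) (y, x)" for k
  have subL: "subspace L" using zs(3) by (auto simp: Zn_def)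
  have projL: "proj L (y, x) = (y, x)"
    using yx by (intro proj_unique subL) (auto simp: orthogonal_comp_def orthogonal_def)
  have "norm ((y, x) - w k) \<le> dZ L (?A k) * norm (y, x)" for k
    using norm_proj_diff_le_dZ[OF subL subspace_adj, of "(y, x)"] by (simp add: projL w_def)
  moreover have "(\<lambda>k. dZ L (?A k) * norm (y, x)) \<longlonglongrightarrow> 0"
    using tendsto_mult_left_zero[OF zs(4)] by simp
  ultimately have "(\<lambda>k. (y, x) - w k) \<longlonglongrightarrow> 0"
    by (rule Lim_null_comparison[OF always_eventually, OF allI])
  from tendsto_diff[OF tendsto_const[of "(y, x)"] this] have w: "w \<longlonglongrightarrow> (y, x)"
    by (simp only: diff_diff_eq2 add_diff_cancel_left' diff_zero)
  have lim: "(\<lambda>k. norm (fst (w k))) \<longlonglongrightarrow> norm y" "(\<lambda>k. \<kappa> * norm (snd (w k))) \<longlonglongrightarrow> \<kappa> * norm x"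
    using tendsto_norm[OF tendsto_fst[OF w]] tendsto_mult_left[OF tendsto_norm[OF tendsto_snd[OF w]]]
    by (simp_all only: fst_conv snd_conv)
  have "\<forall>\<^sub>F k in sequentially. zs k \<in> W" using zs(2) W by (rule topological_tendstoD)
  then have "\<forall>\<^sub>F k in sequentially. norm (fst (w k)) \<le> \<kappa> * norm (snd (w k))"
  proof eventually_elim
    case (elim k)
    have "w k \<in> ?A k" unfolding w_def by (rule proj_mem(1)[OF subspace_adj])
    then have "(fst (w k), snd (w k)) \<in> ?A k" by simp
    then show ?case
      using zs(1)[of k] elim by (intro adj_norm_bound[OF _ bound]) (auto simp: O_set_def)
  qed
  then show ?thesis using tendsto_le[OF _ lim(2,1)] by simp
qed

subsection \<open>Tangent cones of parametrized sets\<close>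

text \<open>Frechet differentiability in Hadamard form: the directions vary with \<open>k\<close>,
  as they do in \<open>tangent_cone\<close>. Convergent directions are bounded by some
  \<open>B\<close>, which makes the remainder uniform.\<close>

lemma has_derivative_sequentially:
  assumes D: "(G has_derivative D) (at u)" and t: "\<And>k. t k > (0::real)" "t \<longlonglongrightarrow> 0" and p: "ps \<longlonglongrightarrow> p"
  shows "(\<lambda>k. (G (u + t k *\<^sub>R ps k) - G u) /\<^sub>R t k) \<longlonglongrightarrow> D p"
proof -
  interpret D: bounded_linear D using D by (rule has_derivative_bounded_linear)
  let ?q = "\<lambda>k. (G (u + t k *\<^sub>R ps k) - G u) /\<^sub>R t k"
  obtain B where B: "B > 0" "\<And>k. norm (ps k) \<le> B"
    using convergent_imp_Bseq[of ps] p by (auto simp: convergent_def Bseq_def)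
  have "(\<lambda>k. ?q k - D (ps k)) \<longlonglongrightarrow> 0"
  proof (rule tendstoI)
    fix e :: real assume "e > 0"
    then have "e / (2 * B) > 0" using B by simp
    then obtain d where d: "d > 0"
      "\<And>y. norm (y - u) < d \<Longrightarrow> norm (G y - G u - D (y - u)) \<le> e / (2 * B) * norm (y - u)"
      using D unfolding has_derivative_at_alt by blast
    have "(\<lambda>k. t k *\<^sub>R ps k) \<longlonglongrightarrow> 0" using tendsto_scaleR[OF t(2) p] by simp
    then have "\<forall>\<^sub>F k in sequentially. norm (t k *\<^sub>R ps k) < d"
      using d(1) by (intro order_tendstoD(2)[OF tendsto_norm_zero])
    then show "\<forall>\<^sub>F k in sequentially. dist (?q k - D (ps k)) 0 < e"
    proof eventually_elim
      case (elim k)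
      have eq: "?q k - D (ps k) = (G (u + t k *\<^sub>R ps k) - G u - D (t k *\<^sub>R ps k)) /\<^sub>R t k"
        using t(1)[of k] by (simp add: D.scaleR scaleR_diff_right)
      have "norm (G (u + t k *\<^sub>R ps k) - G u - D (t k *\<^sub>R ps k)) \<le> e / (2 * B) * norm (t k *\<^sub>R ps k)"
        using d(2)[of "u + t k *\<^sub>R ps k"] elim by simp
      also have "\<dots> \<le> e / (2 * B) * (t k * B)"
        using t(1)[of k] B \<open>e > 0\<close> by (intro mult_left_mono) (auto intro: mult_left_mono)
      also have "\<dots> = e / 2 * t k" using B(1) by simp
      finally have "norm (?q k - D (ps k)) \<le> e / 2"
        unfolding eq norm_scaleR using t(1)[of k]
        by (simp add: abs_of_pos divide_le_eq pos_divide_le_eq flip: divide_inverse_commute)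
      then show ?case using \<open>e > 0\<close> by simp
    qed
  qed
  from tendsto_add[OF this D.tendsto[OF p]] show ?thesis by simp
qed

text \<open>The differentiable left inverse \<open>R\<close> pulls a tangent sequence back to
  parameter directions \<open>ps\<close> converging to \<open>R' w\<close>; differentiating
  \<open>G\<close> along them returns \<open>w = D (R' w)\<close>. The other inclusion uses straight
  lines in \<open>U\<close>.\<close>

lemma tangent_cone_parametrized:
  fixes G :: "'a::real_normed_vector \<Rightarrow> 'b::real_normed_vector"
  assumes U: "open U" "u \<in> U" and W: "open W" and AW: "A \<inter> W = G ` U"
    and R: "\<And>u'. u' \<in> U \<Longrightarrow> R (G u') = u'"
    and D: "(G has_derivative D) (at u)" and R': "(R has_derivative R') (at (G u))"
  shows "tangent_cone A (G u) = range D"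
proof (intro equalityI subsetI)
  fix w assume "w \<in> range D"
  then obtain p where p: "w = D p" by blast
  have "((\<lambda>s. u + s *\<^sub>R p) \<longlongrightarrow> u) (at_right 0)" by (auto intro!: tendsto_eq_intros)
  then have "\<forall>\<^sub>F s in at_right 0. u + s *\<^sub>R p \<in> U" using U by (rule topological_tendstoD)
  then obtain b where b: "b > (0::real)" "\<And>s. \<lbrakk>0 < s; s < b\<rbrakk> \<Longrightarrow> u + s *\<^sub>R p \<in> U"
    by (auto simp: eventually_at_right_field)
  \<comment> \<open>The tangent cone demands membership for every index, so already
    \<open>t 0 = b / 2\<close> must lie strictly below \<open>b\<close>.\<close>
  define t where "t k = b / (2 + real k)" for k
  have t: "0 < t k" "t k < b" for k using b(1) by (auto simp: t_def field_simps add_pos_nonneg)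
  have t0: "t \<longlonglongrightarrow> 0" unfolding t_def by real_asymp
  have "(\<lambda>k. (G (u + t k *\<^sub>R p) - G u) /\<^sub>R t k) \<longlonglongrightarrow> w"
    unfolding p by (rule has_derivative_sequentially[OF D t(1) t0 tendsto_const])
  moreover have "G u + t k *\<^sub>R ((G (u + t k *\<^sub>R p) - G u) /\<^sub>R t k) \<in> A" for k
  proof -
    have "G u + t k *\<^sub>R ((G (u + t k *\<^sub>R p) - G u) /\<^sub>R t k) = G (u + t k *\<^sub>R p)"
      using t(1)[of k] by simp
    then show ?thesis using b(2)[OF t] AW by auto
  qed
  ultimately show "w \<in> tangent_cone A (G u)"
    using t(1) t0 unfolding tangent_cone_def by blast
next
  fix w assume "w \<in> tangent_cone A (G u)"
  then obtain t ws where t: "\<And>k. t k > (0::real)" "t \<longlonglongrightarrow> 0" and ws: "ws \<longlonglongrightarrow> w" "\<And>k. G u + t k *\<^sub>R ws k \<in> A"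
    unfolding tangent_cone_def by blast
  define ps where "ps k = (R (G u + t k *\<^sub>R ws k) - R (G u)) /\<^sub>R t k" for k
  have ps: "ps \<longlonglongrightarrow> R' w" unfolding ps_def by (rule has_derivative_sequentially[OF R' t ws(1)])
  have lim: "(\<lambda>k. (G (u + t k *\<^sub>R ps k) - G u) /\<^sub>R t k) \<longlonglongrightarrow> D (R' w)"
    by (rule has_derivative_sequentially[OF D t ps])
  have "(\<lambda>k. G u + t k *\<^sub>R ws k) \<longlonglongrightarrow> G u"
    using tendsto_add[OF tendsto_const tendsto_scaleR[OF t(2) ws(1)], of "G u"] by simp
  moreover have "G u \<in> W" using AW U by blast
  ultimately have "\<forall>\<^sub>F k in sequentially. G u + t k *\<^sub>R ws k \<in> W" using W by (intro topological_tendstoD)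
  then have "\<forall>\<^sub>F k in sequentially. (G (u + t k *\<^sub>R ps k) - G u) /\<^sub>R t k = ws k"
  proof eventually_elim
    case (elim k)
    then obtain u' where u': "u' \<in> U" "G u + t k *\<^sub>R ws k = G u'" using ws(2)[of k] AW by blast
    then have "u + t k *\<^sub>R ps k = u'"
      using t(1)[of k] R U(2) by (simp add: ps_def)
    then show ?case using u'(2)[symmetric] t(1)[of k] by simp
  qed
  then have "ws \<longlonglongrightarrow> D (R' w)" using lim by (rule Lim_transform_eventually[rotated])
  then have "w = D (R' w)" using ws(1) LIMSEQ_unique by blast
  then show "w \<in> range D" by blast
qed

lemma C1_on_cong_open:
  assumes "open V" "\<And>x. x \<in> V \<Longrightarrow> f x = g x" "C1_on f V"
  shows "C1_on g V"
proof -
  obtain f' where f': "\<And>z. z \<in> V \<Longrightarrow> (f has_derivative blinfun_apply (f' z)) (at z)" "continuous_on V f'"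
    using assms(3) unfolding C1_on_def by blast
  have "(g has_derivative blinfun_apply (f' z)) (at z)" if "z \<in> V" for z
    by (rule has_derivative_transform_within_open[OF f'(1)[OF that] assms(1) that assms(2)])
  then show ?thesis unfolding C1_on_def using f'(2) by blast
qed

subsection \<open>Graphically Lipschitzian mappings\<close>

text \<open>
  Below, \<open>param\<close> parametrizes \<open>gph F \<inter> W\<close> over \<open>U\<close>, and \<open>Zmat u\<close> is its Jacobian matrix at a point of
  differentiability of \<open>f\<close>.
\<close>

locale lip_chart =
  fixes F :: "real ^ 'n \<Rightarrow> (real ^ 'n) set"
    and \<Phi> \<Psi> :: "(real ^ 'n) \<times> (real ^ 'n) \<Rightarrow> (real ^ 'n) \<times> (real ^ 'n)"
    and \<Phi>' \<Psi>' :: "(real ^ 'n) \<times> (real ^ 'n) \<Rightarrow> ((real ^ 'n) \<times> (real ^ 'n)) \<Rightarrow>\<^sub>L ((real ^ 'n) \<times> (real ^ 'n))"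
    and W :: "((real ^ 'n) \<times> (real ^ 'n)) set"
    and U :: "(real ^ 'n) set" and f :: "real ^ 'n \<Rightarrow> real ^ 'n" and K :: real
  assumes W: "open W" and \<Phi>W: "open (\<Phi> ` W)" and \<Psi>: "\<And>z. z \<in> W \<Longrightarrow> \<Psi> (\<Phi> z) = z"
    and \<Phi>': "\<And>z. z \<in> W \<Longrightarrow> (\<Phi> has_derivative blinfun_apply (\<Phi>' z)) (at z)" "continuous_on W \<Phi>'"
    and \<Psi>': "\<And>z. z \<in> \<Phi> ` W \<Longrightarrow> (\<Psi> has_derivative blinfun_apply (\<Psi>' z)) (at z)" "continuous_on (\<Phi> ` W) \<Psi>'"
    and U: "open U" and lip: "K-lipschitz_on U f"
    and graph: "\<Phi> ` (gph F \<inter> W) = {(u, f u) | u. u \<in> U}"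
begin

definition param :: "real ^ 'n \<Rightarrow> (real ^ 'n) \<times> (real ^ 'n)" where "param u = \<Psi> (u, f u)"

text \<open>Bundled as a bounded linear map so that limits of Jacobians are taken in operator norm;
  meaningful only on \<open>diff_pts\<close>.\<close>

definition fD :: "real ^ 'n \<Rightarrow> (real ^ 'n) \<Rightarrow>\<^sub>L (real ^ 'n)" where
  "fD u = Blinfun (frechet_derivative f (at u))"

definition lift :: "((real ^ 'n) \<Rightarrow>\<^sub>L (real ^ 'n)) \<Rightarrow> (real ^ 'n) \<Rightarrow>\<^sub>L ((real ^ 'n) \<times> (real ^ 'n))" where
  "lift A = Blinfun (\<lambda>p. (p, blinfun_apply A p))"

definition Zmat :: "real ^ 'n \<Rightarrow> (real ^ 'n) \<Rightarrow>\<^sub>L ((real ^ 'n) \<times> (real ^ 'n))" where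
  "Zmat u = \<Psi>' (u, f u) o\<^sub>L lift (fD u)"

definition diff_pts :: "(real ^ 'n) set" where "diff_pts = {u \<in> U. f differentiable (at u)}"

lemma inj_\<Phi>: "inj_on \<Phi> W" using \<Psi> by (rule inj_on_inverseI)

lemma lift_apply [simp]: "blinfun_apply (lift A) p = (p, A p)"
  unfolding lift_def by (subst bounded_linear_Blinfun_apply) (auto intro!: bounded_linear_intros)

lemma graphically_Lipschitzian: "z \<in> W \<Longrightarrow> graphically_Lipschitzian F z \<Phi>"
  unfolding graphically_Lipschitzian_def
proof (intro exI[of _ W] conjI)
  have "C1_on \<Psi> (\<Phi> ` W)" using \<Psi>' unfolding C1_on_def by blast
  then show "C1_on (inv_into W \<Phi>) (\<Phi> ` W)"
    by (rule C1_on_cong_open[OF \<Phi>W, rotated]) (use inj_\<Phi> \<Psi> in \<open>auto simp: inv_into_f_f\<close>)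
  show "\<exists>U f K. open U \<and> K-lipschitz_on U f \<and> \<Phi> ` (gph F \<inter> W) = {(u, f u) |u. u \<in> U}"
    using U lip graph by blast
  show "C1_on \<Phi> W" using \<Phi>' unfolding C1_on_def by blast
qed (use W \<Phi>W inj_\<Phi> in auto)

lemma graph_mem:
  assumes "u \<in> U"
  shows "param u \<in> gph F" "param u \<in> W" "\<Phi> (param u) = (u, f u)"
proof -
  have "(u, f u) \<in> \<Phi> ` (gph F \<inter> W)" using graph assms by blast
  then obtain z where "z \<in> gph F \<inter> W" "\<Phi> z = (u, f u)" by auto
  then show "param u \<in> gph F" "param u \<in> W" "\<Phi> (param u) = (u, f u)" using \<Psi>[of z] by (auto simp: param_def)
qed

lemma image_param: "gph F \<inter> W = param ` U"
proof (intro equalityI subsetI)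
  fix z assume z: "z \<in> gph F \<inter> W"
  then obtain u where "u \<in> U" "\<Phi> z = (u, f u)" using graph by blast
  then show "z \<in> param ` U" using \<Psi>[of z] z by (auto simp: param_def image_iff)
qed (use graph_mem in auto)

lemma graph_mem_\<Phi>W: "u \<in> U \<Longrightarrow> (u, f u) \<in> \<Phi> ` W"
  using graph by blast

lemma fD:
  assumes "u \<in> diff_pts"
  shows "(f has_derivative blinfun_apply (fD u)) (at u)"
proof -
  have "(f has_derivative frechet_derivative f (at u)) (at u)"
    using assms by (simp add: diff_pts_def flip: frechet_derivative_works)
  then show ?thesis
    unfolding fD_def by (simp add: bounded_linear_Blinfun_apply has_derivative_bounded_linear)
qed

lemma norm_fD: 
  assumes u: "u \<in> diff_pts"
  shows "norm (fD u) \<le> K"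
proof (rule norm_blinfun_bound)
  show "0 \<le> K" using lip by (rule lipschitz_on_nonneg)
  fix p
  have "((\<lambda>s. u + s *\<^sub>R p) \<longlongrightarrow> u) (at_right 0)" by (auto intro!: tendsto_eq_intros)
  then have "\<forall>\<^sub>F s in at_right 0. u + s *\<^sub>R p \<in> U" using U u by (intro topological_tendstoD) (auto simp: diff_pts_def)
  then obtain b where b: "b > (0::real)" "\<And>s. \<lbrakk>0 < s; s < b\<rbrakk> \<Longrightarrow> u + s *\<^sub>R p \<in> U"
    by (auto simp: eventually_at_right_field)
  define t where "t k = b / (2 + real k)" for k
  have t: "0 < t k" "t k < b" for k using b(1) by (auto simp: t_def field_simps add_pos_nonneg)
  have t0: "t \<longlonglongrightarrow> 0" unfolding t_def by real_asymp
  have "(\<lambda>k. norm ((f (u + t k *\<^sub>R p) - f u) /\<^sub>R t k)) \<longlonglongrightarrow> norm (fD u p)"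
    by (intro tendsto_norm has_derivative_sequentially[OF fD[OF u] t(1) t0 tendsto_const])
  moreover have "norm ((f (u + t k *\<^sub>R p) - f u) /\<^sub>R t k) \<le> K * norm p" for k
  proof -
    have "norm (f (u + t k *\<^sub>R p) - f u) \<le> K * norm (t k *\<^sub>R p)"
      using lipschitz_onD[OF lip b(2)[OF t[of k]], of u] u by (simp add: diff_pts_def dist_norm)
    then show ?thesis unfolding norm_scaleR using t(1)[of k]
      by (simp add: abs_of_pos pos_divide_le_eq mult_ac flip: divide_inverse_commute)
  qed
  ultimately show "norm (fD u p) \<le> K * norm p" by (intro LIMSEQ_le_const2) auto
qed

lemma has_derivative_param:
  assumes u: "u \<in> diff_pts"
  shows "(param has_derivative blinfun_apply (Zmat u)) (at u)"
proof -
  have "((\<lambda>u. (u, f u)) has_derivative (\<lambda>p. (p, fD u p))) (at u)"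
    by (intro derivative_intros fD u)
  moreover have "(\<Psi> has_derivative blinfun_apply (\<Psi>' (u, f u))) (at (u, f u))"
    using u graph_mem_\<Phi>W by (intro \<Psi>') (auto simp: diff_pts_def)
  ultimately have "((\<lambda>u. \<Psi> (u, f u)) has_derivative (\<lambda>p. \<Psi>' (u, f u) (p, fD u p))) (at u)"
    by (rule has_derivative_compose)
  then show ?thesis unfolding param_def[abs_def] Zmat_def by (simp add: o_def blinfun_compose.rep_eq)
qed

text \<open>Chain rule for the composition of \<open>\<Phi>\<close> with \<open>\<Psi>\<close>, the
  identity on an open set. It gives the normalization required by \<open>nabla_bar\<close>, and with
  it injectivity of \<open>Zmat u\<close>.\<close>

lemma \<Phi>'_\<Psi>':
  assumes "u \<in> U"
  shows "\<Phi>' (param u) (\<Psi>' (u, f u) w) = w"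
proof -
  have \<Psi>1: "(\<Psi> has_derivative blinfun_apply (\<Psi>' (u, f u))) (at (u, f u))"
    using assms graph_mem_\<Phi>W by (intro \<Psi>') auto
  have "(\<Phi> has_derivative blinfun_apply (\<Phi>' (param u))) (at (\<Psi> (u, f u)))"
    using graph_mem[OF assms] \<Phi>' by (simp add: param_def)
  from has_derivative_compose[OF \<Psi>1 this]
  have "((\<lambda>w. \<Phi> (\<Psi> w)) has_derivative (\<lambda>w. \<Phi>' (param u) (\<Psi>' (u, f u) w))) (at (u, f u))" .
  moreover have "((\<lambda>w. \<Phi> (\<Psi> w)) has_derivative (\<lambda>w. w)) (at (u, f u))"
    by (rule has_derivative_transform_within_open[OF has_derivative_ident \<Phi>W graph_mem_\<Phi>W[OF assms]])
      (use \<Psi> in auto)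
  ultimately show ?thesis using has_derivative_unique by metis
qed

lemma fst_\<Phi>'_Zmat: "u \<in> U \<Longrightarrow> fst (\<Phi>' (param u) (Zmat u p)) = p"
  by (simp add: Zmat_def \<Phi>'_\<Psi>')

text \<open>The left inverse of \<open>param\<close> is the first block of \<open>\<Phi>\<close>,
  smooth on \<open>W\<close> although \<open>f\<close> is only Lipschitz.\<close>

lemma tangent_cone_param:
  assumes u: "u \<in> diff_pts"
  shows "tangent_cone (gph F) (param u) = range (blinfun_apply (Zmat u))"
proof (rule tangent_cone_parametrized[OF U _ W image_param])
  have uU: "u \<in> U" using u by (simp add: diff_pts_def)
  then show "u \<in> U" .
  show "fst (\<Phi> (param u')) = u'" if "u' \<in> U" for u' using graph_mem[OF that] by simp
  show "(param has_derivative blinfun_apply (Zmat u)) (at u)" by (rule has_derivative_param[OF u])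
  show "((\<lambda>z. fst (\<Phi> z)) has_derivative (\<lambda>w. fst (\<Phi>' (param u) w))) (at (param u))"
    using graph_mem[OF uU] by (intro has_derivative_fst \<Phi>') auto
qed

lemma inj_if_section:
  assumes "\<And>p. fst (blinfun_apply A (blinfun_apply Z p)) = p"
  shows "inj (blinfun_apply Z)"
  by (rule inj_on_inverseI[of _ "\<lambda>w. fst (A w)"]) (rule assms)

lemma param_in_O_set:
  assumes u: "u \<in> diff_pts"
  shows "param u \<in> O_set F"
proof -
  have uU: "u \<in> U" using u by (simp add: diff_pts_def)
  have "inj (blinfun_apply (Zmat u))" by (rule inj_if_section[OF fst_\<Phi>'_Zmat[OF uU]])
  then show ?thesis using graph_mem(1)[OF uU] by (simp add: O_set_def tangent_cone_param[OF u] range_Zn)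
qed

lemma continuous_on_param: "continuous_on U param"
proof -
  have "continuous_on (\<Phi> ` W) \<Psi>"
    using \<Psi>'(1) by (meson continuous_at_imp_continuous_on has_derivative_continuous)
  then show ?thesis unfolding param_def[abs_def]
    by (rule continuous_on_compose2[OF _ continuous_on_Pair[OF continuous_on_id lipschitz_on_continuous_on[OF lip]]])
      (use graph_mem_\<Phi>W in auto)
qed

text \<open>Jacobians of \<open>f\<close> are bounded by \<open>K\<close>, so a subsequence
  converges, and \<open>\<Psi>'\<close> is continuous. The normalization survives in the limit, so
  the limit matrix is injective and its range is again in \<open>Zn\<close>.\<close>

lemma limit_Zmat:
  assumes us: "\<And>k. us k \<in> diff_pts" "us \<longlonglongrightarrow> u" and u: "u \<in> U"
  obtains r A where "strict_mono (r :: nat \<Rightarrow> nat)" "(\<lambda>k. fD (us (r k))) \<longlonglongrightarrow> A"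
    "(\<lambda>k. Zmat (us (r k))) \<longlonglongrightarrow> (\<Psi>' (u, f u) o\<^sub>L lift A)"
    "range (blinfun_apply (\<Psi>' (u, f u) o\<^sub>L lift A)) \<in> SF F (param u)"
    "\<And>p. fst (\<Phi>' (param u) ((\<Psi>' (u, f u) o\<^sub>L lift A) p)) = p"
proof -
  have "bounded (range (\<lambda>k. fD (us k)))"
    using norm_fD[OF us(1)] unfolding bounded_iff by blast
  then obtain A r where r: "strict_mono (r :: nat \<Rightarrow> nat)" and A: "(\<lambda>k. fD (us (r k))) \<longlonglongrightarrow> A"
    using bounded_imp_convergent_subsequence unfolding o_def by blast
  have ur: "(\<lambda>k. us (r k)) \<longlonglongrightarrow> u" using LIMSEQ_subseq_LIMSEQ[OF us(2) r] by (simp add: o_def)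
  have usU: "us k \<in> U" for k using us(1)[of k] by (simp add: diff_pts_def)
  have "(\<lambda>k. f (us (r k))) \<longlonglongrightarrow> f u"
    by (rule continuous_on_tendsto_compose[OF lipschitz_on_continuous_on[OF lip] ur u]) (simp add: usU)
  then have "(\<lambda>k. (us (r k), f (us (r k)))) \<longlonglongrightarrow> (u, f u)" by (intro tendsto_Pair ur)
  then have "(\<lambda>k. \<Psi>' (us (r k), f (us (r k)))) \<longlonglongrightarrow> \<Psi>' (u, f u)"
    by (rule continuous_on_tendsto_compose[OF \<Psi>'(2)]) (auto intro!: always_eventually graph_mem_\<Phi>W u usU)
  moreover have "(\<lambda>k. lift (fD (us (r k)))) \<longlonglongrightarrow> lift A"
  proof -
    have "norm (lift (fD (us (r k))) - lift A) \<le> norm (fD (us (r k)) - A)" for k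
    proof (rule norm_blinfun_bound)
      fix p
      have "(lift (fD (us (r k))) - lift A) p = (0, (fD (us (r k)) - A) p)"
        by (simp add: blinfun.diff_left)
      then show "norm ((lift (fD (us (r k))) - lift A) p) \<le> norm (fD (us (r k)) - A) * norm p"
        using norm_blinfun[of "fD (us (r k)) - A" p] by (simp add: norm_Pair)
    qed simp
    moreover have "(\<lambda>k. norm (fD (us (r k)) - A)) \<longlonglongrightarrow> 0" using A by (simp add: LIM_zero tendsto_norm_zero)
    ultimately have "(\<lambda>k. lift (fD (us (r k))) - lift A) \<longlonglongrightarrow> 0"
      by (rule Lim_null_comparison[OF always_eventually, OF allI])
    then show ?thesis by (simp add: LIM_zero_iff)
  qed
  ultimately have Z: "(\<lambda>k. Zmat (us (r k))) \<longlonglongrightarrow> (\<Psi>' (u, f u) o\<^sub>L lift A)"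
    unfolding Zmat_def by (rule bounded_bilinear.tendsto[OF bounded_bilinear_blinfun_compose])
  have sec: "fst (\<Phi>' (param u) ((\<Psi>' (u, f u) o\<^sub>L lift A) p)) = p" for p
    using u by (simp add: \<Phi>'_\<Psi>')
  have Glim: "(\<lambda>k. param (us (r k))) \<longlonglongrightarrow> param u"
    by (rule continuous_on_tendsto_compose[OF continuous_on_param ur u]) (simp add: usU)
  have "range (blinfun_apply (\<Psi>' (u, f u) o\<^sub>L lift A)) \<in> SF F (param u)"
    by (rule range_in_SF[OF _ Glim Z inj_if_section[OF sec]]) (auto intro: param_in_O_set us(1) simp: tangent_cone_param us(1))
  then show ?thesis by (rule that[OF r A Z _ sec])
qed

lemma nondiff_negligible:
  assumes "cball u r \<subseteq> U"
  shows "negligible (ball u r - diff_pts)"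
proof -
  have "negligible {x \<in> ball u r. \<not> f differentiable (at x)}"
    by (rule rademacher[OF lipschitz_on_subset[OF lip assms]])
  moreover have "ball u r \<subseteq> U" using assms ball_subset_cball by blast
  then have "ball u r - diff_pts = {x \<in> ball u r. \<not> f differentiable (at x)}"
    by (auto simp: diff_pts_def simp del: mem_ball)
  ultimately show ?thesis by simp
qed

lemma diff_pt_near:
  assumes "u \<in> U" "e > 0"
  shows "\<exists>u'\<in>diff_pts. dist u' u < e"
proof -
  obtain r where r: "r > 0" "cball u r \<subseteq> U" using U assms(1) open_contains_cball by blast
  define s where "s = min r e"
  have s: "s > 0" "s \<le> r" "s \<le> e" using r assms by (auto simp: s_def)
  then have "cball u s \<subseteq> U" using r subset_cball by blast
  then have "negligible (ball u s - diff_pts)" by (rule nondiff_negligible)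
  moreover have "\<not> negligible (ball u s)" using s(1) open_not_negligible[of "ball u s"] by auto
  ultimately have "\<not> ball u s \<subseteq> ball u s - diff_pts" using negligible_subset by blast
  then obtain u' where "u' \<in> ball u s" "u' \<in> diff_pts" by blast
  then show ?thesis using s(3) by (intro bexI[of _ u']) (auto simp: dist_commute)
qed

text \<open>Differentiability points are dense by Rademacher's theorem, and compactness of the
  Jacobians supplies a limit. This is the source of the SCD property.\<close>

lemma SF_nonempty:
  assumes u: "u \<in> U"
  shows "SF F (param u) \<noteq> {}"
proof -
  have "\<exists>u'. u' \<in> diff_pts \<and> dist u' u < 1 / real (Suc k)" for k
    using diff_pt_near[OF u, of "1 / real (Suc k)"] by auto
  then have "\<exists>us. \<forall>k. us k \<in> diff_pts \<and> dist (us k) u < 1 / real (Suc k)"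
    by (intro choice) blast
  then obtain us where us: "\<And>k. us k \<in> diff_pts" "\<And>k. dist (us k) u < 1 / real (Suc k)" by blast
  have "us \<longlonglongrightarrow> u"
    by (rule metric_tendsto_imp_tendsto[OF LIMSEQ_inverse_real_of_nat])
       (use us(2) in \<open>auto intro!: always_eventually less_imp_le simp: inverse_eq_divide\<close>)
  then show ?thesis by (rule limit_Zmat[OF us(1) _ u]) auto
qed

end

subsection \<open>Metric regularity\<close>

text \<open>The localization says nothing about values \<open>y'\<close> of \<open>F x\<close> far
  from \<open>y0\<close>. For these \<open>dist y y'\<close> is bounded below, and the estimate
  follows from \<open>x\<close> and \<open>h y\<close> both being close to
  \<open>x0\<close>.\<close>

lemma metric_reg_constI:
  fixes F :: "'a::real_normed_vector \<Rightarrow> 'b::real_normed_vector set"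
  assumes X': "open X'" "x0 \<in> X'" and r: "r > 0" and sub: "ball y0 r \<subseteq> Y'"
    and gr: "gph F \<inter> (X' \<times> Y') = {(h y, y) | y. y \<in> Y'}" and h0: "h y0 = x0"
    and lip: "\<kappa>-lipschitz_on (ball y0 r) h" and \<kappa>: "\<kappa> > 0"
  shows "metric_reg_const F (x0, y0) \<kappa>"
  unfolding metric_reg_const_def
proof (intro conjI exI ballI)
  define \<delta> where "\<delta> = r / 2"
  \<comment> \<open>These radii give \<open>dist x (h y) \<le> \<kappa> * \<delta>\<close>, which
    settles \<open>dist y y' \<ge> \<delta>\<close>; otherwise \<open>y'\<close> is within
    \<open>\<delta> / 2 + \<delta> < r\<close> of \<open>y0\<close>.\<close>
  let ?X = "X' \<inter> ball x0 (\<kappa> * \<delta> / 2)" and ?Y = "ball y0 (\<delta> / 2)"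
  have \<delta>: "\<delta> > 0" "r = 2 * \<delta>" using r by (auto simp: \<delta>_def)
  show "open ?X" "fst (x0, y0) \<in> ?X" "open ?Y" "snd (x0, y0) \<in> ?Y" "\<kappa> \<ge> 0" using X' \<kappa> \<delta> by auto
  fix x y assume x: "x \<in> ?X" and y: "y \<in> ?Y"
  have yB: "y \<in> ball y0 r" using y \<delta> by auto
  have hy: "h y \<in> inv_map F y"
  proof -
    have "(h y, y) \<in> gph F" using gr yB sub by blast
    then show ?thesis by (simp add: gph_def inv_map_def)
  qed
  have main: "dist x (h y) \<le> \<kappa> * dist y y'" if y': "y' \<in> F x" for y'
  proof (cases "dist y y' < \<delta>")
    case True
    have "dist y0 y' \<le> dist y0 y + dist y y'" by (rule dist_triangle)
    then have y'B: "y' \<in> ball y0 r" using True y \<delta> by simp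
    then have "(x, y') \<in> gph F \<inter> (X' \<times> Y')" using y' x sub by (auto simp: gph_def)
    then have "x = h y'" using gr by auto
    then show ?thesis using lipschitz_onD[OF lip y'B yB] by (simp add: dist_commute)
  next
    case False
    have "dist x (h y) \<le> dist x0 x + dist (h y0) (h y)"
      using dist_triangle[of x "h y" x0] h0 by (simp add: dist_commute)
    also have "dist (h y0) (h y) \<le> \<kappa> * dist y0 y" by (rule lipschitz_onD[OF lip _ yB]) (use r in auto)
    also have "\<dots> \<le> \<kappa> * (\<delta> / 2)" using y \<kappa> by (intro mult_left_mono) auto
    also have "dist x0 x \<le> \<kappa> * \<delta> / 2" using x by simp
    finally have "dist x (h y) \<le> \<kappa> * \<delta>" by (simp add: mult.commute)
    also have "\<dots> \<le> \<kappa> * dist y y'" using False \<kappa> by (intro mult_left_mono) auto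
    finally show ?thesis by simp
  qed
  \<comment> \<open>Moving \<open>\<kappa>\<close> to the left exposes the infimum, which is
    infinite if \<open>F x\<close> is empty.\<close>
  have "ereal (dist x (h y)) / ereal \<kappa> \<le> set_dist y (F x)"
    unfolding set_dist_def
  proof (rule INF_greatest)
    fix y' assume "y' \<in> F x"
    then have "dist x (h y) / \<kappa> \<le> dist y y'" using main[of y'] \<kappa> by (simp add: divide_le_eq mult.commute)
    then show "ereal (dist x (h y)) / ereal \<kappa> \<le> ereal (dist y y')" using \<kappa> by simp
  qed
  then have "ereal (dist x (h y)) \<le> ereal \<kappa> * set_dist y (F x)"
    using \<kappa> by (subst (asm) ereal_divide_le_pos) auto
  moreover have "set_dist x (inv_map F y) \<le> ereal (dist x (h y))"
    unfolding set_dist_def using hy by (rule INF_lower)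
  ultimately show "set_dist x (inv_map F y) \<le> ereal \<kappa> * set_dist y (F x)" by (rule order_trans[rotated])
qed

text \<open>Regularity at the pair \<open>h y\<close>, \<open>y'\<close> yields a near-optimal
  preimage of \<open>y'\<close> within about \<open>\<kappa> * dist y' y\<close> of
  \<open>h y\<close>. On a small ball it stays in \<open>X'\<close>, where single-valuedness
  identifies it with \<open>h y'\<close>.\<close>

lemma metric_reg_const_imp_lipschitz:
  fixes F :: "'a::real_normed_vector \<Rightarrow> 'b::real_normed_vector set"
  assumes \<kappa>: "metric_reg_const F (x0, y0) \<kappa>"
    and X': "open X'" "x0 \<in> X'" and Y': "open Y'" "y0 \<in> Y'"
    and gr: "gph F \<inter> (X' \<times> Y') = {(h y, y) | y. y \<in> Y'}" and h0: "h y0 = x0"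
  obtains \<rho> where "\<rho> > 0" "ball y0 \<rho> \<subseteq> Y'" "\<kappa>-lipschitz_on (ball y0 \<rho>) h"
proof -
  obtain X Y where XY: "open X" "x0 \<in> X" "open Y" "y0 \<in> Y" "\<kappa> \<ge> 0"
    "\<And>x y. \<lbrakk>x \<in> X; y \<in> Y\<rbrakk> \<Longrightarrow> set_dist x (inv_map F y) \<le> ereal \<kappa> * set_dist y (F x)"
    using \<kappa> unfolding metric_reg_const_def by auto
  have near: "\<exists>x'. y \<in> F x' \<and> dist x x' < \<kappa> * dist y y' + e" if "x \<in> X" "y \<in> Y" "y' \<in> F x" "e > 0" for x y y' e
  proof -
    have "set_dist y (F x) \<le> ereal (dist y y')" unfolding set_dist_def using that(3) by (rule INF_lower)
    then have "ereal \<kappa> * set_dist y (F x) \<le> ereal \<kappa> * ereal (dist y y')" using XY(5) by (intro ereal_mult_left_mono) auto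
    then have "set_dist x (inv_map F y) \<le> ereal (\<kappa> * dist y y')"
      using XY(6)[OF that(1,2)] by (metis order_trans times_ereal.simps(1))
    also have "\<dots> < ereal (\<kappa> * dist y y' + e)" using that(4) by simp
    finally show ?thesis unfolding set_dist_def INF_less_iff by (auto simp: inv_map_def)
  qed
  have graph: "y \<in> F (h y)" if "y \<in> Y'" for y
    using gr that by (auto simp: gph_def set_eq_iff)
  have graph': "x = h y" if "y \<in> F x" "x \<in> X'" "y \<in> Y'" for x y
  proof -
    have "(x, y) \<in> gph F \<inter> (X' \<times> Y')" using that by (simp add: gph_def)
    then show ?thesis using gr by auto
  qed
  obtain r where r: "r > 0" "ball x0 r \<subseteq> X \<inter> X'"
    using open_Int[OF XY(1) X'(1)] XY(2) X'(2) open_contains_ball by (metis IntI)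
  obtain s where s: "s > 0" "ball y0 s \<subseteq> Y \<inter> Y'"
    using open_Int[OF XY(3) Y'(1)] XY(4) Y'(2) open_contains_ball by (metis IntI)
  \<comment> \<open>Gives \<open>\<kappa> * \<rho> \<le> r / 8\<close>, with
    \<open>\<kappa> + 1\<close> covering \<open>\<kappa> = 0\<close>. The distances below then add
    up to less than \<open>r / 2 + r / 4 + r / 8 < r\<close>.\<close>
  define \<rho> where "\<rho> = min s (r / (8 * (\<kappa> + 1)))"
  have \<rho>: "\<rho> > 0" "\<rho> \<le> s" using r(1) s(1) XY(5) by (auto simp: \<rho>_def)
  have \<kappa>\<rho>: "\<kappa> * \<rho> \<le> r / 8"
  proof -
    have "\<kappa> * \<rho> \<le> (\<kappa> + 1) * (r / (8 * (\<kappa> + 1)))"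
      using XY(5) \<rho>(1) by (intro mult_mono) (auto simp: \<rho>_def)
    also have "\<dots> = r / 8" using XY(5) by (simp add: divide_simps)
    finally show ?thesis .
  qed
  have in_s: "y \<in> Y" "y \<in> Y'" if "y \<in> ball y0 \<rho>" for y
    using that s(2) \<rho>(2) by auto
  have hball: "dist x0 (h y) < r / 2" if y: "y \<in> ball y0 \<rho>" for y
  proof -
    have "y0 \<in> F x0" using graph[OF Y'(2)] h0 by simp
    then obtain x' where x': "y \<in> F x'" "dist x0 x' < \<kappa> * dist y y0 + r / 4"
      using near[OF XY(2) in_s(1)[OF y]] r(1) by (metis zero_less_divide_iff zero_less_numeral)
    have "\<kappa> * dist y y0 \<le> \<kappa> * \<rho>" using y XY(5) by (intro mult_left_mono) (auto simp: dist_commute)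
    then have d: "dist x0 x' < r / 2" using x'(2) \<kappa>\<rho> r(1) by linarith
    then have "x' \<in> ball x0 r" using r(1) by simp
    then have "x' = h y" using x'(1) in_s[OF y] r(2) by (intro graph') auto
    then show ?thesis using d by simp
  qed
  have "\<kappa>-lipschitz_on (ball y0 \<rho>) h"
  proof (rule lipschitz_onI)
    fix y y' assume y: "y \<in> ball y0 \<rho>" and y': "y' \<in> ball y0 \<rho>"
    have hy: "h y \<in> X" using hball[OF y] r by auto
    have small: "\<kappa> * dist y' y \<le> r / 4"
    proof -
      have "dist y' y \<le> 2 * \<rho>" using y y' dist_triangle[of y' y y0] by (simp add: dist_commute)
      then have "\<kappa> * dist y' y \<le> \<kappa> * (2 * \<rho>)" using XY(5) by (intro mult_left_mono)
      then show ?thesis using \<kappa>\<rho> by simp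
    qed
    show "dist (h y) (h y') \<le> \<kappa> * dist y y'"
    proof (rule field_le_epsilon)
      fix e :: real assume "e > 0"
      then have "min e (r / 8) > 0" using r(1) by simp
      then obtain x' where x': "y' \<in> F x'" "dist (h y) x' < \<kappa> * dist y' y + min e (r / 8)"
        using near[OF hy in_s(1)[OF y'] graph[OF in_s(2)[OF y]]] by blast
      have "dist x0 x' \<le> dist x0 (h y) + dist (h y) x'" by (rule dist_triangle)
      then have "dist x0 x' < r" using x'(2) small hball[OF y] r(1) by linarith
      then have "x' = h y'" using x'(1) in_s[OF y'] r(2) by (intro graph') auto
      then show "dist (h y) (h y') \<le> \<kappa> * dist y y' + e" using x'(2) by (simp add: dist_commute)
    qed
  qed (rule XY(5))
  then show thesis using that \<rho>(1) in_s(2) by blast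
qed

text \<open>A tangent vector is a limit of scaled chords of the graph of \<open>h\<close>, and each
  chord obeys the Lipschitz inequality. This covers every graph point in the localization,
  differentiable or not.\<close>

lemma tangent_cone_norm_bound:
  assumes W: "open (X \<times> Y)" and gr: "gph F \<inter> (X \<times> Y) = {(h y, y) | y. y \<in> Y}"
    and lip: "\<kappa>-lipschitz_on Y h" and z: "z \<in> gph F \<inter> (X \<times> Y)" and w: "w \<in> tangent_cone (gph F) z"
  shows "norm (fst w) \<le> \<kappa> * norm (snd w)"
proof -
  obtain t ws where t: "\<And>k. t k > (0::real)" "t \<longlonglongrightarrow> 0" and ws: "ws \<longlonglongrightarrow> w" "\<And>k. z + t k *\<^sub>R ws k \<in> gph F"
    using w unfolding tangent_cone_def by blast
  have graph: "fst z' = h (snd z') \<and> snd z' \<in> Y" if "z' \<in> gph F \<inter> (X \<times> Y)" for z'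
    using that gr by auto
  have "(\<lambda>k. z + t k *\<^sub>R ws k) \<longlonglongrightarrow> z"
    using tendsto_add[OF tendsto_const tendsto_scaleR[OF t(2) ws(1)], of z] by simp
  moreover have "z \<in> X \<times> Y" using z by blast
  ultimately have "\<forall>\<^sub>F k in sequentially. z + t k *\<^sub>R ws k \<in> X \<times> Y" using W by (intro topological_tendstoD)
  then have "\<forall>\<^sub>F k in sequentially. norm (fst (ws k)) \<le> \<kappa> * norm (snd (ws k))"
  proof eventually_elim
    case (elim k)
    then have "z + t k *\<^sub>R ws k \<in> gph F \<inter> (X \<times> Y)" using ws(2) by blast
    from graph[OF this] graph[OF z]
    have "dist (fst z + t k *\<^sub>R fst (ws k)) (fst z) \<le> \<kappa> * dist (snd z + t k *\<^sub>R snd (ws k)) (snd z)"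
      using lipschitz_onD[OF lip] by auto
    then have "t k * norm (fst (ws k)) \<le> t k * (\<kappa> * norm (snd (ws k)))"
      using t(1)[of k] by (simp add: dist_norm mult_ac)
    then show ?case using t(1)[of k] by simp
  qed
  then show ?thesis
    by (rule tendsto_le[OF sequentially_bot tendsto_mult_left[OF tendsto_norm[OF tendsto_snd[OF ws(1)]]]
          tendsto_norm[OF tendsto_fst[OF ws(1)]]])
qed

subsection \<open>Clarke's inverse function theorem\<close>

context lip_chart
begin

text \<open>\<open>\<Psi>'\<close> is bounded by some \<open>M\<close> on a ball by continuity, and
  the pair \<open>(u, f u)\<close> varies with constant \<open>1 + K\<close>; both bounds are the
  product.\<close>

lemma locally_bounded:
  assumes u0: "u0 \<in> U"
  obtains r B where "r > 0" "cball u0 r \<subseteq> U" "B-lipschitz_on (ball u0 r) param"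
    "\<And>u. u \<in> diff_pts \<Longrightarrow> u \<in> ball u0 r \<Longrightarrow> norm (Zmat u) \<le> B"
proof -
  have K0: "K \<ge> 0" using lip by (rule lipschitz_on_nonneg)
  let ?w = "(u0, f u0)"
  have w: "?w \<in> \<Phi> ` W" using u0 by (rule graph_mem_\<Phi>W)
  define M where "M = norm (\<Psi>' ?w) + 1"
  have "((\<lambda>w. norm (\<Psi>' w)) \<longlongrightarrow> norm (\<Psi>' ?w)) (at ?w)"
    using \<Psi>'(2) w unfolding continuous_on_eq_continuous_at[OF \<Phi>W] isCont_def
    by (intro tendsto_norm) blast
  then have "\<forall>\<^sub>F w in at ?w. norm (\<Psi>' w) < M" by (rule order_tendstoD) (simp add: M_def)
  then obtain s1 where s1: "s1 > 0" "\<And>w. \<lbrakk>w \<noteq> ?w; dist w ?w < s1\<rbrakk> \<Longrightarrow> norm (\<Psi>' w) < M"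
    by (auto simp: eventually_at)
  obtain s2 where s2: "s2 > 0" "ball ?w s2 \<subseteq> \<Phi> ` W" using \<Phi>W w open_contains_ball by blast
  define s where "s = min s1 s2"
  have s: "s > 0" "ball ?w s \<subseteq> \<Phi> ` W" using s1 s2 by (auto simp: s_def)
  have M: "norm (\<Psi>' w) \<le> M" if "w \<in> ball ?w s" for w
  proof (cases "w = ?w")
    case False
    then show ?thesis using s1(2)[of w] that by (simp add: s_def dist_commute)
  qed (simp add: M_def)
  have M0: "M > 0" unfolding M_def by (intro add_nonneg_pos) auto
  have lip\<Psi>: "M-lipschitz_on (ball ?w s) \<Psi>"
  proof (rule bounded_derivative_imp_lipschitz)
    show "(\<Psi> has_derivative blinfun_apply (\<Psi>' w)) (at w within ball ?w s)" if "w \<in> ball ?w s" for w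
      by (rule has_derivative_at_withinI[OF \<Psi>'(1)[OF subsetD[OF s(2) that]]])
    show "onorm (blinfun_apply (\<Psi>' w)) \<le> M" if "w \<in> ball ?w s" for w
      using M[OF that] by (simp add: norm_blinfun.rep_eq)
  qed (use M0 in auto)
  obtain r0 where r0: "r0 > 0" "cball u0 r0 \<subseteq> U" using U u0 open_contains_cball by blast
  \<comment> \<open>Keeps the pairs \<open>(u, f u)\<close> in the ball of radius \<open>s\<close>,
    whose convexity made \<open>\<Psi>\<close> Lipschitz there.\<close>
  define r where "r = min r0 (s / (1 + K))"
  have r: "r > 0" "r \<le> r0" "(1 + K) * r \<le> s"
  proof -
    show "r > 0" "r \<le> r0" using r0 s K0 by (auto simp: r_def)
    have "(1 + K) * r \<le> (1 + K) * (s / (1 + K))" using K0 by (intro mult_left_mono) (auto simp: r_def)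
    then show "(1 + K) * r \<le> s" using K0 by simp
  qed
  have rU: "cball u0 r \<subseteq> U" using r0 r subset_cball by blast
  have pair: "dist (u, f u) (u', f u') \<le> (1 + K) * dist u u'" if "u \<in> U" "u' \<in> U" for u u'
  proof -
    have "dist (u, f u) (u', f u') \<le> dist u u' + dist (f u) (f u')"
      unfolding dist_Pair_Pair by (intro sqrt_sum_squares_le_sum) auto
    also have "\<dots> \<le> dist u u' + K * dist u u'" using lipschitz_onD[OF lip that] by simp
    finally show ?thesis by (simp add: algebra_simps)
  qed
  have inb: "(u, f u) \<in> ball ?w s" if u: "u \<in> ball u0 r" for u
  proof -
    have "u \<in> U" using u rU ball_subset_cball by blast
    then have "dist ?w (u, f u) \<le> (1 + K) * dist u0 u" by (intro pair u0)
    also have "\<dots> < (1 + K) * r" using u K0 by (intro mult_strict_left_mono) auto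
    finally show ?thesis using r(3) by simp
  qed
  have "(M * (1 + K))-lipschitz_on (ball u0 r) param"
  proof (rule lipschitz_onI)
    fix u u' assume u: "u \<in> ball u0 r" "u' \<in> ball u0 r"
    then have uU: "u \<in> U" "u' \<in> U" using rU ball_subset_cball by blast+
    have "dist (param u) (param u') \<le> M * dist (u, f u) (u', f u')"
      unfolding param_def by (rule lipschitz_onD[OF lip\<Psi> inb[OF u(1)] inb[OF u(2)]])
    also have "\<dots> \<le> M * ((1 + K) * dist u u')" using M0 by (intro mult_left_mono pair uU) auto
    finally show "dist (param u) (param u') \<le> M * (1 + K) * dist u u'" by (simp only: mult.assoc)
  qed (use M0 K0 in simp)
  moreover have "norm (Zmat u) \<le> M * (1 + K)" if "u \<in> diff_pts" "u \<in> ball u0 r" for u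
  proof -
    have "norm (lift (fD u)) \<le> 1 + K"
    proof (rule norm_blinfun_bound)
      fix p
      have "norm (fD u p) \<le> K * norm p"
        using norm_blinfun[of "fD u" p] norm_fD[OF that(1)] by (meson mult_right_mono norm_ge_zero order_trans)
      moreover have "norm (p, fD u p) \<le> norm p + norm (fD u p)" by (rule norm_Pair_le)
      ultimately show "norm (lift (fD u) p) \<le> (1 + K) * norm p" by (simp add: distrib_right)
    qed (use K0 in simp)
    then have "norm (\<Psi>' (u, f u)) * norm (lift (fD u)) \<le> M * (1 + K)"
      using M[OF inb[OF that(2)]] M0 by (intro mult_mono) auto
    then show ?thesis unfolding Zmat_def using norm_blinfun_compose order_trans by blast
  qed
  ultimately show thesis using that r(1) rU by blast
qed

section \<open>Limiting Jacobians and separation from zero\<close>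

lemma frechet_\<Phi>: "z \<in> W \<Longrightarrow> frechet_derivative \<Phi> (at z) = blinfun_apply (\<Phi>' z)"
  using frechet_derivative_at[OF \<Phi>'(1)] by simp

text \<open>The Bouligand limiting Jacobian of \<open>param\<close>, written as a nested
  intersection of closures so that closedness is immediate.\<close>

definition Zlim :: "real ^ 'n \<Rightarrow> ((real ^ 'n) \<Rightarrow>\<^sub>L ((real ^ 'n) \<times> (real ^ 'n))) set" where
  "Zlim u0 = (\<Inter>r\<in>{0<..}. closure (Zmat ` (diff_pts \<inter> ball u0 r)))"

lemma compact_Zlim:
  assumes "u0 \<in> U"
  shows "compact (Zlim u0)"
proof -
  obtain r B where "r > 0" "\<And>u. u \<in> diff_pts \<Longrightarrow> u \<in> ball u0 r \<Longrightarrow> norm (Zmat u) \<le> B"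
    using locally_bounded[OF assms] by metis
  then have "Zmat ` (diff_pts \<inter> ball u0 r) \<subseteq> cball 0 B" by auto
  then have "closure (Zmat ` (diff_pts \<inter> ball u0 r)) \<subseteq> cball 0 B" by (rule closure_minimal) simp
  then have "bounded (Zlim u0)"
    using \<open>r > 0\<close> unfolding Zlim_def by (intro bounded_subset[OF bounded_cball[of 0 B]]) auto
  moreover have "closed (Zlim u0)" unfolding Zlim_def by (intro closed_INT) auto
  ultimately show ?thesis by (simp add: compact_eq_bounded_closed)
qed

text \<open>Carries the regularity hypothesis over to a set known to be compact: diagonal choice
  gives differentiability points whose Jacobians converge to \<open>Z\<close>, and
  \<open>limit_Zmat\<close> identifies the limit.\<close>

lemma Zlim_subset_nabla_bar:
  assumes u0: "u0 \<in> U"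
  shows "Zlim u0 \<subseteq> nabla_bar \<Phi> F (param u0)"
proof
  fix Z assume Z: "Z \<in> Zlim u0"
  have "\<exists>u. u \<in> diff_pts \<and> dist u u0 < 1 / real (Suc k) \<and> dist (Zmat u) Z < 1 / real (Suc k)" for k
  proof -
    have "Z \<in> closure (Zmat ` (diff_pts \<inter> ball u0 (1 / real (Suc k))))" using Z by (auto simp: Zlim_def)
    then have "\<exists>y\<in>Zmat ` (diff_pts \<inter> ball u0 (1 / real (Suc k))). dist y Z < 1 / real (Suc k)"
      unfolding closure_approachable by simp
    then show ?thesis by (auto simp: dist_commute)
  qed
  then obtain us where us: "\<And>k. us k \<in> diff_pts" "\<And>k. dist (us k) u0 < 1 / real (Suc k)"
    "\<And>k. dist (Zmat (us k)) Z < 1 / real (Suc k)" by metis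
  have lim: "us \<longlonglongrightarrow> u0" "(\<lambda>k. Zmat (us k)) \<longlonglongrightarrow> Z"
    by (rule metric_tendsto_imp_tendsto[OF LIMSEQ_inverse_real_of_nat];
        use us(2,3) in \<open>auto intro!: always_eventually less_imp_le simp: inverse_eq_divide\<close>)+
  obtain r A where r: "strict_mono (r :: nat \<Rightarrow> nat)"
    "(\<lambda>k. Zmat (us (r k))) \<longlonglongrightarrow> (\<Psi>' (u0, f u0) o\<^sub>L lift A)"
    "range (blinfun_apply (\<Psi>' (u0, f u0) o\<^sub>L lift A)) \<in> SF F (param u0)"
    "\<And>p. fst (\<Phi>' (param u0) ((\<Psi>' (u0, f u0) o\<^sub>L lift A) p)) = p"
    by (rule limit_Zmat[OF us(1) lim(1) u0]) blast
  have "(\<lambda>k. Zmat (us (r k))) \<longlonglongrightarrow> Z" using LIMSEQ_subseq_LIMSEQ[OF lim(2) r(1)] by (simp add: o_def)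
  then have "Z = (\<Psi>' (u0, f u0) o\<^sub>L lift A)" using r(2) LIMSEQ_unique by blast
  then show "Z \<in> nabla_bar \<Phi> F (param u0)"
    using r(3,4) frechet_\<Phi>[OF graph_mem(2)[OF u0]] unfolding nabla_bar_def by simp
qed

lemma limit_in_Zlim:
  assumes us: "\<And>k. us k \<in> diff_pts" "us \<longlonglongrightarrow> u0" "(\<lambda>k. Zmat (us k)) \<longlonglongrightarrow> Z"
  shows "Z \<in> Zlim u0"
  unfolding Zlim_def
proof (intro INT_I)
  fix r :: real assume "r \<in> {0<..}"
  then have "\<forall>\<^sub>F k in sequentially. us k \<in> ball u0 r"
    using us(2) by (intro topological_tendstoD) auto
  then have "\<forall>\<^sub>F k in sequentially. Zmat (us k) \<in> closure (Zmat ` (diff_pts \<inter> ball u0 r))"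
  proof eventually_elim
    case (elim k)
    then have "Zmat (us k) \<in> Zmat ` (diff_pts \<inter> ball u0 r)" by (intro imageI IntI us(1))
    then show ?case by (rule subsetD[OF closure_subset])
  qed
  then show "Z \<in> closure (Zmat ` (diff_pts \<inter> ball u0 r))"
    by (rule Lim_in_closed_set[OF closed_closure _ sequentially_bot us(3)])
qed

text \<open>The values \<open>snd (Z v)\<close> over the convex hull of \<open>Zlim u0\<close> form
  a compact convex set. If it contained 0, regularity of the range of \<open>Z\<close> would give
  \<open>Z v = 0\<close>, against the normalization, which recovers \<open>v\<close> from
  \<open>Z v\<close>.\<close>

lemma separating_direction:
  assumes u0: "u0 \<in> U"
    and reg: "{range (blinfun_apply Z) | Z. Z \<in> convex hull nabla_bar \<Phi> F (param u0)} \<subseteq> Zn_reg"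
    and v: "v \<noteq> 0"
  shows "\<exists>\<eta> b. norm \<eta> = 1 \<and> b > 0 \<and> (\<forall>Z\<in>Zlim u0. b < \<eta> \<bullet> snd (blinfun_apply Z v))"
proof -
  let ?ev = "\<lambda>Z. snd (blinfun_apply Z v)"
  let ?C = "convex hull (?ev ` Zlim u0)"
  have bl: "bounded_linear ?ev" by (rule bounded_linear_snd_comp[OF blinfun.bounded_linear_left])
  have "compact (?ev ` Zlim u0)"
    by (rule compact_continuous_image[OF linear_continuous_on[OF bl] compact_Zlim[OF u0]])
  then have cl: "closed ?C" by (rule compact_imp_closed[OF compact_convex_hull])
  have "0 \<notin> ?C"
  proof
    assume "0 \<in> ?C"
    also have "?C = ?ev ` (convex hull Zlim u0)"
      by (rule convex_hull_linear_image[OF bounded_linear.linear[OF bl], symmetric])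
    finally obtain Z where Z: "Z \<in> convex hull Zlim u0" "snd (Z v) = 0" by auto
    have Z': "Z \<in> convex hull nabla_bar \<Phi> F (param u0)"
      using Z(1) hull_mono[OF Zlim_subset_nabla_bar[OF u0]] by blast
    then have "range (blinfun_apply Z) \<in> Zn_reg" using reg by blast
    moreover have "(fst (Z v), 0) \<in> range (blinfun_apply Z)" using Z(2) by (metis prod.collapse rangeI)
    ultimately have "fst (Z v) = 0" by (simp add: Zn_reg_def)
    then have Zv: "Z v = 0" using Z(2) by (simp add: prod_eq_iff)
    \<comment> \<open>For fixed \<open>v\<close> the normalization is an affine condition on
      \<open>Z\<close>, hence passes from \<open>nabla_bar\<close> to its convex hull.\<close>
    let ?S = "(\<lambda>Z. fst (\<Phi>' (param u0) (blinfun_apply Z v))) -` {v}"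
    have "nabla_bar \<Phi> F (param u0) \<subseteq> ?S"
    proof
      fix Y assume "Y \<in> nabla_bar \<Phi> F (param u0)"
      then show "Y \<in> ?S"
        using frechet_\<Phi>[OF graph_mem(2)[OF u0]] unfolding nabla_bar_def by simp
    qed
    moreover have "convex ?S"
      by (rule convex_linear_vimage[OF bounded_linear.linear[OF bounded_linear_fst_comp[OF
            bounded_linear_compose[OF blinfun.bounded_linear_right blinfun.bounded_linear_left]]] convex_singleton])
    ultimately have "convex hull nabla_bar \<Phi> F (param u0) \<subseteq> ?S" by (rule hull_minimal[where S = convex])
    then have "fst (\<Phi>' (param u0) (Z v)) = v" using Z' by auto
    then show False using v Zv by simp
  qed
  obtain a b where ab: "a \<noteq> 0" "0 < b" "\<And>x. x \<in> ?C \<Longrightarrow> b < a \<bullet> x"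
    using separating_hyperplane_closed_0[OF convex_convex_hull cl \<open>0 \<notin> ?C\<close>] by auto
  have "b / norm a < (a /\<^sub>R norm a) \<bullet> ?ev Z" if "Z \<in> Zlim u0" for Z
  proof -
    have "b < a \<bullet> ?ev Z" by (rule ab(3)[OF hull_inc[OF imageI[OF that]]])
    then have "b / norm a < (a \<bullet> ?ev Z) / norm a" using ab(1) by (intro divide_strict_right_mono) auto
    then show ?thesis by (simp add: divide_inverse_commute)
  qed
  moreover have "norm (a /\<^sub>R norm a) = 1" "b / norm a > 0" using ab(1,2) by simp_all
  ultimately show ?thesis by blast
qed

text \<open>Compactness of the unit sphere: bad directions would accumulate at some
  \<open>v\<close>, and the functional separating for \<open>v\<close> would fail on a limiting
  Jacobian. One \<open>\<delta>\<close> serves as radius and as lower bound.\<close>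

lemma uniform_separation:
  assumes u0: "u0 \<in> U"
    and reg: "{range (blinfun_apply Z) | Z. Z \<in> convex hull nabla_bar \<Phi> F (param u0)} \<subseteq> Zn_reg"
  shows "\<exists>\<delta>>0. \<forall>v. norm v = 1 \<longrightarrow>
      (\<exists>\<eta>. norm \<eta> = 1 \<and> (\<forall>u\<in>diff_pts \<inter> ball u0 \<delta>. \<delta> \<le> \<eta> \<bullet> snd (Zmat u v)))"
proof (rule ccontr)
  assume neg: "\<not> ?thesis"
  define \<epsilon> where "\<epsilon> k = 1 / real (Suc k)" for k
  have \<epsilon>: "\<epsilon> k > 0" for k by (simp add: \<epsilon>_def)
  have \<epsilon>0: "\<epsilon> \<longlonglongrightarrow> 0" unfolding \<epsilon>_def by (rule LIMSEQ_inverse_real_of_nat[unfolded inverse_eq_divide])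
  \<comment> \<open>Each \<open>vs k\<close> is bad for every unit \<open>\<eta>\<close>, so
    \<open>\<eta>\<close> may be chosen after the limit direction is known.\<close>
  have "\<exists>v. norm v = 1 \<and> (\<forall>\<eta>. norm \<eta> = 1 \<longrightarrow> (\<exists>u\<in>diff_pts \<inter> ball u0 (\<epsilon> k). \<eta> \<bullet> snd (Zmat u v) < \<epsilon> k))" for k
    using neg \<epsilon>[of k] by (meson not_le)
  then obtain vs where vs: "\<And>k. norm (vs k) = 1"
    "\<And>k \<eta>. norm \<eta> = 1 \<Longrightarrow> \<exists>u\<in>diff_pts \<inter> ball u0 (\<epsilon> k). \<eta> \<bullet> snd (Zmat u (vs k)) < \<epsilon> k" by metis
  have "bounded (range vs)" using vs(1) unfolding bounded_iff by auto
  then obtain v q where q: "strict_mono (q :: nat \<Rightarrow> nat)" and v: "(\<lambda>k. vs (q k)) \<longlonglongrightarrow> v"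
    using bounded_imp_convergent_subsequence unfolding o_def by blast
  have "(\<lambda>k. norm (vs (q k))) \<longlonglongrightarrow> norm v" by (intro tendsto_norm v)
  then have "norm v = 1" using vs(1) by (simp add: LIMSEQ_const_iff)
  then obtain \<eta> b where \<eta>: "norm \<eta> = 1" "b > 0" "\<And>Z. Z \<in> Zlim u0 \<Longrightarrow> b < \<eta> \<bullet> snd (blinfun_apply Z v)"
    using separating_direction[OF u0 reg, of v] by force
  have "\<exists>u. u \<in> diff_pts \<and> u \<in> ball u0 (\<epsilon> (q k)) \<and> \<eta> \<bullet> snd (Zmat u (vs (q k))) < \<epsilon> (q k)" for k
    using vs(2)[OF \<eta>(1), of "q k"] by blast
  then obtain us where us: "\<And>k. us k \<in> diff_pts" "\<And>k. us k \<in> ball u0 (\<epsilon> (q k))"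
    "\<And>k. \<eta> \<bullet> snd (Zmat (us k) (vs (q k))) < \<epsilon> (q k)"
    by metis
  have \<epsilon>q: "(\<lambda>k. \<epsilon> (q k)) \<longlonglongrightarrow> 0" using LIMSEQ_subseq_LIMSEQ[OF \<epsilon>0 q] by (simp add: o_def)
  have lim: "us \<longlonglongrightarrow> u0"
    by (rule metric_tendsto_imp_tendsto[OF \<epsilon>q])
      (use us(2) \<epsilon> in \<open>auto intro!: always_eventually less_imp_le simp: dist_commute less_trans abs_of_pos\<close>)
  obtain r A where r: "strict_mono (r :: nat \<Rightarrow> nat)"
    "(\<lambda>k. Zmat (us (r k))) \<longlonglongrightarrow> (\<Psi>' (u0, f u0) o\<^sub>L lift A)"
    by (rule limit_Zmat[OF us(1) lim u0]) blast
  let ?Z = "\<Psi>' (u0, f u0) o\<^sub>L lift A"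
  have "(\<lambda>k. us (r k)) \<longlonglongrightarrow> u0" using LIMSEQ_subseq_LIMSEQ[OF lim r(1)] by (simp add: o_def)
  then have "?Z \<in> Zlim u0" by (intro limit_in_Zlim[OF _ _ r(2)] us(1))
  then have "b < \<eta> \<bullet> snd (?Z v)" by (rule \<eta>(3))
  moreover have "(\<lambda>k. \<eta> \<bullet> snd (Zmat (us (r k)) (vs (q (r k))))) \<longlonglongrightarrow> \<eta> \<bullet> snd (?Z v)"
  proof -
    have "(\<lambda>k. vs (q (r k))) \<longlonglongrightarrow> v" using LIMSEQ_subseq_LIMSEQ[OF v r(1)] by (simp add: o_def)
    then have "(\<lambda>k. Zmat (us (r k)) (vs (q (r k)))) \<longlonglongrightarrow> ?Z v"
      using r(2) by (rule bounded_bilinear.tendsto[OF bounded_bilinear_blinfun_apply, rotated])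
    then show ?thesis by (rule tendsto_inner[OF tendsto_const tendsto_snd])
  qed
  moreover have "(\<lambda>k. \<epsilon> (q (r k))) \<longlonglongrightarrow> 0" using LIMSEQ_subseq_LIMSEQ[OF \<epsilon>q r(1)] by (simp add: o_def)
  ultimately have "\<eta> \<bullet> snd (?Z v) \<le> 0"
    using us(3) by (intro LIMSEQ_le) (auto intro: less_imp_le)
  then show False using \<open>b < \<eta> \<bullet> snd (?Z v)\<close> \<eta>(2) by linarith
qed

text \<open>The functional \<open>\<eta>\<close> for the direction of \<open>y - x\<close> works at
  all differentiability points of the ball; the mean value inequality for
  \<open>\<eta> \<bullet> snd (param u)\<close> and Cauchy-Schwarz give the expansion.\<close>

lemma snd_param_expanding:
  assumes u0: "u0 \<in> U"
    and reg: "{range (blinfun_apply Z) | Z. Z \<in> convex hull nabla_bar \<Phi> F (param u0)} \<subseteq> Zn_reg"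
  obtains \<rho> \<delta> B where "\<rho> > 0" "\<delta> > 0" "ball u0 \<rho> \<subseteq> U" "B-lipschitz_on (ball u0 \<rho>) param"
    "\<And>x y. \<lbrakk>x \<in> ball u0 \<rho>; y \<in> ball u0 \<rho>\<rbrakk> \<Longrightarrow> \<delta> * dist x y \<le> dist (snd (param x)) (snd (param y))"
proof -
  obtain r B where r: "r > 0" "cball u0 r \<subseteq> U" "B-lipschitz_on (ball u0 r) param"
    using locally_bounded[OF u0] by metis
  obtain \<delta> where \<delta>: "\<delta> > 0" "\<And>v. norm v = 1 \<Longrightarrow>
      \<exists>\<eta>. norm \<eta> = 1 \<and> (\<forall>u\<in>diff_pts \<inter> ball u0 \<delta>. \<delta> \<le> \<eta> \<bullet> snd (Zmat u v))"
    using uniform_separation[OF u0 reg] by blast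
  define \<rho> where "\<rho> = min r \<delta>"
  have \<rho>: "\<rho> > 0" "ball u0 \<rho> \<subseteq> ball u0 r" "ball u0 \<rho> \<subseteq> ball u0 \<delta>" "cball u0 \<rho> \<subseteq> U"
    using r(1,2) \<delta>(1) by (auto simp: \<rho>_def)
  have lipG: "B-lipschitz_on (ball u0 \<rho>) param" using r(3) \<rho>(2) by (rule lipschitz_on_subset)
  have "\<delta> * dist x y \<le> dist (snd (param x)) (snd (param y))" if xy: "x \<in> ball u0 \<rho>" "y \<in> ball u0 \<rho>" for x y
  proof (cases "x = y")
    case False
    define l where "l = norm (y - x)"
    have l: "l > 0" using False by (simp add: l_def)
    define v where "v = (y - x) /\<^sub>R l"
    have "norm v = 1" using l by (simp add: v_def l_def)
    then obtain \<eta> where \<eta>: "norm \<eta> = 1" "\<And>u. \<lbrakk>u \<in> diff_pts; u \<in> ball u0 \<delta>\<rbrakk> \<Longrightarrow> \<delta> \<le> \<eta> \<bullet> snd (Zmat u v)"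
      using \<delta>(2) by (metis IntI)
    have vl: "y - x = l *\<^sub>R v" using l by (simp add: v_def)
    have "\<delta> * l \<le> \<eta> \<bullet> snd (param y) - \<eta> \<bullet> snd (param x)"
    proof (rule lipschitz_mean_value_ge[OF _ nondiff_negligible[OF \<rho>(4)] xy])
      show "B-lipschitz_on (ball u0 \<rho>) (\<lambda>u. \<eta> \<bullet> snd (param u))"
      proof (rule lipschitz_onI)
        fix p q assume pq: "p \<in> ball u0 \<rho>" "q \<in> ball u0 \<rho>"
        have "dist (\<eta> \<bullet> snd (param p)) (\<eta> \<bullet> snd (param q)) = \<bar>\<eta> \<bullet> (snd (param p) - snd (param q))\<bar>"
          by (simp add: dist_real_def inner_diff_right)
        also have "\<dots> \<le> dist (snd (param p)) (snd (param q))"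
          using Cauchy_Schwarz_ineq2[of \<eta> "snd (param p) - snd (param q)"] \<eta>(1) by (simp add: dist_norm)
        also have "\<dots> \<le> dist (param p) (param q)" by (rule dist_snd_le)
        also have "\<dots> \<le> B * dist p q" by (rule lipschitz_onD[OF lipG pq])
        finally show "dist (\<eta> \<bullet> snd (param p)) (\<eta> \<bullet> snd (param q)) \<le> B * dist p q" .
      qed (rule lipschitz_on_nonneg[OF lipG])
      fix u assume "u \<in> ball u0 \<rho>" "u \<notin> ball u0 \<rho> - diff_pts"
      then have u: "u \<in> diff_pts" "u \<in> ball u0 \<delta>" using \<rho>(3) by auto
      have "((\<lambda>u. \<eta> \<bullet> snd (param u)) has_derivative (\<lambda>p. \<eta> \<bullet> snd (Zmat u p))) (at u)"
        by (intro has_derivative_inner_right has_derivative_snd has_derivative_param u)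
      moreover have "\<delta> * l \<le> \<eta> \<bullet> snd (Zmat u (y - x))"
        using \<eta>(2)[OF u] l unfolding vl by (simp add: blinfun.scaleR_right mult.commute)
      ultimately show "\<exists>f'. ((\<lambda>u. \<eta> \<bullet> snd (param u)) has_derivative f') (at u) \<and> \<delta> * l \<le> f' (y - x)" by blast
    qed
    also have "\<dots> = \<eta> \<bullet> (snd (param y) - snd (param x))" by (simp add: inner_diff_right)
    also have "\<dots> \<le> norm (snd (param y) - snd (param x))"
      using norm_cauchy_schwarz[of \<eta> "snd (param y) - snd (param x)"] \<eta>(1) by simp
    finally show ?thesis by (simp add: l_def dist_norm norm_minus_commute)
  qed simp
  moreover have "ball u0 \<rho> \<subseteq> U" using \<rho>(4) ball_subset_cball by blast
  ultimately show thesis using that \<rho>(1) \<delta>(1) lipG by blast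
qed

text \<open>Expansion makes \<open>g\<close> injective with a Lipschitz inverse, and invariance of
  domain makes its image open. The localization of the inverse of \<open>F\<close> is the first
  block of \<open>param\<close> composed with that inverse.\<close>

theorem strongly_metrically_regular_if_conv_regular:
  assumes z: "z \<in> gph F" "z \<in> W"
    and reg: "{range (blinfun_apply Z) | Z. Z \<in> convex hull nabla_bar \<Phi> F z} \<subseteq> Zn_reg"
  shows "strongly_metrically_regular F z"
proof -
  obtain u0 where u0: "u0 \<in> U" "z = param u0" using image_param z by blast
  obtain \<rho> \<delta> B where \<rho>: "\<rho> > 0" "\<delta> > 0" "ball u0 \<rho> \<subseteq> U" "B-lipschitz_on (ball u0 \<rho>) param"
    "\<And>x y. \<lbrakk>x \<in> ball u0 \<rho>; y \<in> ball u0 \<rho>\<rbrakk> \<Longrightarrow> \<delta> * dist x y \<le> dist (snd (param x)) (snd (param y))"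
    using snd_param_expanding[OF u0(1)] reg unfolding u0(2) by blast
  let ?B = "ball u0 \<rho>"
  define g where "g u = snd (param u)" for u
  have B0: "B \<ge> 0" using \<rho>(4) by (rule lipschitz_on_nonneg)
  have inj: "inj_on g ?B"
  proof (rule inj_onI)
    fix x y assume "x \<in> ?B" "y \<in> ?B" "g x = g y"
    then have "\<delta> * dist x y \<le> 0" using \<rho>(5)[of x y] by (simp add: g_def)
    then show "x = y" using \<rho>(2) by (simp add: mult_le_0_iff)
  qed
  have "continuous_on ?B g" unfolding g_def
    by (intro continuous_on_snd lipschitz_on_continuous_on[OF \<rho>(4)])
  then have opV: "open (g ` ?B)" using inj by (intro invariance_of_domain) auto
  define k where "k = inv_into ?B g"
  have k: "k y \<in> ?B" "g (k y) = y" if "y \<in> g ` ?B" for y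
    using inv_into_into[OF that] f_inv_into_f[OF that] by (simp_all only: k_def)
  have kg: "k (g u) = u" if "u \<in> ?B" for u unfolding k_def by (rule inv_into_f_f[OF inj that])
  define h where "h y = fst (param (k y))" for y
  \<comment> \<open>\<open>B / \<delta>\<close> is already a Lipschitz constant of \<open>h\<close>;
    adding 1 secures the positivity that \<open>metric_reg_constI\<close> asks for.\<close>
  define \<kappa> where "\<kappa> = B / \<delta> + 1"
  have \<kappa>: "\<kappa> > 0" using B0 \<rho>(2) by (auto simp: \<kappa>_def intro!: add_nonneg_pos)
  have liph: "\<kappa>-lipschitz_on (g ` ?B) h"
  proof (rule lipschitz_onI)
    fix y y' assume y: "y \<in> g ` ?B" "y' \<in> g ` ?B"
    have "dist (h y) (h y') \<le> dist (param (k y)) (param (k y'))" unfolding h_def by (rule dist_fst_le)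
    also have "\<dots> \<le> B * dist (k y) (k y')" by (rule lipschitz_onD[OF \<rho>(4) k(1)[OF y(1)] k(1)[OF y(2)]])
    also have "dist (k y) (k y') \<le> dist y y' / \<delta>"
      using \<rho>(5)[OF k(1)[OF y(1)] k(1)[OF y(2)]] k(2)[OF y(1)] k(2)[OF y(2)] \<rho>(2)
      by (simp add: g_def pos_le_divide_eq mult.commute)
    finally have "dist (h y) (h y') \<le> B * (dist y y' / \<delta>)" using B0 by (simp add: mult_left_mono)
    also have "\<dots> \<le> \<kappa> * dist y y'" by (simp add: \<kappa>_def distrib_right)
    finally show "dist (h y) (h y') \<le> \<kappa> * dist y y'" .
  qed (use \<kappa> in simp)
  have z': "z = (fst z, snd z)" by simp
  have y0: "snd z \<in> g ` ?B" "h (snd z) = fst z"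
    using \<rho>(1) kg[of u0] by (auto simp: u0(2) g_def h_def intro!: image_eqI[of _ _ u0])
  \<comment> \<open>A graph point of \<open>W\<close> might have its parameter outside
    \<open>?B\<close>. Since \<open>fst (\<Phi> w)\<close> recovers the parameter, an open condition
    on \<open>w\<close> excludes this.\<close>
  have "continuous_on W (\<lambda>z. fst (\<Phi> z))"
    using \<Phi>'(1) by (intro continuous_on_fst continuous_at_imp_continuous_on) (auto dest: has_derivative_continuous)
  then have "open (W \<inter> (\<lambda>z. fst (\<Phi> z)) -` ?B)" using W by (intro continuous_open_preimage) auto
  moreover have "z \<in> W \<inter> (\<lambda>z. fst (\<Phi> z)) -` ?B" using z \<rho>(1) graph_mem(3)[OF u0(1)] by (simp add: u0(2))
  ultimately obtain X' Y1 where XY: "open X'" "open Y1" "z \<in> X' \<times> Y1" "X' \<times> Y1 \<subseteq> W \<inter> (\<lambda>z. fst (\<Phi> z)) -` ?B"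
    by (rule open_prod_elim)
  \<comment> \<open>Intersecting with the preimage of \<open>X'\<close> keeps all values of
    \<open>h\<close> over \<open>Y'\<close> inside \<open>X'\<close>.\<close>
  define Y' where "Y' = (g ` ?B \<inter> Y1) \<inter> h -` X'"
  have "open Y'" unfolding Y'_def
    using opV XY(1,2)
    by (intro continuous_open_preimage lipschitz_on_continuous_on[OF lipschitz_on_subset[OF liph]]) auto
  have sub: "Y' \<subseteq> g ` ?B" by (auto simp: Y'_def)
  have y0': "snd z \<in> Y'" "fst z \<in> X'" using XY(3) y0 by (auto simp: Y'_def mem_Times_iff)
  have Gk: "param (k y) = (h y, y)" if "y \<in> g ` ?B" for y
    using k(2)[OF that] by (simp add: h_def g_def prod_eq_iff)
  have gr: "gph F \<inter> (X' \<times> Y') = {(h y, y) | y. y \<in> Y'}"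
  proof (intro equalityI subsetI)
    fix w assume w: "w \<in> gph F \<inter> (X' \<times> Y')"
    then have w1: "w \<in> X' \<times> Y1" by (auto simp: Y'_def)
    then have "w \<in> W" "fst (\<Phi> w) \<in> ?B" using XY(4) by auto
    then obtain u where u: "u \<in> U" "w = param u" using image_param w by blast
    then have "u \<in> ?B" using \<open>fst (\<Phi> w) \<in> ?B\<close> graph_mem(3)[OF u(1)] by simp
    then have "h (snd w) = fst w" using kg[of u] by (simp add: h_def g_def u(2))
    then show "w \<in> {(h y, y) | y. y \<in> Y'}" using w by (intro CollectI exI[of _ "snd w"]) auto
  next
    fix w assume "w \<in> {(h y, y) | y. y \<in> Y'}"
    then obtain y where y: "y \<in> Y'" "w = (h y, y)" by blast
    then have "y \<in> g ` ?B" using sub by blast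
    then have "w = param (k y)" "k y \<in> U" using Gk k(1) \<rho>(3) y(2) by (simp, blast)
    then have "w \<in> gph F" using graph_mem(1) by simp
    then show "w \<in> gph F \<inter> (X' \<times> Y')" using y by (auto simp: Y'_def)
  qed
  obtain r where r: "r > 0" "ball (snd z) r \<subseteq> Y'" using \<open>open Y'\<close> y0'(1) open_contains_ball by blast
  have "metric_reg_const F (fst z, snd z) \<kappa>"
    by (rule metric_reg_constI[OF XY(1) y0'(2) r gr y0(2) _ \<kappa>])
      (use r(2) sub in \<open>auto intro: lipschitz_on_subset[OF liph]\<close>)
  then have "metrically_regular F z" unfolding metrically_regular_def by auto
  then show ?thesis
    unfolding strongly_metrically_regular_def using \<open>open Y'\<close> y0' XY(1) y0(2) gr by blast
qed

end

subsection \<open>Lipschitz localizations of the inverse mapping\<close>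

lemma lip_chart_if_graphically_Lipschitzian:
  assumes "graphically_Lipschitzian F z \<Phi>"
  obtains \<Psi> \<Phi>' \<Psi>' W U f K where "lip_chart F \<Phi> \<Psi> \<Phi>' \<Psi>' W U f K" "z \<in> W"
proof -
  obtain W U f K where W: "open W" "z \<in> W" "inj_on \<Phi> W" "open (\<Phi> ` W)"
    and C: "C1_on \<Phi> W" "C1_on (inv_into W \<Phi>) (\<Phi> ` W)"
    and f: "open U" "K-lipschitz_on U f" "\<Phi> ` (gph F \<inter> W) = {(u, f u) | u. u \<in> U}"
    using assms unfolding graphically_Lipschitzian_def by blast
  obtain \<Phi>' where \<Phi>': "\<forall>z\<in>W. (\<Phi> has_derivative blinfun_apply (\<Phi>' z)) (at z)" "continuous_on W \<Phi>'"
    using C(1) unfolding C1_on_def by blast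
  obtain \<Psi>' where \<Psi>': "\<forall>z\<in>\<Phi> ` W. (inv_into W \<Phi> has_derivative blinfun_apply (\<Psi>' z)) (at z)"
      "continuous_on (\<Phi> ` W) \<Psi>'"
    using C(2) unfolding C1_on_def by blast
  have "lip_chart F \<Phi> (inv_into W \<Phi>) \<Phi>' \<Psi>' W U f K"
    by (rule lip_chart.intro) (use W(1,4) inv_into_f_f[OF W(3)] \<Phi>' \<Psi>' f in \<open>auto simp only:\<close>)
  then show thesis using W(2) by (rule that)
qed

definition swap_blinfun :: "('a::real_normed_vector \<times> 'a) \<Rightarrow>\<^sub>L ('a \<times> 'a)" where
  "swap_blinfun = Blinfun (\<lambda>(x, y). (y, x))"

lemma swap_blinfun_apply [simp]: "blinfun_apply swap_blinfun z = (snd z, fst z)"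
proof -
  have "bounded_linear (\<lambda>z :: 'a \<times> 'a. (snd z, fst z))" by (intro bounded_linear_intros)
  then show ?thesis unfolding swap_blinfun_def by (simp add: case_prod_unfold bounded_linear_Blinfun_apply)
qed

lemma has_derivative_swap: "((\<lambda>(x, y). (y, x)) has_derivative blinfun_apply swap_blinfun) (at z)"
proof -
  have "blinfun_apply swap_blinfun = (\<lambda>(x, y). (y, x))" by (auto simp: fun_eq_iff)
  then show ?thesis using blinfun.bounded_linear_right[of swap_blinfun] bounded_linear_imp_has_derivative by metis
qed

locale lip_localization =
  fixes F :: "real ^ 'n \<Rightarrow> (real ^ 'n) set" and X Y :: "(real ^ 'n) set"
    and h :: "real ^ 'n \<Rightarrow> real ^ 'n" and \<kappa> :: real
  assumes X: "open X" and Y: "open Y" and lip: "\<kappa>-lipschitz_on Y h"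
    and gr: "gph F \<inter> (X \<times> Y) = {(h y, y) | y. y \<in> Y}"
begin

text \<open>The swap is linear and its own inverse, so both derivative fields are the constant
  \<open>swap_blinfun\<close>.\<close>

sublocale lip_chart F "\<lambda>(x, y). (y, x)" "\<lambda>(x, y). (y, x)" "\<lambda>_. swap_blinfun" "\<lambda>_. swap_blinfun" "X \<times> Y" Y h \<kappa>
proof
  have "(\<lambda>(x, y). (y, x)) ` (X \<times> Y) = Y \<times> X" by auto
  then show "open ((\<lambda>(x, y). (y, x)) ` (X \<times> Y))" using X Y by (simp add: open_Times)
  show "open (X \<times> Y)" using X Y by (rule open_Times)
  show "(\<lambda>(x, y). (y, x)) ` (gph F \<inter> (X \<times> Y)) = {(u, h u) |u. u \<in> Y}" unfolding gr by force
qed (use has_derivative_swap Y lip in auto)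

lemma param_eq: "param u = (h u, u)"
  by (simp add: param_def)

lemma SF_adj_bound:
  assumes z: "z \<in> X \<times> Y" and L: "L \<in> SF_adj F z" "(y, x) \<in> L"
  shows "norm y \<le> \<kappa> * norm x"
  by (rule SF_adj_norm_bound[OF L(1) W z _ L(2)]) (rule tangent_cone_norm_bound[OF W gr lip])

lemma SF_adj_nonempty:
  assumes "y \<in> Y"
  shows "SF_adj F (h y, y) \<noteq> {}"
  using SF_nonempty[OF assms] adj_in_SF_adj unfolding param_eq by blast

text \<open>Every graph point in \<open>X \<times> Y\<close> lies in the same localization, which
  gives the SCD property around the point; \<open>SF_adj_bound\<close> with \<open>x = 0\<close>
  gives regularity.\<close>

lemma SCD_regular:
  assumes y: "y \<in> Y"
  shows "SCD_regular F (h y, y)"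
  unfolding SCD_regular_def SCD_around_def SCD_at_def
proof (intro conjI exI[of _ "X \<times> Y"] ballI subsetI)
  have z: "(h y, y) \<in> X \<times> Y" using y gr by blast
  then show "open (X \<times> Y)" "(h y, y) \<in> X \<times> Y" using W by auto
  show "SF_adj F z' \<noteq> {}" if z': "z' \<in> gph F \<inter> X \<times> Y" for z'
  proof -
    obtain y' where "z' = (h y', y')" "y' \<in> Y" using gr z' by blast
    then show ?thesis using SF_adj_nonempty by simp
  qed
  fix L assume L: "L \<in> SF_adj F (h y, y)"
  have "y' = 0" if "(y', 0) \<in> L" for y'
    using SF_adj_bound[OF z L that] by simp
  moreover have "L \<in> Zn" using L by (simp add: SF_adj_def)
  ultimately show "L \<in> Zn_reg" by (simp add: Zn_reg_def)
qed

section \<open>Equality of the two moduli\<close>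

lemma scd_reg_le:
  assumes y: "y \<in> Y"
  shows "scd_reg F (h y, y) \<le> ereal \<kappa>"
  unfolding scd_reg_def
proof (rule Sup_least)
  have z: "(h y, y) \<in> X \<times> Y" using y gr by blast
  fix s assume "s \<in> {ereal (norm y') | y'. \<exists>L x. L \<in> SF_adj F (h y, y) \<and> (y', x) \<in> L \<and> norm x \<le> 1}"
  then obtain y' L x where s: "s = ereal (norm y')" "L \<in> SF_adj F (h y, y)" "(y', x) \<in> L" "norm x \<le> 1" by blast
  have "norm y' \<le> \<kappa> * norm x" by (rule SF_adj_bound[OF z s(2,3)])
  also have "\<dots> \<le> \<kappa>" using s(4) lipschitz_on_nonneg[OF lip] by (intro mult_left_le) auto
  finally show "s \<le> ereal \<kappa>" using s(1) by simp
qed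

text \<open>An empty supremum would be minus infinity in \<open>ereal\<close>; the pair
  \<open>(0, 0)\<close> in some element of \<open>SF_adj\<close> excludes it.\<close>

lemma scd_reg_nonneg:
  assumes y: "y \<in> Y"
  shows "0 \<le> scd_reg F (h y, y)"
proof -
  obtain L where L: "L \<in> SF_adj F (h y, y)" using SF_adj_nonempty[OF y] by blast
  then have "subspace L" by (simp add: SF_adj_def Zn_def)
  then have "(0, 0) \<in> L" using subspace_0 by (simp flip: zero_prod_def)
  then have "ereal (norm (0 :: real ^ 'n)) \<le> scd_reg F (h y, y)"
    unfolding scd_reg_def using L by (intro Sup_upper) force
  then show ?thesis by (simp add: zero_ereal_def)
qed

text \<open>The range consists of the pairs \<open>(A p, p)\<close>, its adjoint of the pairs
  \<open>(adjoint A u, u)\<close>; hence \<open>scd_reg\<close> bounds the norm of the transpose,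
  which is that of \<open>A\<close>.\<close>

lemma norm_limit_le_scd_reg:
  assumes SF: "range (blinfun_apply (swap_blinfun o\<^sub>L lift A)) \<in> SF F z"
    and s: "scd_reg F z \<le> ereal s" "0 \<le> s"
  shows "norm A \<le> s"
proof (rule norm_blinfun_bound[OF s(2)])
  fix p
  have lin: "linear (blinfun_apply A)" by (simp add: blinfun.bounded_linear_right bounded_linear.linear)
  let ?L = "range (blinfun_apply (swap_blinfun o\<^sub>L lift A))"
  show "norm (A p) \<le> s * norm p"
  proof (cases "A p = 0")
    case False
    \<comment> \<open>The unit vector that attains the norm:
      \<open>norm (A p) = A p \<bullet> u = p \<bullet> w\<close>.\<close>
    define u where "u = A p /\<^sub>R norm (A p)"
    define w where "w = adjoint (blinfun_apply A) u"
    have Aw: "A q \<bullet> u = q \<bullet> w" for q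
      unfolding w_def by (simp add: adjoint_works[OF lin])
    have "(u, - w) \<in> ?L\<^sup>\<bottom>"
      by (auto simp: orthogonal_comp_def orthogonal_def Aw)
    then have "(w, u) \<in> adj ?L" unfolding adj_def by force
    moreover have "norm u = 1" using False by (simp add: u_def)
    ultimately have "ereal (norm w) \<le> scd_reg F z"
      unfolding scd_reg_def using adj_in_SF_adj[OF SF] by (intro Sup_upper) force
    then have "norm w \<le> s" using s(1) by (metis ereal_less_eq(3) order_trans)
    have "norm (A p) = A p \<bullet> u" using False by (simp add: u_def dot_square_norm power2_eq_square)
    also have "\<dots> = p \<bullet> w" by (rule Aw)
    also have "\<dots> \<le> norm p * norm w" by (rule norm_cauchy_schwarz)
    also have "\<dots> \<le> norm p * s" using \<open>norm w \<le> s\<close> by (intro mult_left_mono) auto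
    finally show ?thesis by (simp add: mult.commute)
  qed (use s(2) in simp)
qed

text \<open>Otherwise Jacobians of norm above \<open>M\<close> at points tending to \<open>y\<close>
  would accumulate at some \<open>A\<close> of norm at least \<open>M\<close>, whose range lies in
  \<open>SF\<close>.\<close>

lemma fD_bound_near:
  assumes y: "y \<in> Y" and M: "scd_reg F (h y, y) < ereal M"
  shows "\<exists>r>0. \<forall>u\<in>diff_pts \<inter> ball y r. norm (fD u) \<le> M"
proof (rule ccontr)
  assume neg: "\<not> ?thesis"
  \<comment> \<open>The strict inequality with \<open>M\<close> weakens in the limit, so an
    intermediate \<open>s\<close> supplies the contradiction.\<close>
  obtain s where s: "scd_reg F (h y, y) < ereal s" "ereal s < ereal M" using ereal_dense2[OF M] by blast
  have "ereal 0 < ereal s" using scd_reg_nonneg[OF y] s(1) by (metis le_less_trans zero_ereal_def)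
  then have s0: "0 \<le> s" by simp
  have "\<exists>u. u \<in> diff_pts \<and> dist u y < 1 / real (Suc k) \<and> M < norm (fD u)" for k
  proof -
    have "1 / real (Suc k) > 0" by simp
    then have "\<exists>u\<in>diff_pts \<inter> ball y (1 / real (Suc k)). \<not> norm (fD u) \<le> M" using neg by blast
    then show ?thesis by (auto simp: dist_commute not_le)
  qed
  then obtain us where us: "\<And>k. us k \<in> diff_pts" "\<And>k. dist (us k) y < 1 / real (Suc k)"
    "\<And>k. M < norm (fD (us k))" by metis
  have lim: "us \<longlonglongrightarrow> y"
    by (rule metric_tendsto_imp_tendsto[OF LIMSEQ_inverse_real_of_nat])
      (use us(2) in \<open>auto intro!: always_eventually less_imp_le simp: inverse_eq_divide\<close>)
  obtain r A where A: "(\<lambda>k. fD (us (r k))) \<longlonglongrightarrow> A"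
    "range (blinfun_apply (swap_blinfun o\<^sub>L lift A)) \<in> SF F (param y)"
    by (rule limit_Zmat[OF us(1) lim y]) blast
  have "M \<le> norm A"
    by (rule LIMSEQ_le_const[OF tendsto_norm[OF A(1)]]) (use us(3) in \<open>auto intro: less_imp_le\<close>)
  moreover have "norm A \<le> s"
    using A(2) s(1) s0 unfolding param_eq by (intro norm_limit_le_scd_reg) auto
  ultimately show False using s(2) by simp
qed

text \<open>The derivative bound is integrated by the mean value inequality after scalarization; the
  negative sign turns the desired upper bound into a lower one.\<close>

lemma lipschitz_near:
  assumes y: "y \<in> Y" and M: "scd_reg F (h y, y) < ereal M"
  shows "\<exists>r>0. ball y r \<subseteq> Y \<and> M-lipschitz_on (ball y r) h"
proof -
  have "ereal 0 < ereal M" using scd_reg_nonneg[OF y] M by (metis le_less_trans zero_ereal_def)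
  then have M0: "M > 0" by simp
  obtain r1 where r1: "r1 > 0" "\<And>u. u \<in> diff_pts \<Longrightarrow> u \<in> ball y r1 \<Longrightarrow> norm (fD u) \<le> M"
    using fD_bound_near[OF y M] by blast
  obtain r2 where r2: "r2 > 0" "cball y r2 \<subseteq> Y" using Y y open_contains_cball by blast
  define r where "r = min r1 r2"
  have r: "r > 0" "cball y r \<subseteq> Y" "ball y r \<subseteq> ball y r1" "ball y r \<subseteq> Y"
    using r1(1) r2 by (auto simp: r_def)
  have "M-lipschitz_on (ball y r) h"
  proof (rule lipschitz_onI)
    fix a b assume ab: "a \<in> ball y r" "b \<in> ball y r"
    \<comment> \<open>Testing with the increment itself makes the scalar increment equal to its
      squared norm.\<close>
    define e where "e = h b - h a"
    have "- (norm e * (M * norm (b - a))) \<le> - (e \<bullet> h b) - - (e \<bullet> h a)"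
    proof (rule lipschitz_mean_value_ge[OF _ nondiff_negligible[OF r(2)] ab])
      show "(norm e * \<kappa>)-lipschitz_on (ball y r) (\<lambda>u. - (e \<bullet> h u))"
      proof (rule lipschitz_onI)
        fix p q assume "p \<in> ball y r" "q \<in> ball y r"
        then have pq: "p \<in> Y" "q \<in> Y" using r(4) by auto
        have "dist (- (e \<bullet> h p)) (- (e \<bullet> h q)) = \<bar>e \<bullet> (h p - h q)\<bar>"
          by (simp add: dist_real_def inner_diff_right abs_minus_commute)
        also have "\<dots> \<le> norm e * dist (h p) (h q)"
          unfolding dist_norm by (rule Cauchy_Schwarz_ineq2)
        also have "\<dots> \<le> norm e * (\<kappa> * dist p q)"
          by (intro mult_left_mono lipschitz_onD[OF lip pq]) simp
        finally show "dist (- (e \<bullet> h p)) (- (e \<bullet> h q)) \<le> norm e * \<kappa> * dist p q" by (simp only: mult.assoc)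
      qed (use lipschitz_on_nonneg[OF lip] in simp)
      fix u assume "u \<in> ball y r" "u \<notin> ball y r - diff_pts"
      then have u: "u \<in> diff_pts" "norm (fD u) \<le> M" using r1(2) r(3) by auto
      have "((\<lambda>u. - (e \<bullet> h u)) has_derivative (\<lambda>p. - (e \<bullet> fD u p))) (at u)"
        by (intro has_derivative_minus has_derivative_inner_right fD u)
      moreover have "e \<bullet> fD u (b - a) \<le> norm e * (M * norm (b - a))"
      proof -
        have "e \<bullet> fD u (b - a) \<le> norm e * norm (fD u (b - a))" by (rule norm_cauchy_schwarz)
        also have "\<dots> \<le> norm e * (M * norm (b - a))"
          using norm_blinfun[of "fD u" "b - a"] u(2)
          by (intro mult_left_mono order_trans[OF norm_blinfun] mult_right_mono) auto
        finally show ?thesis .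
      qed
      ultimately show "\<exists>f'. ((\<lambda>u. - (e \<bullet> h u)) has_derivative f') (at u)
          \<and> - (norm e * (M * norm (b - a))) \<le> f' (b - a)"
        by (intro exI[of _ "\<lambda>p. - (e \<bullet> fD u p)"]) simp
    qed
    then have "e \<bullet> e \<le> norm e * (M * norm (b - a))" by (simp add: e_def inner_diff_right)
    then have "norm e * norm e \<le> norm e * (M * norm (b - a))"
      by (simp add: dot_square_norm power2_eq_square)
    then have "norm e \<le> M * norm (b - a)"
      using M0 by (cases "e = 0") auto
    then show "dist (h a) (h b) \<le> M * dist a b" by (simp add: e_def dist_norm norm_minus_commute)
  qed (use M0 in simp)
  then show ?thesis using r(1,4) by blast
qed

text \<open>Every real \<open>M\<close> above \<open>scd_reg\<close> is positive and a Lipschitz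
  constant of \<open>h\<close> near \<open>y\<close>, hence an admissible regularity
  constant.\<close>

lemma reg_modulus_le_scd_reg:
  assumes y: "y \<in> Y"
  shows "reg_modulus F (h y, y) \<le> scd_reg F (h y, y)"
proof (rule dense_ge)
  fix m assume m: "scd_reg F (h y, y) < m"
  show "reg_modulus F (h y, y) \<le> m"
  proof (cases m)
    case (real M)
    then have M: "scd_reg F (h y, y) < ereal M" using m by simp
    have "ereal 0 < ereal M" using scd_reg_nonneg[OF y] M by (metis le_less_trans zero_ereal_def)
    then have M0: "M > 0" by simp
    obtain r where r: "r > 0" "ball y r \<subseteq> Y" "M-lipschitz_on (ball y r) h" using lipschitz_near[OF y M] by blast
    have "h y \<in> X" using gr y by blast
    then have "metric_reg_const F (h y, y) M"
      by (rule metric_reg_constI[OF X _ r(1,2) gr refl r(3) M0])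
    then have "reg_modulus F (h y, y) \<le> ereal M"
      unfolding reg_modulus_def by (intro Inf_lower) blast
    then show ?thesis using real by simp
  qed (use m in auto)
qed

end

text \<open>For the swap the normalization reads \<open>snd (Z p) = p\<close>. Being affine in
  \<open>Z\<close> it holds on the convex hull, and \<open>Z p = (y, 0)\<close> then forces
  \<open>p = 0\<close>.\<close>

lemma swap_conv_nabla_bar_regular:
  fixes F :: "real ^ 'n \<Rightarrow> (real ^ 'n) set"
  assumes "Z \<in> convex hull nabla_bar (\<lambda>(x, y). (y, x)) F z"
  shows "range (blinfun_apply Z) \<in> Zn_reg"
proof -
  have fd: "frechet_derivative (\<lambda>(x, y). (y, x)) (at z) = blinfun_apply (swap_blinfun :: ((real ^ 'n) \<times> (real ^ 'n)) \<Rightarrow>\<^sub>L _)"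
    by (rule frechet_derivative_at[OF has_derivative_swap, symmetric])
  have snd: "snd (blinfun_apply Z p) = p" for p
  proof -
    let ?S = "(\<lambda>Z. snd (blinfun_apply Z p)) -` {p}"
    have "nabla_bar (\<lambda>(x, y). (y, x)) F z \<subseteq> ?S"
      unfolding nabla_bar_def fd by auto
    moreover have "convex ?S"
      by (rule convex_linear_vimage[OF bounded_linear.linear[OF
            bounded_linear_snd_comp[OF blinfun.bounded_linear_left]] convex_singleton])
    ultimately have "convex hull nabla_bar (\<lambda>(x, y). (y, x)) F z \<subseteq> ?S" by (rule hull_minimal[where S = convex])
    then show ?thesis using assms by auto
  qed
  have "inj (blinfun_apply Z)" by (rule inj_on_inverseI[of _ snd]) (rule snd)
  then have "range (blinfun_apply Z) \<in> Zn" by (rule range_Zn)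
  moreover have "y = 0" if "(y, 0) \<in> range (blinfun_apply Z)" for y
  proof -
    have "\<exists>p. (y, 0) = Z p" using that by auto
    then obtain p where p: "(y, 0) = Z p" ..
    then have "p = 0" using snd[of p] by (metis snd_conv)
    then show ?thesis using p by (simp add: zero_prod_def)
  qed
  ultimately show ?thesis by (simp add: Zn_reg_def)
qed

theorem theorem7p2:
  fixes F :: "real ^ 'n \<Rightarrow> (real ^ 'n) set" and xbar ybar :: "real ^ 'n"
  assumes "(xbar, ybar) \<in> gph F"
    and "locally_closed_around (gph F) (xbar, ybar)"
  shows
    "(strongly_metrically_regular F (xbar, ybar) \<longrightarrow>
        graphically_Lipschitzian F (xbar, ybar) (\<lambda>(x, y). (y, x)) \<and>
        {range (blinfun_apply Z) | Z. Z \<in> convex hull nabla_bar (\<lambda>(x, y). (y, x)) F (xbar, ybar)}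
          \<subseteq> Zn_reg \<and>
        SCD_regular F (xbar, ybar) \<and>
        reg_modulus F (xbar, ybar) = scd_reg F (xbar, ybar)) \<and>
     (\<forall>\<Phi>. graphically_Lipschitzian F (xbar, ybar) \<Phi> \<and>
        {range (blinfun_apply Z) | Z. Z \<in> convex hull nabla_bar \<Phi> F (xbar, ybar)} \<subseteq> Zn_reg \<longrightarrow>
        strongly_metrically_regular F (xbar, ybar))"
proof (intro conjI[of "_ \<longrightarrow> _"] impI allI)
  assume "strongly_metrically_regular F (xbar, ybar)"
  then obtain \<kappa>0 X Y' h where \<kappa>0: "metric_reg_const F (xbar, ybar) \<kappa>0"
    and xX: "open X" "xbar \<in> X" and Y': "open Y'" "ybar \<in> Y'" and h0: "h ybar = xbar"
    and gr': "gph F \<inter> (X \<times> Y') = {(h y, y) | y. y \<in> Y'}"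
    unfolding strongly_metrically_regular_def metrically_regular_def by auto
  \<comment> \<open>Proved for every admissible \<open>\<kappa>\<close> with the same
    \<open>h\<close> and \<open>X\<close>: the infimum defining \<open>reg_modulus\<close> ranges
    over all of them, and only \<open>Y\<close> shrinks with \<open>\<kappa>\<close>.\<close>
  have localization: "\<exists>Y. ybar \<in> Y \<and> lip_localization F X Y h \<kappa>" if \<kappa>: "metric_reg_const F (xbar, ybar) \<kappa>" for \<kappa>
  proof -
    obtain \<rho> where \<rho>: "\<rho> > 0" "ball ybar \<rho> \<subseteq> Y'" "\<kappa>-lipschitz_on (ball ybar \<rho>) h"
      by (rule metric_reg_const_imp_lipschitz[OF \<kappa> xX Y' gr' h0])
    \<comment> \<open>As \<open>h\<close> maps \<open>Y'\<close> into \<open>X\<close>, shrinking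
      the second factor alone preserves the graph description.\<close>
    have "h y \<in> X" if "y \<in> Y'" for y using gr' that by blast
    then have "{(h y, y) | y. y \<in> Y'} \<inter> (X \<times> ball ybar \<rho>) = {(h y, y) | y. y \<in> ball ybar \<rho>}"
      using \<rho>(2) by auto
    moreover have "gph F \<inter> (X \<times> ball ybar \<rho>) = gph F \<inter> (X \<times> Y') \<inter> (X \<times> ball ybar \<rho>)"
      using \<rho>(2) by blast
    ultimately have "gph F \<inter> (X \<times> ball ybar \<rho>) = {(h y, y) | y. y \<in> ball ybar \<rho>}"
      unfolding gr' by simp
    then have "lip_localization F X (ball ybar \<rho>) h \<kappa>"
      using xX(1) \<rho>(3) by (intro lip_localization.intro) auto
    then show ?thesis using \<rho>(1) by (intro exI[of _ "ball ybar \<rho>"]) simp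
  qed
  obtain Y where yY: "ybar \<in> Y" "lip_localization F X Y h \<kappa>0" using localization[OF \<kappa>0] by blast
  interpret lip_localization F X Y h \<kappa>0 by (rule yY(2))
  show "graphically_Lipschitzian F (xbar, ybar) (\<lambda>(x, y). (y, x)) \<and>
        {range (blinfun_apply Z) | Z. Z \<in> convex hull nabla_bar (\<lambda>(x, y). (y, x)) F (xbar, ybar)} \<subseteq> Zn_reg \<and>
        SCD_regular F (xbar, ybar) \<and> reg_modulus F (xbar, ybar) = scd_reg F (xbar, ybar)"
  proof (intro conjI)
    show "graphically_Lipschitzian F (xbar, ybar) (\<lambda>(x, y). (y, x))"
      by (rule graphically_Lipschitzian) (use xX(2) yY(1) in simp)
    show "{range (blinfun_apply Z) | Z. Z \<in> convex hull nabla_bar (\<lambda>(x, y). (y, x)) F (xbar, ybar)} \<subseteq> Zn_reg"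
      using swap_conv_nabla_bar_regular by auto
    show "SCD_regular F (xbar, ybar)" using SCD_regular[OF yY(1)] h0 by simp
    show "reg_modulus F (xbar, ybar) = scd_reg F (xbar, ybar)"
    proof (rule antisym)
      show "reg_modulus F (xbar, ybar) \<le> scd_reg F (xbar, ybar)" using reg_modulus_le_scd_reg[OF yY(1)] h0 by simp
      show "scd_reg F (xbar, ybar) \<le> reg_modulus F (xbar, ybar)"
        unfolding reg_modulus_def
      proof (rule Inf_greatest)
        fix s assume "s \<in> {ereal \<kappa> | \<kappa>. metric_reg_const F (xbar, ybar) \<kappa>}"
        then obtain \<kappa> where \<kappa>: "s = ereal \<kappa>" "metric_reg_const F (xbar, ybar) \<kappa>" by blast
        then obtain Y1 where "ybar \<in> Y1" "lip_localization F X Y1 h \<kappa>" using localization by blast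
        then have "scd_reg F (h ybar, ybar) \<le> ereal \<kappa>" by (intro lip_localization.scd_reg_le)
        then show "scd_reg F (xbar, ybar) \<le> s" using \<kappa>(1) h0 by simp
      qed
    qed
  qed
next
  fix \<Phi>
  assume \<Phi>: "graphically_Lipschitzian F (xbar, ybar) \<Phi> \<and>
        {range (blinfun_apply Z) | Z. Z \<in> convex hull nabla_bar \<Phi> F (xbar, ybar)} \<subseteq> Zn_reg"
  show "strongly_metrically_regular F (xbar, ybar)"
  proof (rule lip_chart_if_graphically_Lipschitzian[OF conjunct1[OF \<Phi>]])
    fix \<Psi> \<Phi>' \<Psi>' W U f K
    assume "lip_chart F \<Phi> \<Psi> \<Phi>' \<Psi>' W U f K" "(xbar, ybar) \<in> W"
    then show ?thesis
      by (rule lip_chart.strongly_metrically_regular_if_conv_regular[OF _ assms(1) _ conjunct2[OF \<Phi>]])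
  qed
qed

end
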